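(* Let $p,q$ be primes and $m,n\ge1$ with $p^m>2$. Let $Q\in\mathcal{LSS}(p^m,q^n,\sigma_Q)$ with $\sigma_Q\wedge\gamma_Q=0_Q$. Then $$\mathrm{Dis}(Q)\cong\mathbb{Z}_p^{m+k}\rtimes_\rho K,$$ where $K$ is an extraspecial $q$-group, $\rho$ is an action of $K$ on $\mathbb{Z}_p^{m+k}$, $q$ divides $p^m-1$, $n$ is even and $0\le k\leq m$. If $q$ is odd then $K$ has exponent $q$.
   Context: A quandle is a set $Q$ with a binary operation $*$ such that every $L_a:b\mapsto a*b$ is a bijection, $a*(b*c)=(a*b)*(a*c)$ and $a*a=a$. The displacement group is $\mathrm{Dis}(Q)=\langle L_aL_b^{-1}: a,b\in Q\rangle$; $Q$ is connected if $\mathrm{Dis}(Q)$ is transitive on $Q$. Congruences are equivalence relations compatible with $*$ and left division; $0_Q$ is equality, $1_Q=Q\times Q$. $Q$ is subdirectly irreducible if the intersection of all congruences $\neq 0_Q$ is $\ne 0_Q$. A subquandle is proper if it has more than one element and is not all of $Q$; a quandle with more than one element is strictly simple if it has no proper subquandles, and locally strictly simple (LSS) if all its proper subquandles are strictly simple. A quandle is abelian if $\mathrm{Dis}(Q)$ is abelian and acts semiregularly; a finite connected quandle is abelian iff it is isomorphic to $(A,* )$ with $A$ an abelian group, $a*b=a+f(b-a)$, $f\in\mathrm{Aut}(A)$. $\sigma_Q$ is the equivalence relation: $a\,\sigma_Q\,b$ iff $\mathrm{Dis}(Q)_a=\mathrm{Dis}(Q)_b$ (point stabilizers). $\gamma_Q$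 is the smallest congruence of $Q$ with abelian factor; $\wedge$ denotes intersection of equivalence relations. For primes $p,q$, $\mathcal{LSS}(p^m,q^n,\sigma_Q)$ denotes the class of finite connected non-abelian subdirectly irreducible LSS quandles having a unique congruence different from $0_Q,1_Q$ (this congruence is then $\gamma_Q$), with factor of size $q^n$ and blocks of size $p^m$, and with the given relation $\sigma_Q$. *)

theory Defs
  imports "HOL-Algebra.Group_Action" "HOL-Algebra.Product_Groups" "HOL-Computational_Algebra.Primes"
begin

section \<open>Quandles\<close>

record 'a magma = "'a partial_object" +
  qop :: "['a, 'a] \<Rightarrow> 'a" (infixl \<open>\<rhd>\<index>\<close> 70)

definition quandle :: "('a, 'b) magma_scheme \<Rightarrow> bool" where
  "quandle Q \<longleftrightarrow>
     (\<forall>a \<in> carrier Q. bij_betw (\<lambda>b. a \<rhd>\<^bsub>Q\<^esub> b) (carrier Q) (carrier Q)) \<and>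
     (\<forall>a \<in> carrier Q. \<forall>b \<in> carrier Q. \<forall>c \<in> carrier Q.
        a \<rhd>\<^bsub>Q\<^esub> (b \<rhd>\<^bsub>Q\<^esub> c) = (a \<rhd>\<^bsub>Q\<^esub> b) \<rhd>\<^bsub>Q\<^esub> (a \<rhd>\<^bsub>Q\<^esub> c)) \<and>
     (\<forall>a \<in> carrier Q. a \<rhd>\<^bsub>Q\<^esub> a = a)"

definition left_div :: "('a, 'b) magma_scheme \<Rightarrow> 'a \<Rightarrow> 'a \<Rightarrow> 'a" where
  "left_div Q a b = inv_into (carrier Q) (\<lambda>c. a \<rhd>\<^bsub>Q\<^esub> c) b"

text \<open>Left translations are cut off outside the carrier, so that they are elements of
  \<^term>\<open>BijGroup (carrier Q)\<close>.\<close>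

definition left_mult :: "('a, 'b) magma_scheme \<Rightarrow> 'a \<Rightarrow> 'a \<Rightarrow> 'a" where
  "left_mult Q a = (\<lambda>b \<in> carrier Q. a \<rhd>\<^bsub>Q\<^esub> b)"

definition Dis :: "('a, 'b) magma_scheme \<Rightarrow> ('a \<Rightarrow> 'a) monoid" where
  "Dis Q = subgroup_generated (BijGroup (carrier Q))
     {left_mult Q a \<otimes>\<^bsub>BijGroup (carrier Q)\<^esub> inv\<^bsub>BijGroup (carrier Q)\<^esub> (left_mult Q b)
       | a b. a \<in> carrier Q \<and> b \<in> carrier Q}"

abbreviation Dis_stabilizer :: "('a, 'b) magma_scheme \<Rightarrow> 'a \<Rightarrow> ('a \<Rightarrow> 'a) set" where
  "Dis_stabilizer Q a \<equiv> stabilizer (Dis Q) (\<lambda>h. h) a"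

definition connected_quandle :: "('a, 'b) magma_scheme \<Rightarrow> bool" where
  "connected_quandle Q \<longleftrightarrow> quandle Q \<and> transitive_action (Dis Q) (carrier Q) (\<lambda>h. h)"

definition abelian_quandle :: "('a, 'b) magma_scheme \<Rightarrow> bool" where
  "abelian_quandle Q \<longleftrightarrow> quandle Q \<and> comm_group (Dis Q) \<and>
     (\<forall>a \<in> carrier Q. Dis_stabilizer Q a = {\<one>\<^bsub>Dis Q\<^esub>})"

section \<open>Congruences and factors\<close>

definition qcongruence :: "('a, 'b) magma_scheme \<Rightarrow> ('a \<times> 'a) set \<Rightarrow> bool" where
  "qcongruence Q r \<longleftrightarrow> equiv (carrier Q) r \<and>
     (\<forall>(a, a') \<in> r. \<forall>(b, b') \<in> r.
        (a \<rhd>\<^bsub>Q\<^esub> b, a' \<rhd>\<^bsub>Q\<^esub> b') \<in> r \<and> (left_div Q a b, left_div Q a' b') \<in> r)"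

abbreviation zero_cong :: "('a, 'b) magma_scheme \<Rightarrow> ('a \<times> 'a) set" where
  "zero_cong Q \<equiv> Id_on (carrier Q)"

abbreviation one_cong :: "('a, 'b) magma_scheme \<Rightarrow> ('a \<times> 'a) set" where
  "one_cong Q \<equiv> carrier Q \<times> carrier Q"

definition qfactor :: "('a, 'b) magma_scheme \<Rightarrow> ('a \<times> 'a) set \<Rightarrow> 'a set magma" where
  "qfactor Q r = \<lparr>carrier = carrier Q // r,
     qop = (\<lambda>A B. \<Union>a \<in> A. \<Union>b \<in> B. r `` {a \<rhd>\<^bsub>Q\<^esub> b})\<rparr>"

text \<open>Intersecting with \<^term>\<open>one_cong Q\<close> makes the empty intersection the full relation
  on the carrier instead of \<^term>\<open>UNIV\<close>.\<close>

definition subdirectly_irreducible :: "('a, 'b) magma_scheme \<Rightarrow> bool" where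
  "subdirectly_irreducible Q \<longleftrightarrow>
     one_cong Q \<inter> \<Inter>{r. qcongruence Q r \<and> r \<noteq> zero_cong Q} \<noteq> zero_cong Q"

definition sigma_rel :: "('a, 'b) magma_scheme \<Rightarrow> ('a \<times> 'a) set" where
  "sigma_rel Q = {(a, b) \<in> carrier Q \<times> carrier Q. Dis_stabilizer Q a = Dis_stabilizer Q b}"

text \<open>The least element is taken with respect to inclusion of relations.\<close>

definition gamma_cong :: "('a, 'b) magma_scheme \<Rightarrow> ('a \<times> 'a) set" where
  "gamma_cong Q = (LEAST r. qcongruence Q r \<and> abelian_quandle (qfactor Q r))"

section \<open>Strictly simple and locally strictly simple quandles\<close>

definition subquandle :: "('a, 'b) magma_scheme \<Rightarrow> 'a set \<Rightarrow> bool" where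
  "subquandle Q S \<longleftrightarrow> S \<subseteq> carrier Q \<and>
     (\<forall>a \<in> S. \<forall>b \<in> S. a \<rhd>\<^bsub>Q\<^esub> b \<in> S \<and> left_div Q a b \<in> S)"

definition proper_subquandle :: "('a, 'b) magma_scheme \<Rightarrow> 'a set \<Rightarrow> bool" where
  "proper_subquandle Q S \<longleftrightarrow> subquandle Q S \<and> (\<exists>a \<in> S. \<exists>b \<in> S. a \<noteq> b) \<and> S \<noteq> carrier Q"

definition strictly_simple :: "('a, 'b) magma_scheme \<Rightarrow> bool" where
  "strictly_simple Q \<longleftrightarrow> quandle Q \<and> (\<exists>a \<in> carrier Q. \<exists>b \<in> carrier Q. a \<noteq> b) \<and>
     (\<nexists>S. proper_subquandle Q S)"

definition locally_strictly_simple :: "('a, 'b) magma_scheme \<Rightarrow> bool" where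
  "locally_strictly_simple Q \<longleftrightarrow> quandle Q \<and>
     (\<forall>S. proper_subquandle Q S \<longrightarrow> strictly_simple (Q\<lparr>carrier := S\<rparr>))"

text \<open>The arguments are the size of the blocks, the size of the factor and the prescribed
  relation \<^term>\<open>sigma_rel Q\<close>.\<close>

definition LSS_class :: "nat \<Rightarrow> nat \<Rightarrow> ('a \<times> 'a) set \<Rightarrow> 'a magma set" where
  "LSS_class c d s = {Q. finite (carrier Q) \<and> connected_quandle Q \<and> \<not> abelian_quandle Q \<and>
     subdirectly_irreducible Q \<and> locally_strictly_simple Q \<and>
     (\<exists>\<mu>. {r. qcongruence Q r \<and> r \<noteq> zero_cong Q \<and> r \<noteq> one_cong Q} = {\<mu>} \<and>
          card (carrier (qfactor Q \<mu>)) = d \<and> (\<forall>B \<in> carrier Q // \<mu>. card B = c)) \<and>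
     sigma_rel Q = s}"

section \<open>Groups\<close>

definition elem_abelian_power :: "nat \<Rightarrow> nat \<Rightarrow> (nat \<Rightarrow> int) monoid" where
  "elem_abelian_power p d = product_group {..<d} (\<lambda>_. integer_mod_group p)"

definition semidirect_product ::
    "('a, 'c) monoid_scheme \<Rightarrow> ('b, 'd) monoid_scheme \<Rightarrow> ('b \<Rightarrow> 'a \<Rightarrow> 'a) \<Rightarrow> ('a \<times> 'b) monoid" where
  "semidirect_product N K \<rho> = \<lparr>carrier = carrier N \<times> carrier K,
     monoid.mult = (\<lambda>(a, x) (b, y). (a \<otimes>\<^bsub>N\<^esub> \<rho> x b, x \<otimes>\<^bsub>K\<^esub> y)),
     one = (\<one>\<^bsub>N\<^esub>, \<one>\<^bsub>K\<^esub>)\<rparr>"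

lemma group_semidirect_product:
  assumes "group N" "group K" "\<rho> \<in> hom K (AutoGroup N)"
  shows "group (semidirect_product N K \<rho>)"
proof -
  interpret N: group N by fact
  interpret K: group K by fact
  interpret A: group "AutoGroup N" by (rule N.AutoGroup)
  interpret h: group_hom K "AutoGroup N" \<rho>
    by (simp add: group_hom_def group_hom_axioms_def assms A.group_axioms)
  have aut: "\<rho> x \<in> auto N" if "x \<in> carrier K" for x
    using h.hom_closed[OF that] by (simp add: AutoGroup_def)
  have bij: "\<rho> x \<in> Bij (carrier N)" and hom: "\<rho> x \<in> hom N N" if "x \<in> carrier K" for x
    using aut[OF that] by (auto simp: auto_def)
  have cl: "\<rho> x a \<in> carrier N" if "x \<in> carrier K" "a \<in> carrier N" for x a
    using hom[OF that(1)] that(2) by (auto simp: hom_def)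
  have mult: "\<rho> x (a \<otimes>\<^bsub>N\<^esub> b) = \<rho> x a \<otimes>\<^bsub>N\<^esub> \<rho> x b"
    if "x \<in> carrier K" "a \<in> carrier N" "b \<in> carrier N" for x a b
    using hom[OF that(1)] that(2,3) by (auto simp: hom_def)
  have comp: "\<rho> (x \<otimes>\<^bsub>K\<^esub> y) a = \<rho> x (\<rho> y a)"
    if "x \<in> carrier K" "y \<in> carrier K" "a \<in> carrier N" for x y a
    using h.hom_mult[OF that(1,2)] bij[OF that(1)] bij[OF that(2)] that(3)
    by (simp add: AutoGroup_def BijGroup_def compose_def)
  have one: "\<rho> \<one>\<^bsub>K\<^esub> a = a" if "a \<in> carrier N" for a
    using h.hom_one that by (simp add: AutoGroup_def BijGroup_def)
  show ?thesis
  proof (rule groupI)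
    fix u assume "u \<in> carrier (semidirect_product N K \<rho>)"
    then obtain a x where u: "u = (a, x)" "a \<in> carrier N" "x \<in> carrier K"
      by (auto simp: semidirect_product_def)
    let ?v = "(\<rho> (inv\<^bsub>K\<^esub> x) (inv\<^bsub>N\<^esub> a), inv\<^bsub>K\<^esub> x)"
    have "\<rho> (inv\<^bsub>K\<^esub> x) (inv\<^bsub>N\<^esub> a) \<otimes>\<^bsub>N\<^esub> \<rho> (inv\<^bsub>K\<^esub> x) a = \<one>\<^bsub>N\<^esub>"
      using u mult[of "inv\<^bsub>K\<^esub> x" "inv\<^bsub>N\<^esub> a" a, symmetric]
        hom_one[OF hom N.group_axioms N.group_axioms, of "inv\<^bsub>K\<^esub> x"] by simp
    then show "\<exists>v\<in>carrier (semidirect_product N K \<rho>).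
        v \<otimes>\<^bsub>semidirect_product N K \<rho>\<^esub> u = \<one>\<^bsub>semidirect_product N K \<rho>\<^esub>"
      using u cl by (intro bexI[of _ ?v]) (auto simp: semidirect_product_def simp del: h.hom_inv)
  qed (auto simp: semidirect_product_def cl mult comp one N.m_assoc K.m_assoc
         simp del: h.hom_mult h.hom_one)
qed

definition group_center :: "('a, 'b) monoid_scheme \<Rightarrow> 'a set" where
  "group_center G = {z \<in> carrier G. \<forall>x \<in> carrier G. z \<otimes>\<^bsub>G\<^esub> x = x \<otimes>\<^bsub>G\<^esub> z}"

definition elementary_abelian :: "nat \<Rightarrow> ('a, 'b) monoid_scheme \<Rightarrow> bool" where
  "elementary_abelian q G \<longleftrightarrow> comm_group G \<and> (\<forall>x \<in> carrier G. x [^]\<^bsub>G\<^esub> q = \<one>\<^bsub>G\<^esub>)"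

text \<open>The center has order \<open>q\<close> (hence is cyclic) and the central factor is a non-trivial
  elementary abelian \<open>q\<close>-group.\<close>

definition extraspecial :: "nat \<Rightarrow> ('a, 'b) monoid_scheme \<Rightarrow> bool" where
  "extraspecial q G \<longleftrightarrow> prime q \<and> group G \<and> (\<exists>r. order G = q ^ r) \<and>
     card (group_center G) = q \<and>
     elementary_abelian q (G Mod group_center G) \<and> \<not> trivial_group (G Mod group_center G)"

text \<open>The value for groups of unbounded element order is irrelevant.\<close>

definition group_exponent :: "('a, 'b) monoid_scheme \<Rightarrow> nat" where
  "group_exponent G = (LEAST e. 0 < e \<and> (\<forall>x \<in> carrier G. x [^]\<^bsub>G\<^esub> e = \<one>\<^bsub>G\<^esub>))"

end

theory Submission
  imports Defs "HOL-Algebra.Sylow" "HOL-Algebra.Multiplicative_Group"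
begin

text \<open>Let \<open>D\<close> be the displacement group of \<open>Q\<close> and \<open>r\<close> the unique congruence strictly between equality and the
full relation. A class of \<open>r\<close> is a proper subquandle, so it is strictly simple. The factor by \<open>r\<close> has no
proper subquandle either: its preimage would be a proper subquandle of \<open>Q\<close> that strictly contains a
class with at least two points, and such a subquandle is not strictly simple.

A strictly simple quandle is generated by any two of its points, so an automorphism fixing two points
is trivial. If the size is a power of a prime \<open>p\<close> and the automorphism group is transitive, then that
group is a Frobenius group whose kernel is a Sylow \<open>p\<close>-subgroup. The kernel \<open>P\<close> is regular; it is
elementary abelian, because the orbit of a point under its centre, or under its elements of order \<open>p\<close>,
is a subquandle. It follows that the quandle is medial and that automorphisms fixing a common point
commute, a form of Schur's lemma. All this is the locale \<open>simple_homogeneous\<close>.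

Applied to the factor, this shows that the factor is abelian. So \<open>r\<close> is the congruence \<open>\<gamma>\<close>, and the
kernel \<open>Ker\<close> of the action of \<open>D\<close> on the classes contains all commutators, all \<open>q\<close>-th powers and all
point stabilizers of \<open>D\<close>. Applied to the classes, it shows that the elements of \<open>Ker\<close> acting on each
class as a translation form an elementary abelian normal \<open>p\<close>-subgroup \<open>N\<close>, and that \<open>Ker\<close> modulo \<open>N\<close> is
abelian. The hypothesis that \<open>\<sigma>\<close> and \<open>\<gamma>\<close> intersect in equality says that some point stabilizer moves a
point of the class of that point, so it provides an element \<open>h\<close> of \<open>Ker\<close> outside \<open>N\<close>.

The crucial fact is \<open>fixed_points_section\<close>: the set \<open>S\<close> of fixed points of \<open>h\<close> meets every class in
exactly one point. Let \<open>K\<close> be generated by the displacements \<open>L a (L b)\<^sup>-\<^sup>1\<close> with \<open>a\<close> and \<open>b\<close> in \<open>S\<close>. It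
preserves \<open>S\<close>, so its elements in \<open>Ker\<close> fix \<open>S\<close> pointwise; such an element of \<open>N\<close> is trivial. On the
other hand \<open>L x (L t)\<^sup>-\<^sup>1\<close> lies in \<open>N\<close> for \<open>x\<close> and \<open>t\<close> in one class (\<open>left_mult_quotient_N\<close>), so \<open>D\<close> is the
semidirect product of \<open>N\<close> and \<open>K\<close>.

To see that \<open>K\<close> is extraspecial, let \<open>L s\<close> with \<open>s\<close> in \<open>S\<close> act on \<open>K\<close> by conjugation. The action is
trivial on the central subgroup \<open>M\<close> of elements of \<open>K\<close> in \<open>Ker\<close>, the elements \<open>x \<alpha>(x)\<^sup>-\<^sup>1\<close> generate \<open>K\<close>,
and no invariant subgroup lies strictly between \<open>M\<close> and \<open>K\<close> because \<open>S\<close> is strictly simple. By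
\<open>extraspecial_structure\<close> this forces \<open>M\<close> to be of exponent \<open>q\<close> and to be the centre of \<open>K\<close>, and for odd \<open>q\<close>
it forces \<open>K\<close> to be of exponent \<open>q\<close>. Moreover \<open>M\<close>
is cyclic: its nontrivial elements centralize no nontrivial element of the \<open>p\<close>-group \<open>N\<close>, and a
noncyclic abelian group cannot act on an abelian group of coprime order in that way
(\<open>pow_eq_one_if_fixed_point_free_rank_two\<close>). An element of order \<open>q\<close> in \<open>M\<close> acts on a class of size \<open>p ^ m\<close>
with a single fixed point, so \<open>q\<close> divides \<open>p ^ m - 1\<close>. As \<open>K\<close> has order \<open>q ^ (n + 1)\<close> and centre of order \<open>q\<close>,
\<open>n\<close> is even. Finally \<open>N\<close> is transitive on a class, and an element of \<open>N\<close> with fixed points in two classes is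
trivial; so the order of \<open>N\<close> lies between \<open>p ^ m\<close> and \<open>p ^ (2 * m)\<close>.\<close>

section \<open>Fixed points of groups of prime power order\<close>

text \<open>The size of an orbit divides \<open>p ^ k\<close>, so it is divisible by \<open>p\<close> unless the orbit is a fixed point.\<close>

lemma (in group_action) card_fixed_points_mod:
  assumes p: "prime p" and G: "order G = p ^ k" and E: "finite E"
  shows "card E mod p = card {x \<in> E. \<forall>g\<in>carrier G. \<phi> g x = x} mod p"
proof -
  let ?F = "{x \<in> E. \<forall>g\<in>carrier G. \<phi> g x = x}"
  let ?C = "{orbit G \<phi> x | x. x \<in> E - ?F}"
  have sub: "orbit G \<phi> x \<subseteq> E" if "x \<in> E" for x
    using that element_image by (auto simp: orbit_def)
  have U: "\<Union>?C = E - ?F"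
  proof
    show "\<Union>?C \<subseteq> E - ?F"
    proof
      fix y assume "y \<in> \<Union>?C"
      then obtain x where x: "x \<in> E" "x \<notin> ?F" "y \<in> orbit G \<phi> x" by auto
      have y: "y \<in> E" using sub x by auto
      have "x \<in> orbit G \<phi> y" using orbit_sym x y by auto
      have "y \<notin> ?F"
      proof
        assume yF: "y \<in> ?F"
        then have "x = y" using \<open>x \<in> orbit G \<phi> y\<close> by (auto simp: orbit_def)
        then show False using x(2) yF by simp
      qed
      then show "y \<in> E - ?F" using y by auto
    qed
    show "E - ?F \<subseteq> \<Union>?C" using orbit_refl by auto
  qed
  have fin: "finite (\<Union>?C)" using U E by simp
  have "p dvd card (\<Union>?C)"
  proof (rule dvd_partition[OF fin])
    show "\<forall>c\<in>?C. p dvd card c"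
    proof
      fix c assume "c \<in> ?C"
      then obtain x where x: "x \<in> E" "x \<notin> ?F" "c = orbit G \<phi> x" by auto
      have "card c dvd p ^ k"
        using orbit_stabilizer_theorem[OF x(1)] G x(3) by (metis dvd_triv_left)
      then obtain i where i: "card c = p ^ i" using p divides_primepow_nat by blast
      obtain g where g: "g \<in> carrier G" "\<phi> g x \<noteq> x" using x by auto
      have "{x, \<phi> g x} \<subseteq> c" using g x orbit_refl by (auto simp: orbit_def)
      moreover have "finite c" using sub[OF x(1)] x(3) E finite_subset by auto
      ultimately have "card {x, \<phi> g x} \<le> card c" by (intro card_mono)
      then have "card c \<noteq> 1" using g by simp
      then have "i \<noteq> 0" using i by (metis power_0)
      then show "p dvd card c" using i by simp
    qed
    show "\<forall>c1\<in>?C. \<forall>c2\<in>?C. c1 \<noteq> c2 \<longrightarrow> c1 \<inter> c2 = {}"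
      using disjoint_union by (fastforce simp: orbits_def)
  qed
  moreover have "card E = card ?F + card (E - ?F)"
    using E by (metis (no_types, lifting) card_Diff_subset card_mono finite_subset le_add_diff_inverse mem_Collect_eq subsetI)
  ultimately show ?thesis using U by (auto elim!: dvdE)
qed

lemma (in group) prime_power_group_center_nontrivial:
  assumes p: "prime p" and G: "order G = p ^ k" and k: "1 \<le> k"
  shows "\<exists>z\<in>group_center G. z \<noteq> \<one>"
proof -
  have pos: "0 < order G" using p G by (simp add: prime_gt_0_nat)
  then have fin: "finite (carrier G)" using order_gt_0_iff_finite by blast
  let ?F = "{x \<in> carrier G. \<forall>g\<in>carrier G. (\<lambda>h \<in> carrier G. g \<otimes> h \<otimes> inv g) x = x}"
  have "card ?F mod p = order G mod p"
    using group_action.card_fixed_points_mod[OF action_by_conjugation p G fin] by (simp add: order_def)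
  also have "\<dots> = 0" using G k by simp
  finally have "p dvd card ?F" by (simp only: dvd_eq_mod_eq_0)
  moreover have one: "\<one> \<in> ?F" by simp
  moreover have "finite ?F" using fin by simp
  ultimately have "\<not> card ?F \<le> 1"
    using p by (metis (no_types, lifting) card_0_eq dvd_imp_le empty_iff le_less_trans neq0_conv not_le prime_gt_1_nat less_le_trans)
  moreover have "card ?F \<le> 1" if "?F \<subseteq> {\<one>}"
    by (rule order.trans[OF card_mono[OF _ that]]) simp_all
  ultimately have "\<not> ?F \<subseteq> {\<one>}" by blast
  then obtain z where z: "z \<in> ?F" "z \<noteq> \<one>" by blast
  have "z \<otimes> x = x \<otimes> z" if "x \<in> carrier G" for x
  proof -
    have "x \<otimes> z \<otimes> inv x = z" using z that by auto
    then show ?thesis using z that by (metis (no_types, lifting) inv_solve_right' mem_Collect_eq m_closed)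
  qed
  then show ?thesis using z by (auto simp: group_center_def)
qed

section \<open>Endomorphisms without coinvariants\<close>

lemma (in group) coset_eq_iff_mult_inv:
  assumes "subgroup W G" "x \<in> carrier G" "y \<in> carrier G"
  shows "W #> x = W #> y \<longleftrightarrow> x \<otimes> inv y \<in> W"
  using assms by (metis is_group rcos_self repr_independence subgroup.rcos_module)

lemma (in group_hom) card_kernel_mult_card_image:
  assumes "finite (carrier G)"
  shows "card (kernel G H h) * card (h ` carrier G) = order G"
proof -
  let ?I = "H\<lparr>carrier := h ` carrier G\<rparr>"
  have I: "group ?I" using img_is_subgroup H.subgroup_imp_group by blast
  interpret i: group_hom G ?I h
    using I G.is_group by (auto simp: group_hom_def group_hom_axioms_def hom_def)
  have k: "kernel G ?I h = kernel G H h" by (simp add: kernel_def)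
  have "card (carrier (G Mod kernel G ?I h)) = card (carrier ?I)"
    by (rule iso_same_order[OF i.FactGroup_iso_set, unfolded order_def]) simp
  then show ?thesis
    using G.lagrange[OF subgroup_kernel] by (simp add: k FactGroup_def mult.commute)
qed

text \<open>Modulo \<open>W\<close> the group is abelian, so \<open>x \<mapsto> x \<alpha>(x)\<^sup>-\<^sup>1\<close> is an endomorphism of the factor group. The
generation hypothesis makes it surjective, and by finiteness it is injective.\<close>

lemma (in group) twisted_fixed_points_subset:
  assumes fin: "finite (carrier G)" and W: "subgroup W G"
    and comm: "\<And>x y. x \<in> carrier G \<Longrightarrow> y \<in> carrier G \<Longrightarrow> x \<otimes> y \<otimes> inv (y \<otimes> x) \<in> W"
    and \<alpha>: "\<alpha> \<in> hom G G" and \<alpha>W: "\<And>w. w \<in> W \<Longrightarrow> \<alpha> w \<in> W"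
    and gen: "generate G {x \<otimes> inv (\<alpha> x) | x. x \<in> carrier G} = carrier G"
    and x: "x \<in> carrier G" "x \<otimes> inv (\<alpha> x) \<in> W"
  shows "x \<in> W"
proof -
  interpret N: normal W G
  proof (rule normal_invI[OF W])
    fix x h assume x: "x \<in> carrier G" and h: "h \<in> W"
    have hc: "h \<in> carrier G" using W h subgroup.mem_carrier by metis
    have "x \<otimes> h \<otimes> inv (h \<otimes> x) \<otimes> h \<in> W" using comm[OF x hc] h W by (simp add: subgroup.m_closed)
    then show "x \<otimes> h \<otimes> inv x \<in> W" using x hc by (simp add: inv_mult_group m_assoc)
  qed
  interpret Q: group "G Mod W" by (rule N.factorgroup_is_group)
  interpret a: group_hom G G \<alpha> by unfold_locales (rule \<alpha>)
  define \<delta> where "\<delta> x = W #> (x \<otimes> inv (\<alpha> x))" for x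
  have ac: "\<alpha> x \<in> carrier G" if "x \<in> carrier G" for x using that by simp
  have mult: "(W #> x) \<otimes>\<^bsub>G Mod W\<^esub> (W #> y) = W #> (x \<otimes> y)" if "x \<in> carrier G" "y \<in> carrier G" for x y
    using that by (simp add: N.rcos_sum)
  have car: "W #> x \<in> carrier (G Mod W)" if "x \<in> carrier G" for x
    using that by (auto simp: carrier_FactGroup)
  have swap: "W #> (x \<otimes> y) = W #> (y \<otimes> x)" if "x \<in> carrier G" "y \<in> carrier G" for x y
    using that comm by (simp add: coset_eq_iff_mult_inv[OF W])
  have hom: "\<delta> \<in> hom G (G Mod W)"
  proof (rule homI)
    fix x assume "x \<in> carrier G" then show "\<delta> x \<in> carrier (G Mod W)" by (simp add: \<delta>_def car)
  next
    fix x y assume x: "x \<in> carrier G" and y: "y \<in> carrier G"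
    have "\<delta> (x \<otimes> y) = W #> (x \<otimes> (y \<otimes> inv (\<alpha> y) \<otimes> inv (\<alpha> x)))"
      using x y by (simp add: \<delta>_def inv_mult_group m_assoc)
    also have "\<dots> = (W #> x) \<otimes>\<^bsub>G Mod W\<^esub> (W #> (y \<otimes> inv (\<alpha> y) \<otimes> inv (\<alpha> x)))"
      using x y by (intro mult[symmetric]) auto
    also have "W #> (y \<otimes> inv (\<alpha> y) \<otimes> inv (\<alpha> x)) = W #> (inv (\<alpha> x) \<otimes> (y \<otimes> inv (\<alpha> y)))"
      using x y by (intro swap) auto
    also have "(W #> x) \<otimes>\<^bsub>G Mod W\<^esub> (W #> (inv (\<alpha> x) \<otimes> (y \<otimes> inv (\<alpha> y)))) = W #> ((x \<otimes> inv (\<alpha> x)) \<otimes> (y \<otimes> inv (\<alpha> y)))"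
      using x y mult[of x "inv (\<alpha> x) \<otimes> (y \<otimes> inv (\<alpha> y))"] by (simp add: m_assoc)
    also have "\<dots> = \<delta> x \<otimes>\<^bsub>G Mod W\<^esub> \<delta> y"
      using x y mult[of "x \<otimes> inv (\<alpha> x)" "y \<otimes> inv (\<alpha> y)"] by (simp add: \<delta>_def)
    finally show "\<delta> (x \<otimes> y) = \<delta> x \<otimes>\<^bsub>G Mod W\<^esub> \<delta> y" .
  qed
  interpret d: group_hom G "G Mod W" \<delta> by unfold_locales (rule hom)
  interpret \<pi>: group_hom G "G Mod W" "\<lambda>x. W #> x" by unfold_locales (rule N.r_coset_hom_Mod)
  let ?S = "{x \<otimes> inv (\<alpha> x) | x. x \<in> carrier G}"
  have "carrier (G Mod W) = (\<lambda>x. W #> x) ` generate G ?S"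
    using gen by (simp add: carrier_FactGroup)
  also have "\<dots> = generate (G Mod W) ((\<lambda>x. W #> x) ` ?S)"
    by (rule \<pi>.generate_img[symmetric]) auto
  also have "(\<lambda>x. W #> x) ` ?S = \<delta> ` carrier G"
    unfolding \<delta>_def by (simp only: Setcompr_eq_image image_image)
  also have "generate (G Mod W) (\<delta> ` carrier G) = \<delta> ` carrier G"
    using Q.generateI[OF d.img_is_subgroup] by simp
  finally have surj: "\<delta> ` carrier G = carrier (G Mod W)" ..
  have "card (kernel G (G Mod W) \<delta>) * card (rcosets W) = card W * card (rcosets W)"
    using d.card_kernel_mult_card_image[OF fin] surj lagrange[OF W]
    by (metis FactGroup_def mult.commute partial_object.select_convs(1))
  moreover have "card (rcosets W) > 0"
    using lagrange_finite[OF fin W] fin order_gt_0_iff_finite by (metis nat_0_less_mult_iff)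
  ultimately have cards: "card (kernel G (G Mod W) \<delta>) = card W" by simp
  have "W \<subseteq> kernel G (G Mod W) \<delta>"
  proof
    fix w assume w: "w \<in> W"
    then have "w \<otimes> inv (\<alpha> w) \<in> W" using \<alpha>W W by (simp add: subgroup.m_closed subgroup.m_inv_closed)
    then show "w \<in> kernel G (G Mod W) \<delta>"
      using w W subgroup.mem_carrier[OF W] by (simp add: kernel_def \<delta>_def coset_join2)
  qed
  moreover have "finite (kernel G (G Mod W) \<delta>)" using fin by (simp add: kernel_def)
  ultimately have "W = kernel G (G Mod W) \<delta>" using cards by (intro card_subset_eq) auto
  moreover have "x \<in> kernel G (G Mod W) \<delta>"
    using x W by (simp add: kernel_def \<delta>_def coset_join2)
  ultimately show ?thesis by simp
qed

section \<open>Powers in groups of class two\<close>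

text \<open>Moving all factors \<open>x\<close> to the left past the factors \<open>y\<close> produces \<open>n * (n - 1) div 2\<close> copies of \<open>c\<close>.\<close>

lemma (in group) central_commutator_mult_pow:
  assumes x: "x \<in> carrier G" and y: "y \<in> carrier G" and c: "c \<in> carrier G"
    and yx: "y \<otimes> x = x \<otimes> y \<otimes> c" and cx: "c \<otimes> x = x \<otimes> c" and cy: "c \<otimes> y = y \<otimes> c"
  shows "(x \<otimes> y) [^] (n::nat) = x [^] n \<otimes> y [^] n \<otimes> c [^] (n * (n - 1) div 2)"
proof -
  have cxn: "c [^] (k::nat) \<otimes> x = x \<otimes> c [^] k" for k
    using cx x c by (simp add: group_commutes_pow)
  have cyn: "c [^] (k::nat) \<otimes> y = y \<otimes> c [^] k" for k
    using cy y c by (simp add: group_commutes_pow)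
  have cyn': "c [^] (k::nat) \<otimes> (y \<otimes> z) = y \<otimes> (c [^] k \<otimes> z)" if "z \<in> carrier G" for k z
    using cyn[of k] that y c by (metis m_assoc nat_pow_closed)
  have ynx: "y [^] n \<otimes> x = x \<otimes> y [^] n \<otimes> c [^] n" for n :: nat
  proof (induction n)
    case 0 then show ?case using x by simp
  next
    case (Suc n)
    have "y [^] Suc n \<otimes> x = y [^] n \<otimes> (y \<otimes> x)" using x y by (simp add: m_assoc)
    also have "\<dots> = y [^] n \<otimes> x \<otimes> (y \<otimes> c)" using x y c yx by (simp add: m_assoc)
    also have "\<dots> = x \<otimes> y [^] n \<otimes> (c [^] n \<otimes> y) \<otimes> c" using x y c by (simp add: Suc m_assoc)
    also have "\<dots> = x \<otimes> y [^] Suc n \<otimes> c [^] Suc n" using x y c by (simp add: cyn m_assoc)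
    finally show ?case .
  qed
  show ?thesis
  proof (induction n)
    case 0 then show ?case by simp
  next
    case (Suc n)
    let ?t = "n * (n - 1) div 2"
    have t: "Suc n * (Suc n - 1) div 2 = n + ?t"
    proof (cases n)
      case (Suc m)
      have "Suc n * (Suc n - 1) = 2 * n + n * (n - 1)" using Suc by (simp add: algebra_simps)
      then show ?thesis by simp
    qed simp
    have "(x \<otimes> y) [^] Suc n = x [^] n \<otimes> y [^] n \<otimes> (c [^] ?t \<otimes> x) \<otimes> y"
      using x y c by (simp add: Suc m_assoc)
    also have "\<dots> = x [^] n \<otimes> (y [^] n \<otimes> x) \<otimes> (c [^] ?t \<otimes> y)"
      using x y c by (simp add: cxn m_assoc)
    also have "\<dots> = x [^] n \<otimes> x \<otimes> y [^] n \<otimes> (c [^] n \<otimes> y) \<otimes> c [^] ?t"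
      using x y c by (simp add: cyn cyn' ynx m_assoc)
    also have "\<dots> = x [^] Suc n \<otimes> y [^] Suc n \<otimes> (c [^] n \<otimes> c [^] ?t)"
      using x y c by (simp add: cyn' m_assoc)
    also have "c [^] n \<otimes> c [^] ?t = c [^] (Suc n * (Suc n - 1) div 2)"
      using c by (simp only: t nat_pow_mult)
    finally show ?case .
  qed
qed

section \<open>Internal semidirect products\<close>

text \<open>The action is conjugation, transported to \<open>E\<close> along the isomorphism.\<close>

lemma (in group) internal_semidirect_product:
  assumes N: "N \<lhd> G" and K: "subgroup K G" and NK: "N \<inter> K = {\<one>}"
    and gen: "\<And>g. g \<in> carrier G \<Longrightarrow> \<exists>v\<in>N. \<exists>k\<in>K. g = v \<otimes> k"
    and E: "group E" and f: "f \<in> iso (G\<lparr>carrier := N\<rparr>) E"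
  shows "\<exists>\<rho>. \<rho> \<in> hom (G\<lparr>carrier := K\<rparr>) (AutoGroup E) \<and>
             G \<cong> semidirect_product E (G\<lparr>carrier := K\<rparr>) \<rho>"
proof -
  interpret N: normal N G by fact
  interpret K: subgroup K G by fact
  interpret E: group E by fact
  have Kg: "group (G\<lparr>carrier := K\<rparr>)" using K subgroup_imp_group by blast
  have cancel: "inv k \<otimes> (k \<otimes> x) = x" if "k \<in> K" "x \<in> carrier G" for k x
    using that by (simp flip: m_assoc)
  define f' where "f' = inv_into N f"
  have bij: "bij_betw f N (carrier E)" using f by (simp add: iso_def)
  have ff': "f (f' e) = e" if "e \<in> carrier E" for e
    using bij that by (simp add: f'_def bij_betw_inv_into_right)
  have f'f: "f' (f v) = v" if "v \<in> N" for v
    using bij that by (simp add: f'_def bij_betw_inv_into_left)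
  have f'N: "f' e \<in> N" if "e \<in> carrier E" for e
    using bij that by (metis bij_betwE bij_betw_inv_into f'_def)
  have fE: "f v \<in> carrier E" if "v \<in> N" for v using bij that by (auto simp: bij_betw_def)
  have fm: "f (v \<otimes> w) = f v \<otimes>\<^bsub>E\<^esub> f w" if "v \<in> N" "w \<in> N" for v w
    using f that by (simp add: iso_def hom_def)
  have f'c: "f' e \<in> carrier G" if "e \<in> carrier E" for e using f'N[OF that] by simp
  have cN: "k \<otimes> v \<otimes> inv k \<in> N" if "k \<in> K" "v \<in> N" for k v
    using that N.inv_op_closed2 by simp
  define \<rho> where "\<rho> k = (\<lambda>e\<in>carrier E. f (k \<otimes> f' e \<otimes> inv k))" for k
  have \<rho>E: "\<rho> k e \<in> carrier E" if "k \<in> K" "e \<in> carrier E" for k e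
    using that by (simp add: \<rho>_def fE cN f'N)
  have \<rho>\<rho>: "\<rho> k (\<rho> l e) = \<rho> (k \<otimes> l) e" if "k \<in> K" "l \<in> K" "e \<in> carrier E" for k l e
  proof -
    have "\<rho> k (\<rho> l e) = f (k \<otimes> (l \<otimes> f' e \<otimes> inv l) \<otimes> inv k)"
      using that by (simp add: \<rho>_def fE cN f'N f'f)
    also have "k \<otimes> (l \<otimes> f' e \<otimes> inv l) \<otimes> inv k = (k \<otimes> l) \<otimes> f' e \<otimes> inv (k \<otimes> l)"
      using that f'c by (simp add: inv_mult_group m_assoc)
    finally show ?thesis using that by (simp add: \<rho>_def)
  qed
  have \<rho>1: "\<rho> \<one> e = e" if "e \<in> carrier E" for e
    using that f'c by (simp add: \<rho>_def ff')
  have \<rho>bij: "\<rho> k \<in> Bij (carrier E)" if "k \<in> K" for k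
  proof -
    have "bij_betw (\<rho> k) (carrier E) (carrier E)"
      by (rule bij_betw_byWitness[where f' = "\<rho> (inv k)"])
         (use that \<rho>\<rho>[of "inv k" k] \<rho>\<rho>[of k "inv k"] \<rho>1 \<rho>E in auto)
    then show ?thesis by (simp add: Bij_def \<rho>_def)
  qed
  have \<rho>hom: "\<rho> k (a \<otimes>\<^bsub>E\<^esub> b) = \<rho> k a \<otimes>\<^bsub>E\<^esub> \<rho> k b" if "k \<in> K" "a \<in> carrier E" "b \<in> carrier E" for k a b
  proof -
    have "f' (a \<otimes>\<^bsub>E\<^esub> b) = f' a \<otimes> f' b"
      using that by (metis f'N f'f ff' fm N.m_closed)
    then have "\<rho> k (a \<otimes>\<^bsub>E\<^esub> b) = f (k \<otimes> (f' a \<otimes> f' b) \<otimes> inv k)" using that by (simp add: \<rho>_def)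
    also have "k \<otimes> (f' a \<otimes> f' b) \<otimes> inv k = (k \<otimes> f' a \<otimes> inv k) \<otimes> (k \<otimes> f' b \<otimes> inv k)"
      using that f'c cancel by (simp add: m_assoc)
    finally show ?thesis using that by (simp add: \<rho>_def fm cN f'N)
  qed
  have "\<rho> \<in> hom (G\<lparr>carrier := K\<rparr>) (AutoGroup E)"
  proof (rule homI)
    fix k assume k: "k \<in> carrier (G\<lparr>carrier := K\<rparr>)"
    then show "\<rho> k \<in> carrier (AutoGroup E)"
      using \<rho>bij \<rho>hom \<rho>E by (simp add: AutoGroup_def auto_def hom_def)
  next
    fix k l assume kl: "k \<in> carrier (G\<lparr>carrier := K\<rparr>)" "l \<in> carrier (G\<lparr>carrier := K\<rparr>)"
    have "\<rho> (k \<otimes> l) = compose (carrier E) (\<rho> k) (\<rho> l)"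
    proof
      fix e show "\<rho> (k \<otimes> l) e = compose (carrier E) (\<rho> k) (\<rho> l) e"
      proof (cases "e \<in> carrier E")
        case True then show ?thesis using kl \<rho>\<rho>[of k l e] by (simp add: compose_def)
      next
        case False then show ?thesis by (simp add: compose_def \<rho>_def)
      qed
    qed
    then show "\<rho> (k \<otimes>\<^bsub>G\<lparr>carrier := K\<rparr>\<^esub> l) = \<rho> k \<otimes>\<^bsub>AutoGroup E\<^esub> \<rho> l"
      using kl \<rho>bij by (simp add: AutoGroup_def BijGroup_def)
  qed
  note hom = this
  let ?P = "semidirect_product E (G\<lparr>carrier := K\<rparr>) \<rho>"
  have P: "group ?P" by (rule group_semidirect_product[OF E Kg hom])
  define \<psi> where "\<psi> = (\<lambda>(e, k). f' e \<otimes> k)"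
  have "\<psi> \<in> hom ?P G"
  proof (rule homI)
    fix u assume "u \<in> carrier ?P"
    then show "\<psi> u \<in> carrier G" using f'c by (auto simp: \<psi>_def semidirect_product_def)
  next
    fix u v assume "u \<in> carrier ?P" "v \<in> carrier ?P"
    then obtain a k b l where uv: "u = (a, k)" "v = (b, l)" and [simp]: "a \<in> carrier E" "k \<in> K" "b \<in> carrier E" "l \<in> K"
      by (auto simp: semidirect_product_def)
    have "f' (a \<otimes>\<^bsub>E\<^esub> \<rho> k b) = f' a \<otimes> (k \<otimes> f' b \<otimes> inv k)"
    proof -
      have "a \<otimes>\<^bsub>E\<^esub> \<rho> k b = f (f' a \<otimes> (k \<otimes> f' b \<otimes> inv k))"
        by (simp add: fm cN f'N ff' \<rho>_def)
      then show ?thesis by (simp add: f'f cN f'N)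
    qed
    then have "\<psi> (u \<otimes>\<^bsub>?P\<^esub> v) = f' a \<otimes> (k \<otimes> f' b \<otimes> inv k) \<otimes> (k \<otimes> l)"
      by (simp add: uv \<psi>_def semidirect_product_def)
    also have "\<dots> = f' a \<otimes> k \<otimes> f' b \<otimes> (inv k \<otimes> (k \<otimes> l))" using f'c by (simp add: m_assoc)
    also have "inv k \<otimes> (k \<otimes> l) = l" using cancel by simp
    finally show "\<psi> (u \<otimes>\<^bsub>?P\<^esub> v) = \<psi> u \<otimes> \<psi> v" using f'c by (simp add: uv \<psi>_def m_assoc)
  qed
  then interpret \<psi>: group_hom ?P G \<psi>
    using P by (simp add: group_hom_def group_hom_axioms_def is_group)
  have "\<psi> \<in> iso ?P G"
    unfolding \<psi>.iso_iff
  proof (intro conjI ballI impI subsetI)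
    fix g assume "g \<in> carrier G"
    then obtain v k where vk: "v \<in> N" "k \<in> K" "g = v \<otimes> k" using gen by blast
    have "g = \<psi> (f v, k)" using vk by (simp add: \<psi>_def f'f)
    moreover have "(f v, k) \<in> carrier ?P" using vk fE by (simp add: semidirect_product_def)
    ultimately show "g \<in> \<psi> ` carrier ?P" by blast
  next
    fix u assume u: "u \<in> carrier ?P" "\<psi> u = \<one>"
    then obtain a k where ak: "u = (a, k)" "a \<in> carrier E" "k \<in> K" by (auto simp: semidirect_product_def)
    have "f' a \<otimes> k = \<one>" using u ak by (simp add: \<psi>_def)
    then have "f' a = inv k" using ak f'c by (metis K.mem_carrier inv_equality inv_inv)
    then have "f' a \<in> K" using ak by simp
    then have "f' a \<in> N \<inter> K" using ak f'N by blast
    then have fa: "f' a = \<one>" using NK by simp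
    then have k1: "k = \<one>" using \<open>f' a = inv k\<close> ak by (metis K.mem_carrier inv_eq_1_iff)
    have "a = f \<one>" using fa ff' ak by metis
    also have "\<dots> = \<one>\<^bsub>E\<^esub>" using fm[of \<one> \<one>] fE[of \<one>] by (metis E.r_cancel_one' E.l_cancel_one N.one_closed r_one one_closed)
    finally show "u = \<one>\<^bsub>?P\<^esub>" using k1 ak by (simp add: semidirect_product_def)
  qed
  then have "G \<cong> ?P" using group.iso_sym[OF P] by (auto simp: is_iso_def)
  with hom show ?thesis by blast
qed

section \<open>Groups with a centre of prime order\<close>

text \<open>Since \<open>M\<close> is central, the commutator with \<open>x\<close> is a homomorphism from \<open>H\<close> to \<open>M\<close>. It is not trivial and
\<open>M\<close> has prime order, so it is onto; its kernel is the centralizer of \<open>x\<close>.\<close>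

lemma (in group) card_eq_prime_mult_centralizer:
  assumes q: "prime q" and H: "subgroup H G" and M: "subgroup M G" and MH: "M \<subseteq> H" and cM: "card M = q"
    and x: "x \<in> carrier G"
    and central: "\<And>z g. z \<in> M \<Longrightarrow> g \<in> H \<Longrightarrow> z \<otimes> g = g \<otimes> z"
    and comm: "\<And>g. g \<in> H \<Longrightarrow> g \<otimes> x \<otimes> inv g \<otimes> inv x \<in> M"
    and fin: "finite H" and nontriv: "\<exists>g\<in>H. g \<otimes> x \<noteq> x \<otimes> g"
  shows "card H = q * card {g \<in> H. g \<otimes> x = x \<otimes> g}"
proof -
  interpret H: subgroup H G by fact
  interpret M: subgroup M G by fact
  define \<kappa> where "\<kappa> g = g \<otimes> x \<otimes> inv g \<otimes> inv x" for g
  have \<kappa>M: "\<kappa> g \<in> M" if "g \<in> H" for g using comm that by (simp add: \<kappa>_def)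
  have \<kappa>: "g \<otimes> x \<otimes> inv g = \<kappa> g \<otimes> x" if "g \<in> H" for g
    using that x by (simp add: \<kappa>_def m_assoc)
  have mult: "\<kappa> (g \<otimes> h) = \<kappa> g \<otimes> \<kappa> h" if "g \<in> H" "h \<in> H" for g h
  proof -
    have "\<kappa> (g \<otimes> h) = g \<otimes> (h \<otimes> x \<otimes> inv h) \<otimes> inv g \<otimes> inv x"
      using that x by (simp add: \<kappa>_def inv_mult_group m_assoc)
    also have "\<dots> = (g \<otimes> \<kappa> h) \<otimes> x \<otimes> inv g \<otimes> inv x"
      using that x \<kappa>[of h] \<kappa>M[of h] by (simp add: m_assoc)
    also have "g \<otimes> \<kappa> h = \<kappa> h \<otimes> g" using central[of "\<kappa> h" g] \<kappa>M that by simp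
    also have "\<kappa> h \<otimes> g \<otimes> x \<otimes> inv g \<otimes> inv x = \<kappa> h \<otimes> \<kappa> g"
      using that x \<kappa>M[of h] by (simp add: \<kappa>_def[of g] m_assoc)
    also have "\<dots> = \<kappa> g \<otimes> \<kappa> h" using central \<kappa>M MH that by blast
    finally show ?thesis .
  qed
  interpret k: group_hom "G\<lparr>carrier := H\<rparr>" "G\<lparr>carrier := M\<rparr>" \<kappa>
    using mult \<kappa>M H.subgroup_is_group M.subgroup_is_group is_group
    by (auto simp: group_hom_def group_hom_axioms_def hom_def)
  have one: "\<kappa> g = \<one> \<longleftrightarrow> g \<otimes> x = x \<otimes> g" if "g \<in> H" for g
  proof -
    have "\<kappa> g = \<one> \<longleftrightarrow> (g \<otimes> x) \<otimes> inv (x \<otimes> g) = \<one>"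
      using that x by (simp add: \<kappa>_def inv_mult_group m_assoc)
    also have "\<dots> \<longleftrightarrow> g \<otimes> x = x \<otimes> g"
      using that x by (metis H.mem_carrier inv_closed inv_equality inv_inv m_closed r_inv)
    finally show ?thesis .
  qed
  have "subgroup (\<kappa> ` H) (G\<lparr>carrier := M\<rparr>)" using k.img_is_subgroup by simp
  then have "card (\<kappa> ` H) dvd card M"
    using group.lagrange[OF M.subgroup_is_group[OF is_group], of "\<kappa> ` H"] by (simp add: order_def) (metis dvd_triv_right)
  moreover have "card (\<kappa> ` H) \<noteq> 1"
  proof
    assume "card (\<kappa> ` H) = 1"
    then obtain a where a: "\<kappa> ` H = {a}" by (auto simp: card_1_singleton_iff)
    have "\<kappa> \<one> = \<one>" using one[of \<one>] x by simp
    then have "a = \<one>" using a H.one_closed by (metis imageI singletonD)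
    then show False using nontriv one a by (metis imageI singletonD)
  qed
  ultimately have "card (\<kappa> ` H) = q" using q cM by (auto simp: prime_nat_iff)
  moreover have "card (kernel (G\<lparr>carrier := H\<rparr>) (G\<lparr>carrier := M\<rparr>) \<kappa>) * card (\<kappa> ` H) = card H"
    using k.card_kernel_mult_card_image fin by (simp add: order_def)
  moreover have "kernel (G\<lparr>carrier := H\<rparr>) (G\<lparr>carrier := M\<rparr>) \<kappa> = {g \<in> H. g \<otimes> x = x \<otimes> g}"
    using one by (auto simp: kernel_def)
  ultimately show ?thesis by (simp add: mult.commute)
qed

lemma (in group) subgroup_centralizer_in:
  assumes "subgroup H G" "x \<in> carrier G"
  shows "subgroup {g \<in> H. g \<otimes> x = x \<otimes> g} G"
proof -
  interpret H: subgroup H G by fact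
  show ?thesis
  proof (rule subgroupI)
    show "{g \<in> H. g \<otimes> x = x \<otimes> g} \<noteq> {}"
    proof -
      have "\<one> \<in> {g \<in> H. g \<otimes> x = x \<otimes> g}" using assms by simp
      then show ?thesis by blast
    qed
    show "inv g \<in> {g \<in> H. g \<otimes> x = x \<otimes> g}" if "g \<in> {g \<in> H. g \<otimes> x = x \<otimes> g}" for g
    proof -
      have g: "g \<in> H" "g \<in> carrier G" "g \<otimes> x = x \<otimes> g" using that by auto
      have "inv g \<otimes> x \<otimes> g = inv g \<otimes> (g \<otimes> x)" using g assms(2) by (simp add: m_assoc)
      also have "\<dots> = x" using g(2) assms(2) by (simp flip: m_assoc)
      finally have e: "inv g \<otimes> x \<otimes> g = x" .
      have "x \<otimes> inv g = (inv g \<otimes> x \<otimes> g) \<otimes> inv g" by (simp only: e)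
      also have "\<dots> = inv g \<otimes> x" using g assms by (simp add: m_assoc)
      finally have "inv g \<otimes> x = x \<otimes> inv g" ..
      then show ?thesis using g by simp
    qed
    show "g \<otimes> h \<in> {g \<in> H. g \<otimes> x = x \<otimes> g}"
      if "g \<in> {g \<in> H. g \<otimes> x = x \<otimes> g}" "h \<in> {g \<in> H. g \<otimes> x = x \<otimes> g}" for g h
    proof -
      have gh: "g \<in> H" "h \<in> H" "g \<otimes> x = x \<otimes> g" "h \<otimes> x = x \<otimes> h" using that by auto
      have "g \<otimes> h \<otimes> x = g \<otimes> (x \<otimes> h)" using gh(1,2,4) assms(2) by (simp add: m_assoc)
      also have "\<dots> = (g \<otimes> x) \<otimes> h" using gh(1,2) assms(2) by (simp add: m_assoc)
      also have "\<dots> = x \<otimes> (g \<otimes> h)" unfolding gh(3) using gh(1,2) assms(2) by (simp add: m_assoc)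
      finally have "g \<otimes> h \<otimes> x = x \<otimes> (g \<otimes> h)" .
      then show ?thesis using gh by simp
    qed
  qed (use assms in auto)
qed

text \<open>This is the splitting of the commutator form on \<open>H\<close> modulo \<open>M\<close> into hyperbolic planes. If \<open>x\<close> and \<open>y\<close> do
not commute, their common centralizer \<open>C\<close> has index \<open>q\<^sup>2\<close>, by the index formula for centralizers applied
twice. The centre of \<open>C\<close> is again \<open>M\<close>: if \<open>z\<close> is central in \<open>C\<close>, its centralizer in \<open>H\<close> contains \<open>x\<close>, \<open>y\<close> and
\<open>C\<close>, so the same formula shows that it is as large as \<open>H\<close>.\<close>

lemma (in group) card_odd_prime_power_if_prime_center:
  assumes q: "prime q" and M: "subgroup M G" and cM: "card M = q"
  shows "\<lbrakk>subgroup H G; finite H; {z \<in> H. \<forall>g\<in>H. z \<otimes> g = g \<otimes> z} = M;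
      \<And>g h. g \<in> H \<Longrightarrow> h \<in> H \<Longrightarrow> g \<otimes> h \<otimes> inv g \<otimes> inv h \<in> M\<rbrakk>
    \<Longrightarrow> \<exists>r. card H = q ^ (2 * r + 1)"
proof (induction "card H" arbitrary: H rule: less_induct)
  case (less H)
  note H = less.prems(1) and fin = less.prems(2) and ctr = less.prems(3) and comm = less.prems(4)
  interpret H: subgroup H G by fact
  interpret M: subgroup M G by fact
  have MH: "M \<subseteq> H" and central: "\<And>z g. z \<in> M \<Longrightarrow> g \<in> H \<Longrightarrow> z \<otimes> g = g \<otimes> z"
    using ctr by auto
  show ?case
  proof (cases "H = M")
    case True then have "card H = q ^ (2 * 0 + 1)" using cM by simp
    then show ?thesis by blast
  next
    case False
    then obtain x where x: "x \<in> H" "x \<notin> M" using MH by blast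
    then obtain y where y: "y \<in> H" "y \<otimes> x \<noteq> x \<otimes> y"
    proof -
      have "x \<notin> {z \<in> H. \<forall>g\<in>H. z \<otimes> g = g \<otimes> z}" using x ctr by simp
      then have "\<exists>y\<in>H. x \<otimes> y \<noteq> y \<otimes> x" using x by blast
      then show ?thesis using that by metis
    qed
    have two: "card D = q * (q * card {g \<in> D. g \<otimes> x = x \<otimes> g \<and> g \<otimes> y = y \<otimes> g})"
      if D: "subgroup D G" "D \<subseteq> H" "M \<subseteq> D" "x \<in> D" "y \<in> D" for D
    proof -
      let ?D1 = "{g \<in> D. g \<otimes> x = x \<otimes> g}"
      have "card D = q * card ?D1"
        by (rule card_eq_prime_mult_centralizer[OF q D(1) M D(3) cM])
           (use x y D central comm fin finite_subset in auto)
      also have "card ?D1 = q * card {g \<in> ?D1. g \<otimes> y = y \<otimes> g}"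
      proof (rule card_eq_prime_mult_centralizer[OF q subgroup_centralizer_in[OF D(1)] M _ cM])
        show "M \<subseteq> ?D1"
        proof
          fix z assume z: "z \<in> M"
          then show "z \<in> ?D1" using D(3) central[OF z x(1)] by blast
        qed
        show "\<exists>g\<in>?D1. g \<otimes> y \<noteq> y \<otimes> g" using x y D by (intro bexI[of _ x]) auto
        show "finite ?D1" using D fin by (auto intro: finite_subset)
      qed (use x y D central comm in auto)
      also have "{g \<in> ?D1. g \<otimes> y = y \<otimes> g} = {g \<in> D. g \<otimes> x = x \<otimes> g \<and> g \<otimes> y = y \<otimes> g}" by auto
      finally show ?thesis .
    qed
    define C where "C = {g \<in> H. g \<otimes> x = x \<otimes> g \<and> g \<otimes> y = y \<otimes> g}"
    have Cs: "C = {g \<in> {g \<in> H. g \<otimes> x = x \<otimes> g}. g \<otimes> y = y \<otimes> g}" by (auto simp: C_def)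
    have C: "subgroup C G" unfolding Cs using x y H by (intro subgroup_centralizer_in) auto
    have cH: "card H = q * (q * card C)" using two[OF H _ MH x(1) y(1)] by (simp add: C_def)
    have finC: "finite C" using fin by (simp add: C_def)
    have q1: "1 < q" using q prime_gt_1_nat by blast
    have posC: "0 < card C" using finC C subgroup.one_closed card_gt_0_iff by blast
    have MC: "M \<subseteq> C" using MH central x y by (auto simp: C_def)
    have "{z \<in> C. \<forall>g\<in>C. z \<otimes> g = g \<otimes> z} = M"
    proof
      show "M \<subseteq> {z \<in> C. \<forall>g\<in>C. z \<otimes> g = g \<otimes> z}" using MC central by (auto simp: C_def)
      show "{z \<in> C. \<forall>g\<in>C. z \<otimes> g = g \<otimes> z} \<subseteq> M"
      proof
        fix z assume "z \<in> {z \<in> C. \<forall>g\<in>C. z \<otimes> g = g \<otimes> z}"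
        then have z: "z \<in> C" "\<And>g. g \<in> C \<Longrightarrow> g \<otimes> z = z \<otimes> g" by auto
        let ?D = "{g \<in> H. g \<otimes> z = z \<otimes> g}"
        have zH: "z \<in> H" using z by (simp add: C_def)
        have D: "subgroup ?D G" using zH H by (intro subgroup_centralizer_in) auto
        have zx: "z \<otimes> x = x \<otimes> z" and zy: "z \<otimes> y = y \<otimes> z" using z(1) by (simp_all add: C_def)
        have "card ?D = q * (q * card {g \<in> ?D. g \<otimes> x = x \<otimes> g \<and> g \<otimes> y = y \<otimes> g})"
        proof (rule two[OF D])
          show "M \<subseteq> ?D"
          proof
            fix w assume w: "w \<in> M"
            then show "w \<in> ?D" using MH central[OF w zH] by blast
          qed
        qed (use x y zx zy in simp_all)
        also have "{g \<in> ?D. g \<otimes> x = x \<otimes> g \<and> g \<otimes> y = y \<otimes> g} = C"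
          using z by (auto simp: C_def)
        finally have "card ?D = card H" using cH by simp
        then have "?D = H" using fin by (intro card_subset_eq) auto
        then show "z \<in> M" using ctr zH by fastforce
      qed
    qed
    note ctrC = this
    obtain r where r: "card C = q ^ (2 * r + 1)"
    proof -
      have "card C < card H" using cH q1 posC by (metis One_nat_def less_1_mult mult.assoc mult.commute nat_mult_less_cancel1 mult_1 mult.right_neutral)
      moreover have "g \<otimes> h \<otimes> inv g \<otimes> inv h \<in> M" if "g \<in> C" "h \<in> C" for g h
        using that comm by (simp add: C_def)
      ultimately show ?thesis using less.hyps[OF _ C finC ctrC] that by blast
    qed
    have "card H = q ^ (2 * Suc r + 1)" using r cH by simp
    then show ?thesis by blast
  qed
qed

section \<open>Elementary abelian groups\<close>

text \<open>An embedding of a largest possible power is onto: an element outside the image could be used as the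
value of one more coordinate, since a nonzero exponent is invertible modulo \<open>p\<close>.\<close>

lemma comm_group_elementary_abelian_iso:
  assumes N: "comm_group N" and fin: "finite (carrier N)" and p: "prime p"
    and exp: "\<And>x. x \<in> carrier N \<Longrightarrow> x [^]\<^bsub>N\<^esub> p = \<one>\<^bsub>N\<^esub>"
  shows "\<exists>t. card (carrier N) = p ^ t \<and> N \<cong> elem_abelian_power p t"
proof -
  interpret comm_group N by fact
  let ?E = "elem_abelian_power p"
  have p1: "1 < p" using p prime_gt_1_nat by blast
  have E: "group (?E d)" for d by (simp add: elem_abelian_power_def)
  have carE: "carrier (?E d) = (\<Pi>\<^sub>E i\<in>{..<d}. {0..<int p})" for d
    using p1 by (simp add: elem_abelian_power_def carrier_integer_mod_group)
  have multE: "a \<otimes>\<^bsub>?E d\<^esub> b = (\<lambda>i\<in>{..<d}. (a i + b i) mod int p)" for a b d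
    by (simp add: elem_abelian_power_def)
  have oneE: "\<one>\<^bsub>?E d\<^esub> = (\<lambda>i\<in>{..<d}. 0)" for d
    by (simp add: elem_abelian_power_def)
  have cardE: "card (carrier (?E d)) = p ^ d" for d
    by (simp add: carE card_PiE)
  have powmod: "x [^]\<^bsub>N\<^esub> (k mod int p) = x [^]\<^bsub>N\<^esub> k" if "x \<in> carrier N" for x and k :: int
  proof -
    have "x [^]\<^bsub>N\<^esub> k = x [^]\<^bsub>N\<^esub> (int p * (k div int p) + k mod int p)" by simp
    also have "\<dots> = (x [^]\<^bsub>N\<^esub> int p) [^]\<^bsub>N\<^esub> (k div int p) \<otimes>\<^bsub>N\<^esub> x [^]\<^bsub>N\<^esub> (k mod int p)"
      using that by (simp only: int_pow_mult int_pow_pow)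
    also have "x [^]\<^bsub>N\<^esub> int p = \<one>\<^bsub>N\<^esub>" using exp[OF that] by (simp add: int_pow_int)
    finally show ?thesis using that by simp
  qed
  define I where "I d \<longleftrightarrow> (\<exists>f. f \<in> hom (?E d) N \<and> inj_on f (carrier (?E d)))" for d
  have I0: "I 0"
    unfolding I_def
    by (rule exI[of _ "\<lambda>_. \<one>\<^bsub>N\<^esub>"]) (auto simp: hom_def carE)
  have bound: "d \<le> card (carrier N)" if Id: "I d" for d
  proof -
    obtain f where f: "f \<in> hom (?E d) N" "inj_on f (carrier (?E d))" using Id by (auto simp: I_def)
    have "p ^ d \<le> card (carrier N)"
      using card_inj_on_le[OF f(2) _ fin] f(1) by (auto simp: hom_def cardE)
    moreover have "d < p ^ d" using p1 by (simp add: power_gt_expt)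
    ultimately show ?thesis by simp
  qed
  obtain d where d: "I d" "\<And>e. I e \<Longrightarrow> e \<le> d"
    using ex_has_greatest_nat[of I 0 "\<lambda>x. x" "Suc (card (carrier N))"] I0 bound by (auto simp: less_Suc_eq_le)
  obtain f where f: "f \<in> hom (?E d) N" and inj: "inj_on f (carrier (?E d))" using d(1) by (auto simp: I_def)
  interpret f: group_hom "?E d" N f using E f by (simp add: group_hom_def group_hom_axioms_def is_group)
  have surj: "f ` carrier (?E d) = carrier N"
  proof (rule ccontr)
    assume "f ` carrier (?E d) \<noteq> carrier N"
    then obtain x where x: "x \<in> carrier N" "x \<notin> f ` carrier (?E d)" using f.hom_closed by blast
    let ?r = "\<lambda>c. restrict c {..<d}"
    define h where "h c = f (?r c) \<otimes>\<^bsub>N\<^esub> x [^]\<^bsub>N\<^esub> (c d :: int)" for c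
    have rE: "?r c \<in> carrier (?E d)" if "c \<in> carrier (?E (Suc d))" for c
      using that by (auto simp: carE PiE_iff)
    have hhom: "h \<in> hom (?E (Suc d)) N"
    proof (rule homI)
      fix a assume "a \<in> carrier (?E (Suc d))" then show "h a \<in> carrier N" using x rE by (simp add: h_def)
    next
      fix a b assume a: "a \<in> carrier (?E (Suc d))" and b: "b \<in> carrier (?E (Suc d))"
      have "?r (a \<otimes>\<^bsub>?E (Suc d)\<^esub> b) = ?r a \<otimes>\<^bsub>?E d\<^esub> ?r b"
        by (auto simp: multE)
      then have "f (?r (a \<otimes>\<^bsub>?E (Suc d)\<^esub> b)) = f (?r a) \<otimes>\<^bsub>N\<^esub> f (?r b)"
        using f.hom_mult[OF rE[OF a] rE[OF b]] by simp
      moreover have "(a \<otimes>\<^bsub>?E (Suc d)\<^esub> b) d = (a d + b d) mod int p" by (simp add: multE)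
      ultimately have "h (a \<otimes>\<^bsub>?E (Suc d)\<^esub> b) = f (?r a) \<otimes>\<^bsub>N\<^esub> f (?r b) \<otimes>\<^bsub>N\<^esub> x [^]\<^bsub>N\<^esub> ((a d + b d) mod int p)"
        by (simp only: h_def)
      also have "x [^]\<^bsub>N\<^esub> ((a d + b d) mod int p) = x [^]\<^bsub>N\<^esub> (a d) \<otimes>\<^bsub>N\<^esub> x [^]\<^bsub>N\<^esub> (b d)"
        using x by (simp add: powmod int_pow_mult)
      also have "f (?r a) \<otimes>\<^bsub>N\<^esub> f (?r b) \<otimes>\<^bsub>N\<^esub> (x [^]\<^bsub>N\<^esub> (a d) \<otimes>\<^bsub>N\<^esub> x [^]\<^bsub>N\<^esub> (b d)) = h a \<otimes>\<^bsub>N\<^esub> h b"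
      proof -
        have "A \<otimes>\<^bsub>N\<^esub> B \<otimes>\<^bsub>N\<^esub> (X \<otimes>\<^bsub>N\<^esub> Y) = A \<otimes>\<^bsub>N\<^esub> X \<otimes>\<^bsub>N\<^esub> (B \<otimes>\<^bsub>N\<^esub> Y)"
          if "A \<in> carrier N" "B \<in> carrier N" "X \<in> carrier N" "Y \<in> carrier N" for A B X Y
          using that by (simp add: m_ac)
        from this[OF f.hom_closed[OF rE[OF a]] f.hom_closed[OF rE[OF b]], of "x [^]\<^bsub>N\<^esub> a d" "x [^]\<^bsub>N\<^esub> b d"]
        show ?thesis using x by (simp only: h_def int_pow_closed)
      qed
      finally show "h (a \<otimes>\<^bsub>?E (Suc d)\<^esub> b) = h a \<otimes>\<^bsub>N\<^esub> h b" .
    qed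
    interpret h: group_hom "?E (Suc d)" N h using E hhom by (simp add: group_hom_def group_hom_axioms_def is_group)
    have "inj_on h (carrier (?E (Suc d)))"
      unfolding h.inj_on_one_iff
    proof (intro allI impI)
      fix c assume c: "c \<in> carrier (?E (Suc d))" and hc: "h c = \<one>\<^bsub>N\<^esub>"
      have cd: "c d \<in> {0..<int p}" using c by (auto simp: carE PiE_iff)
      have xk: "x [^]\<^bsub>N\<^esub> (c d) \<in> f ` carrier (?E d)"
      proof -
        have "x [^]\<^bsub>N\<^esub> (c d) = inv\<^bsub>N\<^esub> f (?r c)"
          using hc x rE[OF c] unfolding h_def by (metis f.hom_closed int_pow_closed inv_equality inv_inv)
        also have "\<dots> = f (inv\<^bsub>?E d\<^esub> ?r c)" using rE[OF c] by simp
        finally show ?thesis using rE[OF c] E group.inv_closed by blast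
      qed
      have c0: "c d = 0"
      proof (rule ccontr)
        assume n: "c d \<noteq> 0"
        then have "coprime (c d) (int p)"
          using cd p by (metis atLeastLessThan_iff coprime_commute dvd_imp_le_int leD less_le of_nat_0_le_iff abs_of_nonneg abs_of_nat prime_imp_coprime prime_nat_int_transfer)
        then obtain u v where uv: "u * c d + v * int p = 1"
          using bezout_int[of "c d" "int p"] by (auto simp: coprime_iff_gcd_eq_1)
        then have "(c d * u) mod int p = 1 mod int p" by (metis mod_mult_self1 mult.commute)
        then have "x = x [^]\<^bsub>N\<^esub> ((c d * u) mod int p)" using x by (simp add: powmod int_pow_1 del: mod_mult_eq)
        also have "\<dots> = (x [^]\<^bsub>N\<^esub> (c d)) [^]\<^bsub>N\<^esub> u" using x by (simp add: powmod int_pow_pow)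
        also have "\<dots> \<in> f ` carrier (?E d)"
          using xk f.img_is_subgroup by (metis subgroup_int_pow_closed)
        finally show False using x by simp
      qed
      then have "f (?r c) = \<one>\<^bsub>N\<^esub>" using hc rE[OF c] by (simp add: h_def)
      then have "?r c = \<one>\<^bsub>?E d\<^esub>" using inj rE[OF c] f.inj_on_one_iff by blast
      then have "c i = 0" if "i < Suc d" for i
        using that c0 by (cases "i = d") (auto simp: oneE fun_eq_iff restrict_def split: if_splits dest: less_SucE)
      then show "c = \<one>\<^bsub>?E (Suc d)\<^esub>" using c by (auto simp: oneE carE PiE_iff extensional_def)
    qed
    then have "I (Suc d)" using hhom unfolding I_def by blast
    then show False using d(2) by fastforce
  qed
  have iso: "f \<in> iso (?E d) N" using f inj surj by (simp add: iso_def bij_betw_def)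
  then have "card (carrier N) = p ^ d" using cardE iso_same_order by (metis order_def)
  moreover have "N \<cong> ?E d" using iso group.iso_sym[OF E] by (auto simp: is_iso_def)
  ultimately show ?thesis by blast
qed

section \<open>Fixed-point-free actions on abelian groups\<close>

lemma (in comm_group) endo_funpow_hom:
  assumes "h \<in> hom G G" shows "h ^^ i \<in> hom G G"
proof (induction i)
  case 0 then show ?case by (simp add: hom_def)
next
  case (Suc i) then show ?case
  proof (intro homI)
    fix x assume x: "x \<in> carrier G"
    show "(h ^^ Suc i) x \<in> carrier G" using hom_in_carrier[OF assms hom_in_carrier[OF Suc x]] by simp
    fix y assume y: "y \<in> carrier G"
    show "(h ^^ Suc i) (x \<otimes> y) = (h ^^ Suc i) x \<otimes> (h ^^ Suc i) y"
      using hom_mult[OF Suc x y] hom_mult[OF assms hom_in_carrier[OF Suc x] hom_in_carrier[OF Suc y]] by simp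
  qed
qed

lemma (in comm_group) endo_finprod:
  assumes h: "h \<in> hom G G" and f: "f \<in> A \<rightarrow> carrier G"
  shows "h (finprod G f A) = finprod G (\<lambda>x. h (f x)) A"
proof -
  interpret h: group_hom G G h by unfold_locales (rule h)
  show ?thesis using f
  proof (induction A rule: infinite_finite_induct)
    case (insert a A)
    then have "f a \<in> carrier G" "f \<in> A \<rightarrow> carrier G" by auto
    moreover from this have "(\<lambda>x. h (f x)) \<in> A \<rightarrow> carrier G" by (auto simp: Pi_iff)
    ultimately show ?case using insert by simp
  qed auto
qed

lemma (in comm_group) finprod_swap:
  assumes "finite B" and "\<And>i j. i \<in> A \<Longrightarrow> j \<in> B \<Longrightarrow> F i j \<in> carrier G"
  shows "finprod G (\<lambda>i. finprod G (\<lambda>j. F i j) B) A = finprod G (\<lambda>j. finprod G (\<lambda>i. F i j) A) B"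
  using assms
proof (induction B rule: finite_induct)
  case empty then show ?case by simp
next
  case (insert b B)
  have c: "F i b \<in> carrier G" "F i j \<in> carrier G" if "i \<in> A" "j \<in> B" for i j
    using insert.prems that by blast+
  have cb: "F i b \<in> carrier G" if "i \<in> A" for i using insert.prems that by blast
  have fc: "finprod G (F i) B \<in> carrier G" if "i \<in> A" for i
    using c that by (intro finprod_closed) auto
  have gc: "finprod G (\<lambda>i. F i j) A \<in> carrier G" if "j \<in> insert b B" for j
    using insert.prems that by (intro finprod_closed) auto
  have "finprod G (\<lambda>i. finprod G (F i) (insert b B)) A = finprod G (\<lambda>i. F i b \<otimes> finprod G (F i) B) A"
  proof (rule finprod_cong'[OF refl])
    show "(\<lambda>i. F i b \<otimes> finprod G (F i) B) \<in> A \<rightarrow> carrier G" using cb fc by (intro Pi_I m_closed)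
    show "finprod G (F i) (insert b B) = F i b \<otimes> finprod G (F i) B" if "i \<in> A" for i
      by (rule finprod_insert[OF insert.hyps]) (use c cb that in auto)
  qed
  also have "\<dots> = finprod G (\<lambda>i. F i b) A \<otimes> finprod G (\<lambda>i. finprod G (F i) B) A"
    using cb fc by (intro finprod_multf) auto
  also have "finprod G (\<lambda>i. finprod G (F i) B) A = finprod G (\<lambda>j. finprod G (\<lambda>i. F i j) A) B"
    using insert.IH c by blast
  also have "finprod G (\<lambda>i. F i b) A \<otimes> \<dots> = finprod G (\<lambda>j. finprod G (\<lambda>i. F i j) A) (insert b B)"
    by (rule finprod_insert[symmetric, OF insert.hyps]) (use gc in auto)
  finally show ?case .
qed

text \<open>Applying \<open>h\<close> permutes the factors cyclically, so the product is a fixed point of \<open>h\<close>.\<close>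

lemma (in comm_group) finprod_orbit_of_fixed_point_free_endo:
  assumes h: "h \<in> hom G G" and per: "\<And>x. x \<in> carrier G \<Longrightarrow> (h ^^ q) x = x"
    and fpf: "\<And>x. x \<in> carrier G \<Longrightarrow> h x = x \<Longrightarrow> x = \<one>" and v: "v \<in> carrier G"
  shows "finprod G (\<lambda>i. (h ^^ i) v) {..<q} = \<one>"
proof -
  interpret h: group_hom G G h by unfold_locales (rule h)
  have cl: "(h ^^ i) v \<in> carrier G" for i by (induction i) (use v in auto)
  let ?P = "\<lambda>n. finprod G (\<lambda>i. (h ^^ i) v) {..<n}"
  have P: "?P n \<in> carrier G" for n using cl by (auto intro: finprod_closed)
  have PS: "?P (Suc n) = (h ^^ n) v \<otimes> ?P n" for n
    unfolding lessThan_Suc by (rule finprod_insert) (use cl in auto)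
  have "h (?P n) \<otimes> v = ?P n \<otimes> (h ^^ n) v" for n
  proof (induction n)
    case 0 then show ?case using v by simp
  next
    case (Suc n)
    have "h (?P (Suc n)) \<otimes> v = h ((h ^^ n) v) \<otimes> (h (?P n) \<otimes> v)"
      using cl P v by (simp add: PS m_assoc)
    also have "\<dots> = ?P (Suc n) \<otimes> (h ^^ Suc n) v"
    proof -
      have "X \<otimes> (Y \<otimes> Z) = Z \<otimes> Y \<otimes> X" if "X \<in> carrier G" "Y \<in> carrier G" "Z \<in> carrier G" for X Y Z
        using that by (simp add: m_ac)
      from this[OF cl[of "Suc n"] P[of n] cl[of n]] show ?thesis unfolding Suc PS by simp
    qed
    finally show ?case .
  qed
  from this[of q] have "h (?P q) \<otimes> v = ?P q \<otimes> v" using per[OF v] by simp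
  then have "h (?P q) = ?P q" using right_cancel v P h.hom_closed by blast
  then show ?thesis using fpf P by blast
qed

text \<open>Write the group additively. For every \<open>j\<close> the sum of \<open>a\<^sup>i b\<^sup>i\<^sup>j v\<close> over \<open>i < q\<close> vanishes, because it is an
orbit sum of \<open>a b\<^sup>j\<close>. In the sum of all of these over \<open>j < q\<close>, the terms with \<open>i = 0\<close> contribute \<open>q v\<close>, and
for every other \<open>i\<close> the terms add up to the image under \<open>a\<^sup>i\<close> of an orbit sum of \<open>b\<^sup>i\<close>, which vanishes.\<close>

lemma (in comm_group) pow_eq_one_if_fixed_point_free_rank_two:
  assumes a: "a \<in> hom G G" and b: "b \<in> hom G G"
    and ab: "\<And>x. x \<in> carrier G \<Longrightarrow> a (b x) = b (a x)"
    and aq: "\<And>x. x \<in> carrier G \<Longrightarrow> (a ^^ q) x = x" and bq: "\<And>x. x \<in> carrier G \<Longrightarrow> (b ^^ q) x = x"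
    and fb: "\<And>i x. 0 < i \<Longrightarrow> i < q \<Longrightarrow> x \<in> carrier G \<Longrightarrow> (b ^^ i) x = x \<Longrightarrow> x = \<one>"
    and fa: "\<And>j x. j < q \<Longrightarrow> x \<in> carrier G \<Longrightarrow> a ((b ^^ j) x) = x \<Longrightarrow> x = \<one>"
    and v: "v \<in> carrier G"
  shows "v [^] q = \<one>"
proof (cases "q = 0")
  case False
  have acl: "(a ^^ i) x \<in> carrier G" and bcl: "(b ^^ i) x \<in> carrier G" if "x \<in> carrier G" for i x
    using endo_funpow_hom[OF a, of i] endo_funpow_hom[OF b, of i] that by (auto simp: hom_def Pi_iff)
  have a1: "a x \<in> carrier G" and b1: "b x \<in> carrier G" if "x \<in> carrier G" for x
    using acl[of x 1] bcl[of x 1] that by auto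
  have comm1: "(b ^^ j) (a x) = a ((b ^^ j) x)" if "x \<in> carrier G" for j x
    by (induction j) (use that ab bcl in auto)
  have comm: "(b ^^ j) ((a ^^ i) x) = (a ^^ i) ((b ^^ j) x)" if "x \<in> carrier G" for i j x
    by (induction i) (use that comm1 acl in auto)
  have pow: "((\<lambda>x. a ((b ^^ j) x)) ^^ i) x = (a ^^ i) ((b ^^ (i * j)) x)" if "x \<in> carrier G" for i j x
  proof (induction i)
    case (Suc i)
    show ?case using that bcl Suc by (simp add: comm funpow_add)
  qed simp
  have bqj: "(b ^^ (q * j)) x = x" if "x \<in> carrier G" for j x
    by (induction j) (use that bq in \<open>auto simp: funpow_add\<close>)
  let ?F = "\<lambda>i j. (a ^^ i) ((b ^^ (i * j)) v)"
  have F: "?F i j \<in> carrier G" for i j using acl bcl v by blast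
  have col: "finprod G (\<lambda>i. ?F i j) {..<q} = \<one>" if "j < q" for j
  proof -
    let ?h = "\<lambda>x. a ((b ^^ j) x)"
    have "?h \<in> hom G G" using a endo_funpow_hom[OF b, of j] by (auto simp: hom_def Pi_iff)
    then have "finprod G (\<lambda>i. (?h ^^ i) v) {..<q} = \<one>"
      by (rule finprod_orbit_of_fixed_point_free_endo) (use pow bqj aq fa that v in auto)
    then show ?thesis using pow v by simp
  qed
  have row: "finprod G (\<lambda>j. ?F i j) {..<q} = \<one>" if "i \<in> {..<q} - {0}" for i
  proof -
    have "finprod G (\<lambda>j. ((b ^^ i) ^^ j) v) {..<q} = \<one>"
    proof (rule finprod_orbit_of_fixed_point_free_endo[OF endo_funpow_hom[OF b]])
      show "((b ^^ i) ^^ q) x = x" if "x \<in> carrier G" for x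
        using bqj[OF that, of i] by (simp add: funpow_mult mult.commute)
    qed (use that fb v in auto)
    then have "(a ^^ i) (finprod G (\<lambda>j. ((b ^^ i) ^^ j) v) {..<q}) = \<one>"
      using hom_one[OF endo_funpow_hom[OF a] is_group is_group] by simp
    also have "(a ^^ i) (finprod G (\<lambda>j. ((b ^^ i) ^^ j) v) {..<q}) = finprod G (\<lambda>j. (a ^^ i) (((b ^^ i) ^^ j) v)) {..<q}"
      using bcl v by (intro endo_finprod endo_funpow_hom a) (auto simp: funpow_mult)
    finally show ?thesis by (simp add: funpow_mult)
  qed
  have "finprod G (\<lambda>j. finprod G (\<lambda>i. ?F i j) {..<q}) {..<q} = \<one>"
    by (rule finprod_one_eqI) (use col in auto)
  then have swap: "finprod G (\<lambda>i. finprod G (\<lambda>j. ?F i j) {..<q}) {..<q} = \<one>"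
    using F by (subst finprod_swap) auto
  define R where "R = (\<lambda>i. finprod G (\<lambda>j. ?F i j) {..<q})"
  have R: "R i \<in> carrier G" for i unfolding R_def by (rule finprod_closed) (use F in blast)
  have "\<one> = finprod G R {..<q}" using swap by (simp only: R_def)
  also have "{..<q} = insert 0 ({..<q} - {0})" using False by auto
  also have "finprod G R (insert 0 ({..<q} - {0})) = R 0 \<otimes> finprod G R ({..<q} - {0})"
    by (rule finprod_insert) (use R in auto)
  also have "finprod G R ({..<q} - {0}) = \<one>"
    by (rule finprod_one_eqI) (use row in \<open>auto simp: R_def\<close>)
  also have "R 0 = v [^] q"
    using v by (simp add: R_def finprod_const)
  finally show ?thesis using v by simp
qed simp

section \<open>Extraspecial groups\<close>

lemma (in group) subgroup_group_center: "subgroup (group_center G) G"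
proof (rule subgroupI)
  have "\<one> \<in> group_center G" by (simp add: group_center_def)
  then show "group_center G \<noteq> {}" by blast
next
  fix z assume z: "z \<in> group_center G"
  have "inv z \<otimes> x = x \<otimes> inv z" if x: "x \<in> carrier G" for x
  proof -
    have zc: "z \<in> carrier G" "z \<otimes> inv x = inv x \<otimes> z" using z inv_closed[OF x] unfolding group_center_def by blast+
    then have "inv (z \<otimes> inv x) = inv (inv x \<otimes> z)" by simp
    then show ?thesis using zc(1) x by (simp add: inv_mult_group)
  qed
  moreover have "z \<in> carrier G" using z by (simp add: group_center_def)
  ultimately show "inv z \<in> group_center G" unfolding group_center_def using inv_closed by blast
next
  fix z w assume zw: "z \<in> group_center G" "w \<in> group_center G"
  have "z \<otimes> w \<otimes> x = x \<otimes> (z \<otimes> w)" if x: "x \<in> carrier G" for x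
  proof -
    have c: "z \<in> carrier G" "w \<in> carrier G" "z \<otimes> x = x \<otimes> z" "w \<otimes> x = x \<otimes> w"
      using zw x unfolding group_center_def by blast+
    have "z \<otimes> w \<otimes> x = z \<otimes> (x \<otimes> w)" using c(1,2,4) x by (simp add: m_assoc)
    also have "\<dots> = (z \<otimes> x) \<otimes> w" using c(1,2) x by (simp add: m_assoc)
    also have "\<dots> = x \<otimes> (z \<otimes> w)" unfolding c(3) using c(1,2) x by (simp add: m_assoc)
    finally show ?thesis .
  qed
  moreover have "z \<in> carrier G" "w \<in> carrier G" using zw by (simp_all add: group_center_def)
  ultimately show "z \<otimes> w \<in> group_center G" unfolding group_center_def using m_closed by blast
qed (simp add: group_center_def)

text \<open>The first two claims rest on \<open>twisted_fixed_points_subset\<close>, the last one on the generation hypothesis. The elements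
of \<open>M\<close> of order dividing \<open>q\<close> form a subgroup that contains all commutators, since \<open>[x, y]\<^sup>q = [x\<^sup>q, y]\<close> and
\<open>x\<^sup>q\<close> is central; as \<open>\<alpha>\<close> is trivial on \<open>M\<close>, that subgroup is \<open>M\<close>. If \<open>G\<close> were abelian, the same argument
with the trivial subgroup would show that \<open>M\<close> is trivial; so irreducibility leaves only \<open>M\<close> for the
centre. Having exponent \<open>q\<close>, the subgroup \<open>M\<close> is generated by any of its nontrivial elements. For odd \<open>q\<close> the \<open>q\<close>-th power is an endomorphism, and it kills every generator \<open>x \<alpha>(x)\<^sup>-\<^sup>1\<close>.\<close>

lemma (in group) extraspecial_structure:
  assumes fin: "finite (carrier G)" and q: "prime q" and M: "subgroup M G"
    and central: "\<And>z x. z \<in> M \<Longrightarrow> x \<in> carrier G \<Longrightarrow> z \<otimes> x = x \<otimes> z"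
    and comm: "\<And>x y. x \<in> carrier G \<Longrightarrow> y \<in> carrier G \<Longrightarrow> x \<otimes> y \<otimes> inv (y \<otimes> x) \<in> M"
    and powM: "\<And>x. x \<in> carrier G \<Longrightarrow> x [^] q \<in> M"
    and \<alpha>: "\<alpha> \<in> hom G G" and surj: "\<alpha> ` carrier G = carrier G" and \<alpha>M: "\<And>z. z \<in> M \<Longrightarrow> \<alpha> z = z"
    and gen: "generate G {x \<otimes> inv (\<alpha> x) | x. x \<in> carrier G} = carrier G"
    and irr: "\<And>W. subgroup W G \<Longrightarrow> M \<subseteq> W \<Longrightarrow> \<alpha> ` W \<subseteq> W \<Longrightarrow> W = M \<or> W = carrier G"
    and M1: "M \<noteq> {\<one>}"
    and cyc: "\<And>c d. c \<in> M \<Longrightarrow> d \<in> M \<Longrightarrow> d \<noteq> \<one> \<Longrightarrow> c [^] q = \<one> \<Longrightarrow> d [^] q = \<one> \<Longrightarrow> \<exists>j::nat. c = d [^] j"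
  shows "card M = q" and "group_center G = M" and "\<And>z. z \<in> M \<Longrightarrow> z [^] q = \<one>"
    and "odd q \<Longrightarrow> x \<in> carrier G \<Longrightarrow> x [^] q = \<one>"
proof -
  interpret M: subgroup M G by fact
  interpret a: group_hom G G \<alpha> by unfold_locales (rule \<alpha>)
  have powcomm: "(x \<otimes> y \<otimes> inv (y \<otimes> x)) [^] q = \<one>" if x: "x \<in> carrier G" and y: "y \<in> carrier G" for x y
  proof -
    \<comment> \<open>\<open>x\<^sup>q\<close> is central, and conjugating \<open>x\<^sup>q\<close> by \<open>y\<close> multiplies it by the \<open>q\<close>-th power of the commutator.\<close>
    define c where "c = x \<otimes> y \<otimes> inv (y \<otimes> x)"
    have c: "c \<in> M" "c \<in> carrier G" using comm[OF x y] by (auto simp: c_def)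
    have xy: "x \<otimes> y = c \<otimes> (y \<otimes> x)" using x y by (simp add: c_def m_assoc inv_mult_group)
      (simp flip: m_assoc)
    have "x [^] n \<otimes> y = c [^] n \<otimes> (y \<otimes> x [^] n)" for n :: nat
    proof (induction n)
      case 0 then show ?case using y by simp
    next
      case (Suc n)
      have cn: "c [^] k \<otimes> z = z \<otimes> c [^] k" if "z \<in> carrier G" for z and k :: nat
        using central[OF c(1) that] c that by (intro group_commutes_pow) auto
      have "x [^] Suc n \<otimes> y = x [^] n \<otimes> (x \<otimes> y)" using x y by (simp add: m_assoc)
      also have "\<dots> = x [^] n \<otimes> c \<otimes> (y \<otimes> x)" using x y c by (simp add: xy m_assoc)
      also have "x [^] n \<otimes> c = c \<otimes> x [^] n" using central[OF c(1)] x by simp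
      also have "c \<otimes> x [^] n \<otimes> (y \<otimes> x) = c \<otimes> (x [^] n \<otimes> y) \<otimes> x" using x y c by (simp add: m_assoc)
      also have "\<dots> = c \<otimes> c [^] n \<otimes> (y \<otimes> (x [^] n \<otimes> x))" unfolding Suc using x y c by (simp add: m_assoc)
      also have "c \<otimes> c [^] n = c [^] Suc n" using cn[of c n] c by simp
      finally show ?case by simp
    qed
    from this[of q] have "c [^] q \<otimes> (y \<otimes> x [^] q) = \<one> \<otimes> (y \<otimes> x [^] q)"
      using central[OF powM[OF x] y] x y c by simp
    then have "c [^] q = \<one>" using x y c by (subst (asm) right_cancel) auto
    then show ?thesis by (simp add: c_def)
  qed
  have powmultM: "(z \<otimes> w) [^] n = z [^] n \<otimes> w [^] n" if "z \<in> M" "w \<in> M" for z w and n :: nat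
    using that central by (intro pow_mult_distrib) auto
  let ?W = "{z \<in> M. z [^] q = \<one>}"
  have W: "subgroup ?W G"
  proof (rule subgroupI)
    have "\<one> \<in> ?W" by simp
    then show "?W \<noteq> {}" by blast
  next
    fix z assume "z \<in> ?W"
    then show "inv z \<in> ?W" by (simp add: nat_pow_inv)
  next
    fix z w assume "z \<in> ?W" "w \<in> ?W"
    then show "z \<otimes> w \<in> ?W" by (simp add: powmultM)
  qed auto
  have "z \<in> ?W" if "z \<in> M" for z
    by (rule twisted_fixed_points_subset[OF fin W _ \<alpha> _ gen])
       (use comm powcomm \<alpha>M that in auto)
  then show expM: "z [^] q = \<one>" if "z \<in> M" for z using that by simp
  obtain d where d: "d \<in> M" "d \<noteq> \<one>" using M1 M.one_closed by blast
  have dq: "d [^] q = \<one>" using expM d by blast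
  have ordd: "ord d = q"
    using dq d q by (metis M.mem_carrier ord_eq_1 pow_eq_id prime_nat_iff)
  have "M = generate G {d}"
  proof
    show "M \<subseteq> generate G {d}"
    proof
      fix c assume c: "c \<in> M"
      then obtain j :: nat where "c = d [^] j" using cyc[OF c d] expM d by blast
      then have "c = d [^] int j" by (simp add: int_pow_int)
      then show "c \<in> generate G {d}" using d generate_pow by auto
    qed
    show "generate G {d} \<subseteq> M" using M d by (intro generate_subgroup_incl) auto
  qed
  then show cM: "card M = q" using generate_pow_card[of d] ordd d by simp
  show ctr: "group_center G = M"
  proof -
    note Z = subgroup_group_center
    have MZ: "M \<subseteq> group_center G" unfolding group_center_def using central M.mem_carrier by blast
    have aZ: "\<alpha> ` group_center G \<subseteq> group_center G"
    proof
      fix y assume "y \<in> \<alpha> ` group_center G"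
      then obtain z where z: "y = \<alpha> z" "z \<in> carrier G" "\<And>x. x \<in> carrier G \<Longrightarrow> z \<otimes> x = x \<otimes> z"
        unfolding group_center_def by blast
      have "y \<otimes> x = x \<otimes> y" if x: "x \<in> carrier G" for x
      proof -
        obtain w where w: "w \<in> carrier G" "x = \<alpha> w" using x surj by blast
        have "\<alpha> (z \<otimes> w) = \<alpha> (w \<otimes> z)" using z w by simp
        then show ?thesis using z(1,2) w by simp
      qed
      moreover have "y \<in> carrier G" using z by simp
      ultimately show "y \<in> group_center G" unfolding group_center_def by blast
    qed
    have "group_center G \<noteq> carrier G"
    proof
      assume ab: "group_center G = carrier G"
      have "d \<in> {\<one>}"
      proof (rule twisted_fixed_points_subset[OF fin triv_subgroup _ \<alpha> _ gen])
        fix x y assume xy: "x \<in> carrier G" "y \<in> carrier G"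
        then have "x \<otimes> y = y \<otimes> x" using ab unfolding group_center_def by blast
        then show "x \<otimes> y \<otimes> inv (y \<otimes> x) \<in> {\<one>}" using xy by simp
      qed (use d \<alpha>M in auto)
      then show False using d by simp
    qed
    then show ?thesis using irr[OF Z MZ aZ] by blast
  qed
  show "x [^] q = \<one>" if odd: "odd q" and x: "x \<in> carrier G"
  proof -
    have mult: "(x \<otimes> y) [^] q = x [^] q \<otimes> y [^] q" if x: "x \<in> carrier G" and y: "y \<in> carrier G" for x y
    proof -
      define c where "c = inv (x \<otimes> y) \<otimes> (y \<otimes> x)"
      have "c = inv (x \<otimes> y) \<otimes> (inv (inv x \<otimes> inv y))" using x y by (simp add: c_def inv_mult_group)
      then have "c = inv y \<otimes> inv x \<otimes> inv (inv x \<otimes> inv y)" using x y by (simp add: inv_mult_group)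
      then have cM: "c \<in> M" using comm[of "inv y" "inv x"] x y by simp
      have yx: "y \<otimes> x = x \<otimes> y \<otimes> c" using x y by (simp add: c_def flip: m_assoc)
      have "(x \<otimes> y) [^] q = x [^] q \<otimes> y [^] q \<otimes> c [^] (q * (q - 1) div 2)"
        using x y cM central yx by (intro central_commutator_mult_pow) auto
      also have "q * (q - 1) div 2 = q * ((q - 1) div 2)" using odd by (simp add: div_mult_swap)
      also have "c [^] \<dots> = (c [^] q) [^] ((q - 1) div 2)" using cM by (simp add: nat_pow_pow)
      also have "\<dots> = \<one>" using expM[OF cM] by simp
      finally show ?thesis using x y by simp
    qed
    let ?V = "{x \<in> carrier G. x [^] q = \<one>}"
    have V: "subgroup ?V G"
    proof (rule subgroupI)
      have "\<one> \<in> ?V" by simp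
      then show "?V \<noteq> {}" by blast
    qed (auto simp: mult nat_pow_inv)
    have "generate G {x \<otimes> inv (\<alpha> x) | x. x \<in> carrier G} \<subseteq> ?V"
    proof (rule generate_subgroup_incl[OF _ V], rule)
      fix u assume "u \<in> {x \<otimes> inv (\<alpha> x) | x. x \<in> carrier G}"
      then obtain x where x: "x \<in> carrier G" "u = x \<otimes> inv (\<alpha> x)" by blast
      have "u [^] q = x [^] q \<otimes> inv (\<alpha> (x [^] q))"
        using x by (simp add: mult nat_pow_inv a.hom_nat_pow)
      also have "\<dots> = \<one>" using \<alpha>M[OF powM[OF x(1)]] x by simp
      finally show "u \<in> ?V" using x by simp
    qed
    then show ?thesis using gen x by blast
  qed
qed

lemma (in group) extraspecialI:
  assumes fin: "finite (carrier G)" and q: "prime q" and M: "group_center G = M" and cM: "card M = q"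
    and comm: "\<And>x y. x \<in> carrier G \<Longrightarrow> y \<in> carrier G \<Longrightarrow> x \<otimes> y \<otimes> inv (y \<otimes> x) \<in> M"
    and pow: "\<And>x. x \<in> carrier G \<Longrightarrow> x [^] q \<in> M"
    and ord: "order G = q ^ Suc n" and n: "1 \<le> n"
  shows "extraspecial q G"
proof -
  have sM: "subgroup M G" using subgroup_group_center M by simp
  have nM: "M \<lhd> G"
  proof (rule normal_invI[OF sM])
    fix x z assume x: "x \<in> carrier G" and z: "z \<in> M"
    have zc: "z \<in> carrier G" "z \<otimes> x = x \<otimes> z" using z x unfolding M[symmetric] group_center_def by blast+
    have "x \<otimes> z \<otimes> inv x = z \<otimes> (x \<otimes> inv x)" unfolding zc(2)[symmetric] using x zc(1) by (simp only: m_assoc inv_closed)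
    then show "x \<otimes> z \<otimes> inv x \<in> M" using x z zc by simp
  qed
  interpret N: normal M G by (rule nM)
  have G: "group (G Mod M)" by (rule N.factorgroup_is_group)
  have car: "B \<in> carrier (G Mod M) \<Longrightarrow> \<exists>x\<in>carrier G. B = M #> x" for B by (auto simp: carrier_FactGroup)
  have cg: "comm_group (G Mod M)"
  proof (rule group.group_comm_groupI[OF G])
    fix B C assume "B \<in> carrier (G Mod M)" "C \<in> carrier (G Mod M)"
    then obtain x y where x: "x \<in> carrier G" "B = M #> x" and y: "y \<in> carrier G" "C = M #> y" using car by meson
    have "M #> (x \<otimes> y) = M #> (y \<otimes> x)" using coset_eq_iff_mult_inv[OF sM] x y comm by simp
    then show "B \<otimes>\<^bsub>G Mod M\<^esub> C = C \<otimes>\<^bsub>G Mod M\<^esub> B" using x y by (simp add: N.rcos_sum)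
  qed
  have pw: "B [^]\<^bsub>G Mod M\<^esub> q = \<one>\<^bsub>G Mod M\<^esub>" if B: "B \<in> carrier (G Mod M)" for B
  proof -
    obtain x where x: "x \<in> carrier G" "B = M #> x" using car[OF B] by blast
    then show ?thesis using N.FactGroup_pow[OF x(1), of q] coset_join2[OF _ sM pow[OF x(1)]] by simp
  qed
  have "\<not> trivial_group (G Mod M)"
  proof
    assume "trivial_group (G Mod M)"
    then have "card (rcosets M) = 1" by (auto simp: trivial_group_def FactGroup_def)
    then have "q = q ^ Suc n" using lagrange[OF sM] ord cM by simp
    moreover have "1 < q ^ n" using one_less_power[OF prime_gt_1_nat[OF q]] n by simp
    ultimately show False using prime_gt_0_nat[OF q] by simp
  qed
  moreover have "\<exists>k. order G = q ^ k" using ord by blast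
  ultimately show ?thesis
    unfolding extraspecial_def elementary_abelian_def M using q is_group cM cg pw by blast
qed

lemma (in group) ord_eq_prime:
  assumes "x \<in> carrier G" "x \<noteq> \<one>" "x [^] q = \<one>" "prime (q::nat)" shows "ord x = q"
proof -
  have "ord x dvd q" using assms pow_eq_id by simp
  moreover have "ord x \<noteq> 1" using assms ord_eq_1 by simp
  ultimately show ?thesis using assms(4) by (metis prime_nat_iff)
qed

section \<open>Permutation groups of prime power degree\<close>

interpretation Sym: group "BijGroup S" for S
  by (rule group_BijGroup)

lemma carrier_BijGroup [simp]: "carrier (BijGroup S) = Bij S"
  by (simp add: BijGroup_def)

lemma Bij_apply_closed: "g \<in> Bij S \<Longrightarrow> x \<in> S \<Longrightarrow> g x \<in> S"
  by (auto simp: Bij_def bij_betw_def)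

lemma Bij_mult_closed [simp]: "g \<in> Bij S \<Longrightarrow> h \<in> Bij S \<Longrightarrow> g \<otimes>\<^bsub>BijGroup S\<^esub> h \<in> Bij S"
  using Sym.m_closed[of g S h] by simp

lemma Bij_inv_closed [simp]: "g \<in> Bij S \<Longrightarrow> inv\<^bsub>BijGroup S\<^esub> g \<in> Bij S"
  using Sym.inv_closed[of g S] by simp

lemma Bij_one_closed [simp]: "\<one>\<^bsub>BijGroup S\<^esub> \<in> Bij S"
  using Sym.one_closed[of S] by simp

lemma Bij_mult_apply:
  "g \<in> Bij S \<Longrightarrow> h \<in> Bij S \<Longrightarrow> x \<in> S \<Longrightarrow> (g \<otimes>\<^bsub>BijGroup S\<^esub> h) x = g (h x)"
  by (simp add: BijGroup_def compose_def)

lemma Bij_one_apply: "x \<in> S \<Longrightarrow> \<one>\<^bsub>BijGroup S\<^esub> x = x"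
  by (simp add: BijGroup_def)

lemma Bij_inv_apply: "g \<in> Bij S \<Longrightarrow> x \<in> S \<Longrightarrow> (inv\<^bsub>BijGroup S\<^esub> g) (g x) = x"
  using Bij_mult_apply[of "inv\<^bsub>BijGroup S\<^esub> g" S g x] Sym.l_inv[of g S]
  by (simp add: Bij_inv_closed Bij_one_apply)

lemma Bij_apply_inv: "g \<in> Bij S \<Longrightarrow> x \<in> S \<Longrightarrow> g ((inv\<^bsub>BijGroup S\<^esub> g) x) = x"
  using Bij_mult_apply[of g S "inv\<^bsub>BijGroup S\<^esub> g" x] Sym.r_inv[of g S]
  by (simp add: Bij_inv_closed Bij_one_apply)

lemma Bij_eqI: "g \<in> Bij S \<Longrightarrow> h \<in> Bij S \<Longrightarrow> (\<And>x. x \<in> S \<Longrightarrow> g x = h x) \<Longrightarrow> g = h"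
  by (rule extensionalityI[of _ S]) (auto simp: Bij_def)

lemma Bij_pow_closed [simp]: "g \<in> Bij S \<Longrightarrow> g [^]\<^bsub>BijGroup S\<^esub> (n::nat) \<in> Bij S"
  using Sym.nat_pow_closed[of g S n] by simp

lemma Bij_pow_fixed: "g \<in> Bij S \<Longrightarrow> x \<in> S \<Longrightarrow> g x = x \<Longrightarrow> (g [^]\<^bsub>BijGroup S\<^esub> (n::nat)) x = x"
  by (induction n) (simp_all add: Bij_one_apply Bij_mult_apply Bij_pow_closed)

lemma finite_Bij: "finite S \<Longrightarrow> finite (Bij S)"
proof -
  assume "finite S"
  moreover have "Bij S \<subseteq> S \<rightarrow>\<^sub>E S" by (auto simp: Bij_def PiE_def bij_betw_def)
  ultimately show ?thesis by (meson finite_PiE finite_subset)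
qed

lemma Bij_subgroup_finite: "finite S \<Longrightarrow> subgroup H (BijGroup S) \<Longrightarrow> finite H"
  using finite_Bij subgroup.subset finite_subset by fastforce

lemma Bij_subgroup_action:
  assumes "subgroup H (BijGroup S)"
  shows "group_action (BijGroup S\<lparr>carrier := H\<rparr>) S (\<lambda>h. h)"
proof -
  have "group (BijGroup S\<lparr>carrier := H\<rparr>)"
    using assms by (simp add: subgroup.subgroup_is_group group_BijGroup)
  moreover have "H \<subseteq> Bij S" using subgroup.subset[OF assms] by simp
  ultimately show ?thesis
    by (auto simp: group_action_def group_hom_def group_hom_axioms_def group_BijGroup hom_def)
qed

text \<open>A subgroup of order \<open>r\<close> has no other fixed points than \<open>J\<close>.\<close>

lemma card_mod_prime_if_unique_fixed_point:
  assumes fin: "finite S" and J: "subgroup J (BijGroup S)" and x: "x \<in> S"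
    and fixed: "\<And>g. g \<in> J \<Longrightarrow> g x = x"
    and semi: "\<And>g y. g \<in> J \<Longrightarrow> y \<in> S \<Longrightarrow> y \<noteq> x \<Longrightarrow> g y = y \<Longrightarrow> g = \<one>\<^bsub>BijGroup S\<^esub>"
    and r: "prime r" and dvd: "r dvd card J"
  shows "card S mod r = 1"
proof -
  let ?J = "BijGroup S\<lparr>carrier := J\<rparr>"
  have Jg: "group ?J" using J by (simp add: subgroup.subgroup_is_group group_BijGroup)
  obtain k where "card J = r ^ 1 * k" using dvd by auto
  then obtain T where T: "subgroup T ?J" "card T = r ^ 1"
    using sylow_thm[OF r Jg, of 1 k] Bij_subgroup_finite[OF fin J] by (auto simp: order_def)
  have TS: "subgroup T (BijGroup S)" using Sym.incl_subgroup[OF J T(1)] .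
  have TJ: "T \<subseteq> J" using subgroup.subset[OF T(1)] by simp
  have "card T \<noteq> 1" using T r by auto
  then have "T \<noteq> {\<one>\<^bsub>BijGroup S\<^esub>}" by auto
  then obtain g where g: "g \<in> T" "g \<noteq> \<one>\<^bsub>BijGroup S\<^esub>" using subgroup.one_closed[OF TS] by blast
  have "{y \<in> S. \<forall>g\<in>T. g y = y} = {x}"
  proof
    show "{y \<in> S. \<forall>g\<in>T. g y = y} \<subseteq> {x}" using g semi TJ by blast
    show "{x} \<subseteq> {y \<in> S. \<forall>g\<in>T. g y = y}" using x fixed TJ by blast
  qed
  moreover have "card S mod r = card {y \<in> S. \<forall>g\<in>T. g y = y} mod r"
    using group_action.card_fixed_points_mod[OF Bij_subgroup_action[OF TS] r _ fin, of 1] T(2)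
    by (simp add: order_def)
  ultimately show ?thesis using prime_gt_1_nat[OF r] by simp
qed

text \<open>In prime power degree Frobenius' theorem is elementary. By \<open>card_mod_prime_if_unique_fixed_point\<close>, point stabilizers have order
prime to \<open>p\<close>; so a Sylow \<open>p\<close>-subgroup has order \<open>p ^ m\<close> and all its elements lie in \<open>P\<close>. Distinct
stabilizers meet trivially, and counting their elements leaves exactly \<open>p ^ m\<close> elements for \<open>P\<close>.\<close>

lemma Frobenius_kernel_prime_power_degree:
  assumes fin: "finite S" and p: "prime p" and cS: "card S = p ^ m" and m: "1 \<le> m"
    and H: "subgroup H (BijGroup S)"
    and trans: "\<And>x y. x \<in> S \<Longrightarrow> y \<in> S \<Longrightarrow> \<exists>h\<in>H. h x = y"
    and rigid: "\<And>h x y. h \<in> H \<Longrightarrow> x \<in> S \<Longrightarrow> y \<in> S \<Longrightarrow> x \<noteq> y \<Longrightarrow> h x = x \<Longrightarrow> h y = y \<Longrightarrow> h = \<one>\<^bsub>BijGroup S\<^esub>"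
  defines "P \<equiv> {h \<in> H. h = \<one>\<^bsub>BijGroup S\<^esub> \<or> (\<forall>x\<in>S. h x \<noteq> x)}"
  shows "subgroup P (BijGroup S)" and "card P = p ^ m"
    and "\<And>x y. x \<in> S \<Longrightarrow> y \<in> S \<Longrightarrow> \<exists>h\<in>P. h x = y"
    and "\<And>c x. c \<in> H \<Longrightarrow> x \<in> S \<Longrightarrow> c x = x \<Longrightarrow> c [^]\<^bsub>BijGroup S\<^esub> p = \<one>\<^bsub>BijGroup S\<^esub> \<Longrightarrow> c = \<one>\<^bsub>BijGroup S\<^esub>"
proof -
  let ?B = "BijGroup S" and ?HG = "BijGroup S\<lparr>carrier := H\<rparr>"
  interpret H: subgroup H ?B by fact
  interpret HG: group ?HG using H by (simp add: subgroup.subgroup_is_group group_BijGroup)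
  interpret act: group_action ?HG S "\<lambda>h. h" by (rule Bij_subgroup_action[OF H])
  have HB: "H \<subseteq> Bij S" using H.subset by simp
  have p1: "1 < p" using p prime_gt_1_nat by blast
  have finH: "finite H" by (rule Bij_subgroup_finite[OF fin H])
  have S0: "S \<noteq> {}" using cS p1 by auto
  then obtain w where w: "w \<in> S" by blast
  define St where "St x = {h \<in> H. h x = x}" for x
  have St_eq: "St x = stabilizer ?HG (\<lambda>h. h) x" for x by (simp add: St_def stabilizer_def)
  have St: "subgroup (St x) ?B" if "x \<in> S" for x
    using Sym.incl_subgroup[OF H] act.stabilizer_subgroup[OF that] by (simp add: St_eq)
  have orb: "p ^ m * card (St x) = card H" if x: "x \<in> S" for x
  proof -
    have "orbit ?HG (\<lambda>h. h) x = S"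
      using trans[OF x] HB Bij_apply_closed[of _ S x] x by (fastforce simp: orbit_def)
    then show ?thesis using act.orbit_stabilizer_theorem[OF x] cS by (simp add: St_eq order_def)
  qed
  have cSt: "card (St x) = card (St w)" if "x \<in> S" for x
    using orb[OF that] orb[OF w] p1 by (metis mult_cancel1 power_not_zero not_one_less_zero)
  have ndvd: "\<not> p dvd card (St x)" if x: "x \<in> S" for x
  proof
    assume "p dvd card (St x)"
    then have "card S mod p = 1"
      using card_mod_prime_if_unique_fixed_point[OF fin St[OF x] x _ _ p] rigid x by (auto simp: St_def)
    then show False using cS m by (metis dvd_imp_mod_0 dvd_power zero_neq_one less_le_trans zero_less_one)
  qed
  obtain T where T: "subgroup T ?HG" "card T = p ^ m"
    using sylow_thm[OF p HG.is_group, of m "card (St w)"] orb[OF w] finH by (auto simp: order_def)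
  have TS: "subgroup T ?B" using Sym.incl_subgroup[OF H T(1)] .
  have TH: "T \<subseteq> H" using subgroup.subset[OF T(1)] by simp
  have TSt: "h = \<one>\<^bsub>?B\<^esub>" if "h \<in> T" "x \<in> S" "h x = x" for h x
  proof -
    have "h \<in> Bij S" using that TH HB by blast
    have dT: "h [^]\<^bsub>?B\<^esub> card T = \<one>\<^bsub>?B\<^esub>"
      using group.pow_order_eq_1[OF subgroup.subgroup_is_group[OF TS group_BijGroup]] that
      by (simp add: order_def flip: Sym.nat_pow_consistent)
    have dS: "h [^]\<^bsub>?B\<^esub> card (St x) = \<one>\<^bsub>?B\<^esub>"
      using group.pow_order_eq_1[OF subgroup.subgroup_is_group[OF St[OF that(2)] group_BijGroup]] that TH
      by (auto simp: order_def St_def simp flip: Sym.nat_pow_consistent)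
    have "Sym.ord S h dvd p ^ m" "Sym.ord S h dvd card (St x)"
      using dT dS T \<open>h \<in> Bij S\<close> by (simp_all add: Sym.pow_eq_id)
    moreover have "coprime (p ^ m) (card (St x))"
      using ndvd[OF that(2)] p prime_imp_coprime by (metis coprime_power_left_iff)
    ultimately have "Sym.ord S h = 1" by (metis coprime_common_divisor nat_dvd_1_iff_1)
    then show ?thesis using \<open>h \<in> Bij S\<close> Sym.ord_eq_1[of h S] by simp
  qed
  show last: "c = \<one>\<^bsub>?B\<^esub>" if c: "c \<in> H" "x \<in> S" "c x = x" "c [^]\<^bsub>?B\<^esub> p = \<one>\<^bsub>?B\<^esub>" for c x
  proof -
    have cB: "c \<in> Bij S" using c HB by blast
    have "c [^]\<^bsub>?B\<^esub> card (St x) = \<one>\<^bsub>?B\<^esub>"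
      using group.pow_order_eq_1[OF subgroup.subgroup_is_group[OF St[OF c(2)] group_BijGroup]] c
      by (auto simp: order_def St_def simp flip: Sym.nat_pow_consistent)
    then have "Sym.ord S c dvd p" "Sym.ord S c dvd card (St x)"
      using c cB by (simp_all add: Sym.pow_eq_id)
    then have "Sym.ord S c = 1" using ndvd[OF c(2)] p by (metis prime_nat_iff)
    then show ?thesis using cB Sym.ord_eq_1[of c S] by simp
  qed
  have TP: "T \<subseteq> P"
    using TSt TH by (auto simp: P_def)
  have finP: "finite P" using finH by (simp add: P_def)
  have card: "card H = card P + p ^ m * (card (St w) - 1)"
  proof -
    let ?one = "\<one>\<^bsub>?B\<^esub>"
    have "H - P = (\<Union>x\<in>S. St x - {?one})"
      by (auto simp: P_def St_def)
    moreover have "card (\<Union>x\<in>S. St x - {?one}) = (\<Sum>x\<in>S. card (St x - {?one}))"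
    proof (rule card_UN_disjoint[OF fin])
      show "\<forall>x\<in>S. finite (St x - {?one})" using finH by (auto simp: St_def)
      show "\<forall>x\<in>S. \<forall>y\<in>S. x \<noteq> y \<longrightarrow> (St x - {?one}) \<inter> (St y - {?one}) = {}"
        using rigid by (auto simp: St_def)
    qed
    moreover have "card (St x - {?one}) = card (St w) - 1" if "x \<in> S" for x
      using cSt[OF that] subgroup.one_closed[OF St[OF that]] by simp
    ultimately have "card (H - P) = p ^ m * (card (St w) - 1)" using cS by simp
    moreover have "card H = card P + card (H - P)"
    proof -
      have "P \<subseteq> H" by (auto simp: P_def)
      then show ?thesis using card_Diff_subset[OF finP] card_mono[OF finH] by simp
    qed
    ultimately show ?thesis by simp
  qed
  have "0 < card (St w)"
  proof -
    have "finite (St w)" using finH by (simp add: St_def)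
    moreover have "St w \<noteq> {}" using subgroup.one_closed[OF St[OF w]] by blast
    ultimately show ?thesis by (simp add: card_gt_0_iff)
  qed
  then have "p ^ m + p ^ m * (card (St w) - 1) = card H" using orb[OF w] by (cases "card (St w)") auto
  then show cP: "card P = p ^ m" using card by simp
  have PT: "P = T" using card_subset_eq[OF finP TP] T cP by simp
  show "subgroup P ?B" using TS PT by simp
  show "\<exists>h\<in>P. h x = y" if x: "x \<in> S" and y: "y \<in> S" for x y
  proof -
    have "inj_on (\<lambda>h. h x) T"
    proof (rule inj_onI)
      fix g h assume gh: "g \<in> T" "h \<in> T" "g x = h x"
      have B: "g \<in> Bij S" "h \<in> Bij S" using gh TH HB by auto
      have "(inv\<^bsub>?B\<^esub> h \<otimes>\<^bsub>?B\<^esub> g) x = x"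
        using B x gh by (simp add: Bij_mult_apply Bij_inv_closed Bij_inv_apply)
      then have "inv\<^bsub>?B\<^esub> h \<otimes>\<^bsub>?B\<^esub> g = \<one>\<^bsub>?B\<^esub>"
        using TSt[OF _ x] TS gh by (simp add: subgroup.m_closed subgroup.m_inv_closed)
      moreover have "h \<otimes>\<^bsub>?B\<^esub> (inv\<^bsub>?B\<^esub> h \<otimes>\<^bsub>?B\<^esub> g) = g" using B by (simp flip: Sym.m_assoc)
      ultimately show "g = h" using B by simp
    qed
    then have c: "card ((\<lambda>h. h x) ` T) = card S" using T cS card_image by metis
    have "(\<lambda>h. h x) ` T \<subseteq> S"
    proof (rule image_subsetI)
      fix h assume "h \<in> T"
      then have "h \<in> Bij S" using TH HB by blast
      then show "h x \<in> S" using x by (rule Bij_apply_closed)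
    qed
    from card_subset_eq[OF fin this c] have "(\<lambda>h. h x) ` T = S" .
    then have "y \<in> (\<lambda>h. h x) ` T" using y by simp
    then obtain h where "h \<in> T" "h x = y" by (elim imageE) simp
    then show ?thesis unfolding PT by (rule_tac bexI)
  qed
qed

section \<open>Automorphisms and subquandles of finite quandles\<close>

text \<open>Like the left translations, automorphisms are cut off outside the carrier, so that they form a subgroup of
the permutation group.\<close>

definition qaut :: "'a magma \<Rightarrow> ('a \<Rightarrow> 'a) set" where
  "qaut Q = {h \<in> Bij (carrier Q). \<forall>x\<in>carrier Q. \<forall>y\<in>carrier Q. h (x \<rhd>\<^bsub>Q\<^esub> y) = h x \<rhd>\<^bsub>Q\<^esub> h y}"

locale finite_quandle =
  fixes Q :: "'a magma" (structure)
  assumes quandle: "quandle Q" and finite_carrier: "finite (carrier Q)"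
begin

abbreviation "A \<equiv> BijGroup (carrier Q)"
abbreviation "L \<equiv> left_mult Q"
abbreviation perm_mult (infixl \<open>\<cdot>\<close> 70) where "g \<cdot> h \<equiv> g \<otimes>\<^bsub>A\<^esub> h"
abbreviation perm_inv (\<open>\<iota> _\<close> [81] 80) where "\<iota> g \<equiv> inv\<^bsub>A\<^esub> g"
abbreviation perm_one (\<open>id\<^sub>Q\<close>) where "id\<^sub>Q \<equiv> \<one>\<^bsub>A\<^esub>"

lemma bij_left: "a \<in> carrier Q \<Longrightarrow> bij_betw (\<lambda>b. a \<rhd> b) (carrier Q) (carrier Q)"
  using quandle unfolding quandle_def by blast

lemma op_closed [simp]: "a \<in> carrier Q \<Longrightarrow> b \<in> carrier Q \<Longrightarrow> a \<rhd> b \<in> carrier Q"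
  using bij_left by (auto simp: bij_betw_def)

lemma distrib:
  "a \<in> carrier Q \<Longrightarrow> b \<in> carrier Q \<Longrightarrow> c \<in> carrier Q \<Longrightarrow> a \<rhd> (b \<rhd> c) = (a \<rhd> b) \<rhd> (a \<rhd> c)"
  using quandle unfolding quandle_def by blast

lemma idem [simp]: "a \<in> carrier Q \<Longrightarrow> a \<rhd> a = a"
  using quandle unfolding quandle_def by blast

lemma left_div_closed [simp]: "a \<in> carrier Q \<Longrightarrow> b \<in> carrier Q \<Longrightarrow> left_div Q a b \<in> carrier Q"
  unfolding left_div_def using bij_left by (metis bij_betw_def inv_into_into)

lemma op_left_div: "a \<in> carrier Q \<Longrightarrow> b \<in> carrier Q \<Longrightarrow> a \<rhd> left_div Q a b = b"
  unfolding left_div_def using bij_left bij_betw_inv_into_right by fastforce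

lemma left_div_eqI:
  "a \<in> carrier Q \<Longrightarrow> c \<in> carrier Q \<Longrightarrow> a \<rhd> c = b \<Longrightarrow> left_div Q a b = c"
  unfolding left_div_def using bij_left bij_betw_inv_into_left by fastforce

lemma left_div_op: "a \<in> carrier Q \<Longrightarrow> c \<in> carrier Q \<Longrightarrow> left_div Q a (a \<rhd> c) = c"
  by (rule left_div_eqI) auto

lemma left_mult_apply: "b \<in> carrier Q \<Longrightarrow> L a b = a \<rhd> b"
  by (simp add: left_mult_def)

lemma left_mult_Bij: "a \<in> carrier Q \<Longrightarrow> L a \<in> Bij (carrier Q)"
  using bij_left by (simp add: left_mult_def Bij_def cong: bij_betw_cong)

lemma qaut_Bij: "h \<in> qaut Q \<Longrightarrow> h \<in> Bij (carrier Q)"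
  by (simp add: qaut_def)

lemma qaut_closed: "h \<in> qaut Q \<Longrightarrow> x \<in> carrier Q \<Longrightarrow> h x \<in> carrier Q"
  by (rule Bij_apply_closed[OF qaut_Bij])

lemma qaut_op: "h \<in> qaut Q \<Longrightarrow> x \<in> carrier Q \<Longrightarrow> y \<in> carrier Q \<Longrightarrow> h (x \<rhd> y) = h x \<rhd> h y"
  by (simp add: qaut_def)

lemma left_mult_qaut: "a \<in> carrier Q \<Longrightarrow> L a \<in> qaut Q"
  unfolding qaut_def using left_mult_Bij by (auto simp: left_mult_apply intro: distrib)

lemma subgroup_qaut: "subgroup (qaut Q) A"
proof (rule Sym.subgroupI)
  show "qaut Q \<subseteq> carrier A" by (auto simp: qaut_def)
  have "id\<^sub>Q \<in> qaut Q" using Sym.one_closed[of "carrier Q"] by (simp add: qaut_def Bij_one_apply)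
  then show "qaut Q \<noteq> {}" by blast
next
  fix h assume h: "h \<in> qaut Q"
  have B: "h \<in> Bij (carrier Q)" "\<iota> h \<in> Bij (carrier Q)" using h qaut_Bij Bij_inv_closed by auto
  have "(\<iota> h) (x \<rhd> y) = (\<iota> h) x \<rhd> (\<iota> h) y" if "x \<in> carrier Q" "y \<in> carrier Q" for x y
  proof -
    let ?x = "(\<iota> h) x" and ?y = "(\<iota> h) y"
    have c: "?x \<in> carrier Q" "?y \<in> carrier Q" using that Bij_apply_closed[OF B(2)] by simp_all
    have "h (?x \<rhd> ?y) = x \<rhd> y" using qaut_op[OF h c] B that by (simp add: Bij_apply_inv)
    then show ?thesis using Bij_inv_apply[OF B(1), of "?x \<rhd> ?y"] c by simp
  qed
  then show "\<iota> h \<in> qaut Q" using B by (simp add: qaut_def)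
next
  fix g h assume "g \<in> qaut Q" "h \<in> qaut Q"
  then show "g \<cdot> h \<in> qaut Q"
    by (simp add: qaut_def Bij_mult_closed Bij_mult_apply Bij_apply_closed)
qed

lemma qaut_mult: "g \<in> qaut Q \<Longrightarrow> h \<in> qaut Q \<Longrightarrow> g \<cdot> h \<in> qaut Q"
  and qaut_inv: "g \<in> qaut Q \<Longrightarrow> \<iota> g \<in> qaut Q"
  by (rule subgroup.m_closed[OF subgroup_qaut], assumption+)
     (rule subgroup.m_inv_closed[OF subgroup_qaut])

lemma qaut_mult_apply: "g \<in> qaut Q \<Longrightarrow> h \<in> qaut Q \<Longrightarrow> x \<in> carrier Q \<Longrightarrow> (g \<cdot> h) x = g (h x)"
  and qaut_inv_apply: "g \<in> qaut Q \<Longrightarrow> x \<in> carrier Q \<Longrightarrow> (\<iota> g) (g x) = x"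
  and qaut_apply_inv: "g \<in> qaut Q \<Longrightarrow> x \<in> carrier Q \<Longrightarrow> g ((\<iota> g) x) = x"
  by (simp_all add: qaut_Bij Bij_mult_apply Bij_inv_apply Bij_apply_inv)

lemma inv_left_mult_apply:
  assumes "a \<in> carrier Q" "b \<in> carrier Q" shows "(\<iota> L a) b = left_div Q a b"
proof -
  have "(\<iota> L a) b \<in> carrier Q"
    by (rule qaut_closed[OF qaut_inv[OF left_mult_qaut]]) (use assms in auto)
  moreover have "a \<rhd> (\<iota> L a) b = b"
    using qaut_apply_inv[OF left_mult_qaut[OF assms(1)] assms(2)] calculation by (simp add: left_mult_apply)
  ultimately show ?thesis using left_div_eqI assms by metis
qed

lemma qaut_left_mult_comm:
  assumes "h \<in> qaut Q" "a \<in> carrier Q"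
  shows "h \<cdot> L a = L (h a) \<cdot> h"
  by (rule Bij_eqI[of _ "carrier Q"])
     (use assms qaut_closed in \<open>auto simp: qaut_mult_apply left_mult_qaut left_mult_apply qaut_op qaut_mult qaut_Bij\<close>)

lemma qaut_conj_left_mult:
  assumes "h \<in> qaut Q" "a \<in> carrier Q"
  shows "h \<cdot> L a \<cdot> \<iota> h = L (h a)"
proof -
  have "h \<in> carrier A" "L (h a) \<in> carrier A" using assms qaut_Bij left_mult_Bij qaut_closed by auto
  then show ?thesis unfolding qaut_left_mult_comm[OF assms] by (simp add: Sym.m_assoc)
qed

text \<open>On a finite set closed under the injective map \<open>\<lambda>b. a \<rhd> b\<close> that map is onto, so closure under left
division is automatic.\<close>

lemma subquandleI:
  assumes T: "T \<subseteq> carrier Q" and cl: "\<And>a b. a \<in> T \<Longrightarrow> b \<in> T \<Longrightarrow> a \<rhd> b \<in> T"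
  shows "subquandle Q T"
proof -
  have "left_div Q a b \<in> T" if ab: "a \<in> T" "b \<in> T" for a b
  proof -
    have "inj_on (\<lambda>b. a \<rhd> b) T"
      using bij_left[of a] ab T by (auto simp: bij_betw_def intro: inj_on_subset)
    moreover have "(\<lambda>b. a \<rhd> b) ` T \<subseteq> T" using cl ab by blast
    ultimately have "(\<lambda>b. a \<rhd> b) ` T = T"
      using T finite_carrier finite_subset endo_inj_surj by metis
    then have "b \<in> (\<lambda>b. a \<rhd> b) ` T" using ab by simp
    then obtain c where c: "b = a \<rhd> c" "c \<in> T" by (rule imageE)
    then have "left_div Q a b = c" using T ab by (intro left_div_eqI) auto
    then show ?thesis using c by simp
  qed
  then show ?thesis using T cl by (auto simp: subquandle_def)
qed

lemma subquandle_Int: "subquandle Q T \<Longrightarrow> subquandle Q U \<Longrightarrow> subquandle Q (T \<inter> U)"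
  by (auto simp: subquandle_def)

lemma subquandle_fixed_points:
  assumes "h \<in> qaut Q" shows "subquandle Q {x \<in> carrier Q. h x = x}"
  by (rule subquandleI) (use assms in \<open>auto simp: qaut_op\<close>)

lemma subquandle_imp_finite_quandle:
  assumes T: "subquandle Q T" shows "finite_quandle (Q\<lparr>carrier := T\<rparr>)"
proof
  have TS: "T \<subseteq> carrier Q" using T by (simp add: subquandle_def)
  show "finite (carrier (Q\<lparr>carrier := T\<rparr>))" using finite_subset[OF TS finite_carrier] by simp
  have "bij_betw (\<lambda>b. a \<rhd> b) T T" if a: "a \<in> T" for a
  proof (rule bij_betw_byWitness[where f' = "left_div Q a"])
    show "\<forall>b\<in>T. left_div Q a (a \<rhd> b) = b" using a TS left_div_eqI by blast
    show "\<forall>b\<in>T. a \<rhd> left_div Q a b = b" using a TS op_left_div by blast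
  qed (use T a in \<open>auto simp: subquandle_def\<close>)
  moreover have "a \<rhd> (b \<rhd> c) = (a \<rhd> b) \<rhd> (a \<rhd> c)" if "a \<in> T" "b \<in> T" "c \<in> T" for a b c
    by (rule distrib) (use that TS in auto)
  moreover have "a \<rhd> a = a" if "a \<in> T" for a using that TS by auto
  ultimately show "quandle (Q\<lparr>carrier := T\<rparr>)" by (simp add: quandle_def)
qed

lemma left_div_subquandle:
  assumes T: "subquandle Q T" and ab: "a \<in> T" "b \<in> T"
  shows "left_div (Q\<lparr>carrier := T\<rparr>) a b = left_div Q a b"
proof -
  interpret T: finite_quandle "Q\<lparr>carrier := T\<rparr>" by (rule subquandle_imp_finite_quandle[OF T])
  have "left_div Q a b \<in> T" using T ab by (simp add: subquandle_def)
  moreover have "a \<rhd> left_div Q a b = b" using T ab op_left_div by (auto simp: subquandle_def)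
  ultimately show ?thesis using T.left_div_eqI[of a "left_div Q a b" b] ab by simp
qed

lemma subquandle_of_subquandle:
  assumes T: "subquandle Q T"
  shows "subquandle (Q\<lparr>carrier := T\<rparr>) U \<longleftrightarrow> subquandle Q U \<and> U \<subseteq> T"
proof -
  have "T \<subseteq> carrier Q" using T by (simp add: subquandle_def)
  moreover have "left_div (Q\<lparr>carrier := T\<rparr>) a b = left_div Q a b" if "U \<subseteq> T" "a \<in> U" "b \<in> U" for a b
    using left_div_subquandle[OF T, of a b] that by auto
  ultimately show ?thesis by (cases "U \<subseteq> T") (auto simp: subquandle_def)
qed

lemma qaut_restrict:
  assumes h: "h \<in> qaut Q" and sub: "subquandle Q T" and hT: "h ` T = T"
  shows "restrict h T \<in> qaut (Q\<lparr>carrier := T\<rparr>)"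
proof -
  have T: "T \<subseteq> carrier Q" and cl: "\<And>x y. x \<in> T \<Longrightarrow> y \<in> T \<Longrightarrow> x \<rhd> y \<in> T"
    using sub by (auto simp: subquandle_def)
  have "inj_on h T" using h T by (auto simp: qaut_def Bij_def bij_betw_def intro: inj_on_subset)
  then have "restrict h T \<in> Bij T" using hT by (simp add: Bij_def bij_betw_def inj_on_restrict_eq)
  moreover have "restrict h T (x \<rhd> y) = restrict h T x \<rhd> restrict h T y"
    if "x \<in> T" "y \<in> T" "x \<rhd> y \<in> T" for x y
    using that T qaut_op[OF h, of x y] by auto
  ultimately show ?thesis using cl by (simp add: qaut_def)
qed

end

section \<open>Strictly simple homogeneous quandles\<close>

text \<open>For a strictly simple affine quandle these are the maps \<open>x \<mapsto> x + t\<close>: an affine automorphism with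
nontrivial linear part has a fixed point.\<close>

definition translation_group :: "'a magma \<Rightarrow> ('a \<Rightarrow> 'a) set" where
  "translation_group Q = {h \<in> qaut Q. h = \<one>\<^bsub>BijGroup (carrier Q)\<^esub> \<or> (\<forall>x\<in>carrier Q. h x \<noteq> x)}"

text \<open>Strict simplicity appears as generation by any two points. Transitivity is required of the automorphism
group only, because this is what the classes of a congruence inherit from a connected quandle.\<close>

locale simple_homogeneous = finite_quandle Q for Q :: "'a magma" (structure) +
  fixes p m :: nat
  assumes p: "prime p" and card_carrier: "card (carrier Q) = p ^ m"
    and generated: "\<And>T a b. subquandle Q T \<Longrightarrow> a \<in> T \<Longrightarrow> b \<in> T \<Longrightarrow> a \<noteq> b \<Longrightarrow> T = carrier Q"
    and two_points: "\<exists>a\<in>carrier Q. \<exists>b\<in>carrier Q. a \<noteq> b"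
    and homogeneous: "\<And>x y. x \<in> carrier Q \<Longrightarrow> y \<in> carrier Q \<Longrightarrow> \<exists>h\<in>qaut Q. h x = y"
begin

abbreviation "P \<equiv> translation_group Q"

lemma qaut_rigid:
  assumes h: "h \<in> qaut Q" and x: "x \<in> carrier Q" "h x = x" and y: "y \<in> carrier Q" "h y = y" and ne: "x \<noteq> y"
  shows "h = id\<^sub>Q"
proof (rule Bij_eqI[of _ "carrier Q"])
  have "{z \<in> carrier Q. h z = z} = carrier Q"
    by (rule generated[OF subquandle_fixed_points[OF h], of x y]) (use x y ne in auto)
  then show "h z = id\<^sub>Q z" if "z \<in> carrier Q" for z using that by (auto simp: Bij_one_apply)
qed (use h qaut_Bij in auto)

lemma m_pos: "1 \<le> m"
proof (rule ccontr)
  assume "\<not> 1 \<le> m"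
  then have "card (carrier Q) = 1" using card_carrier by simp
  then show False using two_points by (auto simp: card_1_singleton_iff)
qed

lemmas Frobenius = Frobenius_kernel_prime_power_degree[OF finite_carrier p card_carrier m_pos subgroup_qaut homogeneous,
    folded translation_group_def]

lemma subgroup_P: "subgroup P A"
  by (rule Frobenius(1)) (use qaut_rigid in auto)

lemma card_P: "card P = p ^ m"
  by (rule Frobenius(2)) (use qaut_rigid in auto)

lemma P_transitive: "x \<in> carrier Q \<Longrightarrow> y \<in> carrier Q \<Longrightarrow> \<exists>h\<in>P. h x = y"
  by (rule Frobenius(3)) (use qaut_rigid in auto)

lemma stabilizer_p_torsion_free:
  "c \<in> qaut Q \<Longrightarrow> x \<in> carrier Q \<Longrightarrow> c x = x \<Longrightarrow> c [^]\<^bsub>A\<^esub> p = id\<^sub>Q \<Longrightarrow> c = id\<^sub>Q"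
  by (rule Frobenius(4)) (use qaut_rigid in auto)

lemma P_qaut: "h \<in> P \<Longrightarrow> h \<in> qaut Q"
  by (simp add: translation_group_def)

lemma P_Bij: "h \<in> P \<Longrightarrow> h \<in> Bij (carrier Q)"
  by (simp add: P_qaut qaut_Bij)

lemma P_fixed: "h \<in> P \<Longrightarrow> x \<in> carrier Q \<Longrightarrow> h x = x \<Longrightarrow> h = id\<^sub>Q"
  by (auto simp: translation_group_def)

lemma P_mult: "g \<in> P \<Longrightarrow> h \<in> P \<Longrightarrow> g \<cdot> h \<in> P"
  by (rule subgroup.m_closed[OF subgroup_P])

lemma P_inv: "g \<in> P \<Longrightarrow> \<iota> g \<in> P"
  by (rule subgroup.m_inv_closed[OF subgroup_P])

lemma P_eqI: "g \<in> P \<Longrightarrow> h \<in> P \<Longrightarrow> x \<in> carrier Q \<Longrightarrow> g x = h x \<Longrightarrow> g = h"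
proof -
  assume g: "g \<in> P" and h: "h \<in> P" and x: "x \<in> carrier Q" and e: "g x = h x"
  have "(\<iota> h \<cdot> g) x = x"
    using g h x e by (simp add: qaut_mult_apply P_qaut qaut_inv qaut_inv_apply)
  then have "\<iota> h \<cdot> g = id\<^sub>Q" using P_fixed[OF P_mult[OF P_inv[OF h] g] x] by simp
  moreover have "h \<cdot> (\<iota> h \<cdot> g) = g" using P_Bij[OF g] P_Bij[OF h] by (simp flip: Sym.m_assoc)
  ultimately show "g = h" using P_Bij[OF h] by simp
qed

lemma P_conj:
  assumes g: "g \<in> qaut Q" and h: "h \<in> P" shows "g \<cdot> h \<cdot> \<iota> g \<in> P"
proof -
  let ?k = "g \<cdot> h \<cdot> \<iota> g"
  have q: "h \<in> qaut Q" "\<iota> g \<in> qaut Q" using g h P_qaut qaut_inv by auto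
  have k: "?k \<in> qaut Q" using g q qaut_mult by simp
  show ?thesis
  proof (cases "\<exists>x\<in>carrier Q. ?k x = x")
    case True
    then obtain x where x: "x \<in> carrier Q" "?k x = x" by auto
    let ?y = "(\<iota> g) x"
    have y: "?y \<in> carrier Q" by (rule qaut_closed[OF q(2) x(1)])
    have "g (h ?y) = x" using x y g q by (simp add: qaut_mult_apply qaut_mult)
    then have "h ?y = ?y" using qaut_inv_apply[OF g, of "h ?y"] qaut_closed[OF q(1) y] by simp
    then have "h = id\<^sub>Q" using P_fixed[OF h y] by simp
    then have "?k = id\<^sub>Q" using qaut_Bij[OF g] by simp
    then show ?thesis using subgroup.one_closed[OF subgroup_P] by simp
  next
    case False then show ?thesis using k by (auto simp: translation_group_def)
  qed
qed

text \<open>The orbit of \<open>a\<close> under \<open>W\<close> is a subquandle, because \<open>g a \<rhd> h a = g (L a u (L a)\<^sup>-\<^sup>1) a\<close> for \<open>u = g\<^sup>-\<^sup>1 h\<close>. It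
has two points, so \<open>W\<close> is transitive; but \<open>P\<close> is regular.\<close>

lemma normal_subgroup_eq_P:
  assumes W: "subgroup W A" and WP: "W \<subseteq> P" and w: "w \<in> W" "w \<noteq> id\<^sub>Q"
    and nrm: "\<And>a h. a \<in> carrier Q \<Longrightarrow> h \<in> W \<Longrightarrow> L a \<cdot> h \<cdot> \<iota> L a \<in> W"
  shows "W = P"
proof -
  obtain a where a: "a \<in> carrier Q" using two_points by blast
  define T where "T = (\<lambda>h. h a) ` W"
  have Wq: "h \<in> qaut Q" if "h \<in> W" for h using that WP P_qaut by auto
  have TQ: "T \<subseteq> carrier Q" using Wq qaut_closed a by (auto simp: T_def)
  have "subquandle Q T"
  proof (rule subquandleI[OF TQ])
    fix x y assume "x \<in> T" "y \<in> T"
    then obtain g h where gh: "g \<in> W" "h \<in> W" "x = g a" "y = h a" by (auto simp: T_def)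
    let ?u = "\<iota> g \<cdot> h"
    have u: "?u \<in> W" using gh W by (simp add: subgroup.m_closed subgroup.m_inv_closed)
    let ?k = "g \<cdot> (L a \<cdot> ?u \<cdot> \<iota> L a)"
    have kW: "?k \<in> W" using gh nrm[OF a u] by (simp add: subgroup.m_closed[OF W])
    have q: "g \<in> qaut Q" "h \<in> qaut Q" "?u \<in> qaut Q" "L a \<in> qaut Q" "\<iota> L a \<in> qaut Q" "\<iota> g \<in> qaut Q"
      using gh u Wq left_mult_qaut[OF a] qaut_inv by auto
    have "left_div Q a a = a" using a by (intro left_div_eqI) auto
    then have "?k a = g (a \<rhd> (\<iota> g) (h a))"
      using q a by (simp add: qaut_mult_apply qaut_mult inv_left_mult_apply left_mult_apply qaut_closed)
    also have "\<dots> = g a \<rhd> h a"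
      using q a by (simp add: qaut_op qaut_closed qaut_apply_inv)
    finally have "x \<rhd> y = ?k a" using gh by simp
    then show "x \<rhd> y \<in> T" using kW unfolding T_def by (rule image_eqI)
  qed
  moreover have "a \<in> T" using subgroup.one_closed[OF W] a by (auto simp: T_def Bij_one_apply intro!: rev_image_eqI)
  moreover have "w a \<in> T" using w by (simp add: T_def)
  moreover have "a \<noteq> w a" using w WP a P_fixed[of w a] by auto
  ultimately have T: "T = carrier Q" by (rule generated)
  have "h \<in> W" if h: "h \<in> P" for h
  proof -
    have "h a \<in> T" using T qaut_closed[OF P_qaut[OF h] a] by simp
    then obtain g where g: "h a = g a" "g \<in> W" unfolding T_def by (rule imageE)
    then have "h = g" using P_eqI[OF h _ a] WP by auto
    then show ?thesis using g by simp
  qed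
  then show ?thesis using WP by blast
qed

text \<open>The centre of the \<open>p\<close>-group \<open>P\<close> is not trivial, and all automorphisms normalize it.\<close>

lemma P_comm:
  assumes "g \<in> P" "h \<in> P" shows "g \<cdot> h = h \<cdot> g"
proof -
  let ?PG = "A\<lparr>carrier := P\<rparr>"
  interpret PG: group ?PG by (rule subgroup.subgroup_is_group[OF subgroup_P group_BijGroup])
  let ?W = "group_center ?PG"
  have W: "subgroup ?W A" using Sym.incl_subgroup[OF subgroup_P PG.subgroup_group_center] .
  have WP: "?W \<subseteq> P" by (simp add: group_center_def)
  have Wc: "z \<cdot> k = k \<cdot> z" if "z \<in> ?W" "k \<in> P" for z k
    using that by (simp add: group_center_def)
  obtain w where w: "w \<in> ?W" "w \<noteq> id\<^sub>Q"
    using PG.prime_power_group_center_nontrivial[OF p _ m_pos] card_P by (auto simp: order_def)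
  have "?W = P"
  proof (rule normal_subgroup_eq_P[OF W WP w])
    fix a z assume a: "a \<in> carrier Q" and z: "z \<in> ?W"
    let ?l = "L a" and ?l' = "\<iota> L a"
    let ?z = "?l \<cdot> z \<cdot> ?l'"
    have zP: "z \<in> P" using z WP by blast
    have lq: "?l \<in> qaut Q" "?l' \<in> qaut Q" using left_mult_qaut[OF a] qaut_inv by auto
    have B: "?l \<in> carrier A" "z \<in> carrier A" using left_mult_Bij[OF a] P_Bij[OF zP] by auto
    have "?z \<cdot> k = k \<cdot> ?z" if k: "k \<in> P" for k
    proof -
      let ?k = "?l' \<cdot> k \<cdot> \<iota> ?l'"
      have kB: "k \<in> carrier A" using P_Bij[OF k] by simp
      have kP: "?k \<in> P" by (rule P_conj[OF lq(2) k])
      have kk: "k = ?l \<cdot> ?k \<cdot> ?l'"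
        using B kB by (simp add: Sym.m_assoc) (simp flip: Sym.m_assoc)
      have kB': "?k \<in> carrier A" using P_Bij[OF kP] by simp
      have c: "x \<cdot> ?l' \<cdot> (?l \<cdot> y) = x \<cdot> y" if "x \<in> carrier A" "y \<in> carrier A" for x y
      proof -
        have "?l' \<cdot> (?l \<cdot> y) = y" using that B by (simp flip: Sym.m_assoc)
        then show ?thesis using that B by (simp add: Sym.m_assoc)
      qed
      have e: "(?l \<cdot> x \<cdot> ?l') \<cdot> (?l \<cdot> y \<cdot> ?l') = ?l \<cdot> (x \<cdot> y) \<cdot> ?l'"
        if "x \<in> carrier A" "y \<in> carrier A" for x y
        using that B c[of "?l \<cdot> x" "y \<cdot> ?l'"] by (simp add: Sym.m_assoc)
      have "?z \<cdot> k = ?l \<cdot> (z \<cdot> ?k) \<cdot> ?l'"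
        using e[OF B(2) kB'] kk by simp
      also have "z \<cdot> ?k = ?k \<cdot> z" by (rule Wc[OF z kP])
      also have "?l \<cdot> (?k \<cdot> z) \<cdot> ?l' = k \<cdot> ?z"
        using e[OF kB' B(2)] kk by simp
      finally show ?thesis .
    qed
    then show "?z \<in> ?W" using P_conj[OF lq(1) zP] unfolding group_center_def by auto
  qed
  then show ?thesis using Wc assms by blast
qed

text \<open>The elements of order dividing \<open>p\<close> form a nontrivial subgroup normalized by all automorphisms.\<close>

lemma P_pow_p:
  assumes "g \<in> P" shows "g [^]\<^bsub>A\<^esub> p = id\<^sub>Q"
proof -
  let ?PG = "A\<lparr>carrier := P\<rparr>"
  interpret PG: group ?PG by (rule subgroup.subgroup_is_group[OF subgroup_P group_BijGroup])
  let ?W = "{g \<in> P. g [^]\<^bsub>A\<^esub> p = id\<^sub>Q}"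
  have W: "subgroup ?W A"
  proof (rule Sym.subgroupI)
    show "?W \<subseteq> carrier A" using P_Bij by auto
    have "id\<^sub>Q \<in> ?W" using subgroup.one_closed[OF subgroup_P] by simp
    then show "?W \<noteq> {}" by blast
    show "\<iota> g \<in> ?W" if "g \<in> ?W" for g
      using that P_inv P_Bij by (simp add: Sym.nat_pow_inv)
    show "g \<cdot> h \<in> ?W" if "g \<in> ?W" "h \<in> ?W" for g h
    proof -
      have "(g \<cdot> h) [^]\<^bsub>A\<^esub> p = g [^]\<^bsub>A\<^esub> p \<cdot> h [^]\<^bsub>A\<^esub> p"
        by (rule Sym.pow_mult_distrib) (use that P_comm[of g h] P_Bij in simp_all)
      then show ?thesis using that P_mult by simp
    qed
  qed
  obtain T where T: "subgroup T ?PG" "card T = p ^ 1"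
    using sylow_thm[OF p PG.is_group, of 1 "p ^ (m - 1)"] card_P m_pos
      Bij_subgroup_finite[OF finite_carrier subgroup_P]
    by (auto simp: order_def simp flip: power_Suc)
  have TA: "subgroup T A" using Sym.incl_subgroup[OF subgroup_P T(1)] .
  have "T \<noteq> {id\<^sub>Q}" using T(2) prime_gt_1_nat[OF p] by auto
  then obtain w where w: "w \<in> T" "w \<noteq> id\<^sub>Q" using subgroup.one_closed[OF TA] by blast
  have wP: "w \<in> P" using w subgroup.subset[OF T(1)] by auto
  have "w [^]\<^bsub>A\<lparr>carrier := T\<rparr>\<^esub> order (A\<lparr>carrier := T\<rparr>) = \<one>\<^bsub>A\<lparr>carrier := T\<rparr>\<^esub>"
    using group.pow_order_eq_1[OF subgroup.subgroup_is_group[OF TA group_BijGroup]] w by simp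
  then have "w [^]\<^bsub>A\<^esub> p = id\<^sub>Q" using T(2) by (simp add: order_def flip: Sym.nat_pow_consistent)
  then have wW: "w \<in> ?W" using wP by simp
  have "?W = P"
  proof (rule normal_subgroup_eq_P[OF W _ wW w(2)])
    fix a h assume a: "a \<in> carrier Q" and h: "h \<in> ?W"
    let ?k = "L a \<cdot> h \<cdot> \<iota> L a"
    have B: "L a \<in> Bij (carrier Q)" "h \<in> Bij (carrier Q)" using left_mult_Bij[OF a] P_Bij h by auto
    have "?k [^]\<^bsub>A\<^esub> n = L a \<cdot> h [^]\<^bsub>A\<^esub> n \<cdot> \<iota> L a" for n :: nat
    proof (induction n)
      case (Suc n)
      have "?k [^]\<^bsub>A\<^esub> Suc n = (L a \<cdot> h [^]\<^bsub>A\<^esub> n \<cdot> \<iota> L a) \<cdot> ?k"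
        by (simp only: Sym.nat_pow_Suc Suc)
      also have "\<dots> = L a \<cdot> h [^]\<^bsub>A\<^esub> n \<cdot> (\<iota> L a \<cdot> (L a \<cdot> (h \<cdot> \<iota> L a)))"
        using B by (simp add: Sym.m_assoc)
      also have "\<iota> L a \<cdot> (L a \<cdot> (h \<cdot> \<iota> L a)) = h \<cdot> \<iota> L a"
        using B by (simp flip: Sym.m_assoc)
      finally show ?case using B by (simp add: Sym.m_assoc)
    qed (use B in simp)
    then have "?k [^]\<^bsub>A\<^esub> p = id\<^sub>Q" using h B by simp
    then show "?k \<in> ?W" using P_conj[OF left_mult_qaut[OF a]] h by simp
  qed auto
  then show ?thesis using assms by blast
qed

text \<open>If \<open>g\<close> in \<open>P\<close> maps \<open>y\<close> to \<open>x\<close>, then \<open>L x = g (L y) g\<^sup>-\<^sup>1\<close>, so the quotient is a product of \<open>g\<close> and a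
conjugate of its inverse.\<close>

lemma left_mult_quotient_P:
  assumes x: "x \<in> carrier Q" and y: "y \<in> carrier Q"
  shows "L x \<cdot> \<iota> L y \<in> P"
proof -
  obtain g where g: "g \<in> P" "g y = x" using P_transitive[OF y x] by blast
  have B: "g \<in> Bij (carrier Q)" "L y \<in> Bij (carrier Q)" using P_Bij[OF g(1)] left_mult_Bij[OF y] by auto
  have "L x = g \<cdot> L y \<cdot> \<iota> g" using qaut_conj_left_mult[OF P_qaut[OF g(1)] y] g by simp
  then have "L x \<cdot> \<iota> L y = g \<cdot> (L y \<cdot> \<iota> g \<cdot> \<iota> L y)"
    using B by (simp add: Sym.m_assoc)
  then show ?thesis using P_mult[OF g(1) P_conj[OF left_mult_qaut[OF y] P_inv[OF g(1)]]] by simp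
qed

text \<open>Since \<open>L y (L x)\<^sup>-\<^sup>1\<close> and \<open>L z (L x)\<^sup>-\<^sup>1\<close> commute, \<open>L y (L x)\<^sup>-\<^sup>1 L z\<close> is symmetric in \<open>y\<close> and \<open>z\<close>.\<close>

lemma medial:
  assumes c: "x \<in> carrier Q" "y \<in> carrier Q" "z \<in> carrier Q" "w \<in> carrier Q"
  shows "(x \<rhd> y) \<rhd> (z \<rhd> w) = (x \<rhd> z) \<rhd> (y \<rhd> w)"
proof -
  have q: "L a \<in> qaut Q" "\<iota> L a \<in> qaut Q" "L a \<in> Bij (carrier Q)" if "a \<in> carrier Q" for a
    using left_mult_qaut[OF that] qaut_inv left_mult_Bij[OF that] by auto
  have sw: "L y \<cdot> (\<iota> L x \<cdot> L z) = L z \<cdot> (\<iota> L x \<cdot> L y)"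
  proof -
    have "(L y \<cdot> \<iota> L x) \<cdot> (L z \<cdot> \<iota> L x) = (L z \<cdot> \<iota> L x) \<cdot> (L y \<cdot> \<iota> L x)"
      by (rule P_comm) (use left_mult_quotient_P c in auto)
    then have "(L y \<cdot> (\<iota> L x \<cdot> L z)) \<cdot> \<iota> L x = (L z \<cdot> (\<iota> L x \<cdot> L y)) \<cdot> \<iota> L x"
      using q c by (simp add: Sym.m_assoc)
    then show ?thesis using q c by simp
  qed
  have d: "left_div Q x (z \<rhd> w) \<in> carrier Q" "left_div Q x (y \<rhd> w) \<in> carrier Q" using c by auto
  have "(L y \<cdot> (\<iota> L x \<cdot> L z)) w = (L z \<cdot> (\<iota> L x \<cdot> L y)) w" by (simp add: sw)
  then have e: "y \<rhd> left_div Q x (z \<rhd> w) = z \<rhd> left_div Q x (y \<rhd> w)"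
    using q c by (simp add: qaut_mult_apply qaut_mult inv_left_mult_apply left_mult_apply)
  have "(x \<rhd> y) \<rhd> (z \<rhd> w) = x \<rhd> (y \<rhd> left_div Q x (z \<rhd> w))"
    using distrib[OF c(1,2) d(1)] c by (simp add: op_left_div)
  also have "\<dots> = (x \<rhd> z) \<rhd> (y \<rhd> w)"
    unfolding e using distrib[OF c(1,3) d(2)] c by (simp add: op_left_div)
  finally show ?thesis .
qed

text \<open>A quandle version of Schur's lemma. Let \<open>D\<close> be the set of endomorphisms that fix \<open>a\<close> and commute with all
endomorphisms fixing \<open>a\<close>. By mediality it is closed under the pointwise operation, so the values of its
members at \<open>b\<close> form a subquandle; this contains \<open>a\<close> and \<open>b\<close>, hence it is everything. So \<open>c\<close> and \<open>d\<close> agree at \<open>b\<close>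
with members of \<open>D\<close>, and therefore \<open>c (d b) = d (c b)\<close>. Automorphisms that agree at \<open>a\<close> and \<open>b\<close> are equal.\<close>

lemma stabilizer_comm:
  assumes a: "a \<in> carrier Q" and c: "c \<in> qaut Q" "c a = a" and d: "d \<in> qaut Q" "d a = a"
  shows "c \<cdot> d = d \<cdot> c"
proof -
  obtain b where b: "b \<in> carrier Q" "b \<noteq> a" using two_points by blast
  define E where "E = {e. e \<in> carrier Q \<rightarrow> carrier Q \<and> e a = a \<and>
      (\<forall>x\<in>carrier Q. \<forall>y\<in>carrier Q. e (x \<rhd> y) = e x \<rhd> e y)}"
  define D where "D = {\<phi> \<in> E. \<forall>e\<in>E. \<forall>x\<in>carrier Q. \<phi> (e x) = e (\<phi> x)}"
  have Ecl: "e x \<in> carrier Q" and Eop: "y \<in> carrier Q \<Longrightarrow> e (x \<rhd> y) = e x \<rhd> e y"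
    if "e \<in> E" "x \<in> carrier Q" for e x y using that by (auto simp: E_def)
  have Ea: "e a = a" if "e \<in> E" for e using that by (simp add: E_def)
  have DE: "\<phi> \<in> E" if "\<phi> \<in> D" for \<phi> using that by (simp add: D_def)
  have Dc: "\<phi> (e x) = e (\<phi> x)" if "\<phi> \<in> D" "e \<in> E" "x \<in> carrier Q" for \<phi> e x using that by (simp add: D_def)
  have op: "(\<lambda>x. \<phi> x \<rhd> \<psi> x) \<in> D" if \<phi>: "\<phi> \<in> D" and \<psi>: "\<psi> \<in> D" for \<phi> \<psi>
  proof -
    have "\<phi> (x \<rhd> y) \<rhd> \<psi> (x \<rhd> y) = (\<phi> x \<rhd> \<psi> x) \<rhd> (\<phi> y \<rhd> \<psi> y)" if "x \<in> carrier Q" "y \<in> carrier Q" for x y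
      using that DE[OF \<phi>] DE[OF \<psi>] medial[of "\<phi> x" "\<phi> y" "\<psi> x" "\<psi> y"] by (simp add: Eop Ecl)
    moreover have "(\<lambda>x. \<phi> x \<rhd> \<psi> x) \<in> carrier Q \<rightarrow> carrier Q"
      using Ecl[OF DE[OF \<phi>]] Ecl[OF DE[OF \<psi>]] by simp
    moreover have "\<phi> a \<rhd> \<psi> a = a" using Ea[OF DE[OF \<phi>]] Ea[OF DE[OF \<psi>]] a by simp
    ultimately have E': "(\<lambda>x. \<phi> x \<rhd> \<psi> x) \<in> E" unfolding E_def by (intro CollectI conjI ballI)
    have "\<phi> (e x) \<rhd> \<psi> (e x) = e (\<phi> x \<rhd> \<psi> x)" if "e \<in> E" "x \<in> carrier Q" for e x
      using that DE[OF \<phi>] DE[OF \<psi>] by (simp add: Dc[OF \<phi>] Dc[OF \<psi>] Eop Ecl)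
    then show ?thesis unfolding D_def using E' by (intro CollectI conjI ballI)
  qed
  have cE: "c \<in> E" and dE: "d \<in> E" using c d by (simp_all add: E_def qaut_closed qaut_op)
  define T where "T = (\<lambda>\<phi>. \<phi> b) ` D"
  have TQ: "T \<subseteq> carrier Q" unfolding T_def using Ecl[OF DE b(1)] by (rule image_subsetI)
  have "subquandle Q T"
  proof (rule subquandleI[OF TQ])
    fix x y assume "x \<in> T" "y \<in> T"
    then obtain \<phi> \<psi> where "x = \<phi> b" "\<phi> \<in> D" "y = \<psi> b" "\<psi> \<in> D" unfolding T_def by (elim imageE)
    then show "x \<rhd> y \<in> T" unfolding T_def using op[of \<phi> \<psi>]
      by (intro image_eqI[of _ _ "\<lambda>x. \<phi> x \<rhd> \<psi> x"]) simp_all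
  qed
  moreover have "a \<in> T"
  proof -
    have "(\<lambda>_. a) \<in> E" using a by (simp add: E_def)
    then have "(\<lambda>_. a) \<in> D" unfolding D_def by (intro CollectI conjI ballI) (simp_all only: Ea)
    then show ?thesis unfolding T_def by (rule rev_image_eqI) simp
  qed
  moreover have "b \<in> T"
  proof -
    have "(\<lambda>x. x) \<in> E" by (simp add: E_def)
    then have "(\<lambda>x. x) \<in> D" by (simp add: D_def)
    then show ?thesis unfolding T_def by (rule rev_image_eqI) simp
  qed
  ultimately have T: "T = carrier Q" using generated b by blast
  have cd: "c b \<in> T" "d b \<in> T" using T qaut_closed[OF c(1) b(1)] qaut_closed[OF d(1) b(1)] by simp_all
  obtain \<phi> where \<phi>: "c b = \<phi> b" "\<phi> \<in> D" using cd(1) unfolding T_def by (rule imageE)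
  obtain \<psi> where \<psi>: "d b = \<psi> b" "\<psi> \<in> D" using cd(2) unfolding T_def by (rule imageE)
  have "c (d b) = \<psi> (\<phi> b)" using Dc[OF \<psi>(2) cE b(1)] \<phi> \<psi> by simp
  moreover have "d (c b) = \<phi> (\<psi> b)" using Dc[OF \<phi>(2) dE b(1)] \<phi> \<psi> by simp
  moreover have "\<psi> (\<phi> b) = \<phi> (\<psi> b)" using Dc[OF \<psi>(2) DE[OF \<phi>(2)] b(1)] .
  ultimately have cdb: "c (d b) = d (c b)" by simp
  let ?h = "\<iota> (d \<cdot> c) \<cdot> (c \<cdot> d)"
  have dc: "d \<cdot> c \<in> qaut Q" "c \<cdot> d \<in> qaut Q" using c d qaut_mult by auto
  have fixd: "?h x = x" if "x \<in> carrier Q" "c (d x) = d (c x)" for x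
    using qaut_inv_apply[OF dc(1) that(1)] that c d dc by (simp add: qaut_mult_apply qaut_inv)
  have "?h = id\<^sub>Q"
  proof (rule qaut_rigid[of _ a b])
    show "?h \<in> qaut Q" using qaut_mult[OF qaut_inv[OF dc(1)] dc(2)] .
    show "?h a = a" using fixd[OF a] c d by simp
    show "?h b = b" using fixd[OF b(1) cdb] .
  qed (use a b in auto)
  moreover have "(d \<cdot> c) \<cdot> ?h = c \<cdot> d"
    using qaut_Bij[OF c(1)] qaut_Bij[OF d(1)] by (simp flip: Sym.m_assoc)
  ultimately show ?thesis using qaut_Bij[OF dc(1)] by simp
qed

text \<open>Modulo the normal subgroup \<open>P\<close> every automorphism agrees with one that fixes \<open>a\<close>, and those commute.\<close>

lemma qaut_commutator_P:
  assumes g: "g \<in> qaut Q" and h: "h \<in> qaut Q"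
  shows "g \<cdot> h \<cdot> \<iota> (h \<cdot> g) \<in> P"
proof -
  obtain a where a: "a \<in> carrier Q" using two_points by blast
  have dec: "\<exists>u\<in>P. \<exists>c\<in>qaut Q. c a = a \<and> k = u \<cdot> c" if k: "k \<in> qaut Q" for k
  proof -
    obtain u where u: "u \<in> P" "u a = k a" using P_transitive[OF a qaut_closed[OF k a]] by blast
    have uq: "u \<in> qaut Q" by (rule P_qaut[OF u(1)])
    have "(\<iota> u \<cdot> k) a = a"
      using qaut_inv_apply[OF uq a] u k uq a by (simp add: qaut_mult_apply qaut_inv)
    moreover have "k = u \<cdot> (\<iota> u \<cdot> k)" using qaut_Bij[OF k] qaut_Bij[OF uq] by (simp flip: Sym.m_assoc)
    ultimately show ?thesis using u(1) qaut_mult[OF qaut_inv[OF uq] k] by blast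
  qed
  obtain u c where u: "u \<in> P" and c: "c \<in> qaut Q" "c a = a" and gu: "g = u \<cdot> c" using dec[OF g] by auto
  obtain v d where v: "v \<in> P" and d: "d \<in> qaut Q" "d a = a" and hv: "h = v \<cdot> d" using dec[OF h] by auto
  let ?e = "c \<cdot> d"
  let ?s = "u \<cdot> (c \<cdot> v \<cdot> \<iota> c)" and ?t = "v \<cdot> (d \<cdot> u \<cdot> \<iota> d)"
  have s: "?s \<in> P" and t: "?t \<in> P" using P_mult P_conj u v c d by simp_all
  have B: "u \<in> Bij (carrier Q)" "v \<in> Bij (carrier Q)" "c \<in> Bij (carrier Q)" "d \<in> Bij (carrier Q)"
    using P_Bij u v qaut_Bij c d by auto
  have cc: "\<iota> x \<cdot> (x \<cdot> y) = y" if "x \<in> Bij (carrier Q)" "y \<in> Bij (carrier Q)" for x y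
    using that by (simp flip: Sym.m_assoc)
  have "g \<cdot> h = ?s \<cdot> ?e" using B by (simp add: gu hv Sym.m_assoc cc)
  moreover have "h \<cdot> g = ?t \<cdot> (d \<cdot> c)" using B by (simp add: gu hv Sym.m_assoc cc)
  then have "h \<cdot> g = ?t \<cdot> ?e" using stabilizer_comm[OF a c d] by simp
  moreover have "?s \<cdot> ?e \<cdot> \<iota> (?t \<cdot> ?e) = ?s \<cdot> \<iota> ?t"
  proof -
    have "x \<cdot> e \<cdot> \<iota> (y \<cdot> e) = x \<cdot> \<iota> y"
      if "x \<in> Bij (carrier Q)" "y \<in> Bij (carrier Q)" "e \<in> Bij (carrier Q)" for x y e
    proof -
      have "e \<cdot> (\<iota> e \<cdot> \<iota> y) = \<iota> y" using that by (simp flip: Sym.m_assoc)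
      then show ?thesis using that by (simp add: Sym.inv_mult_group Sym.m_assoc)
    qed
    then show ?thesis using P_Bij[OF s] P_Bij[OF t] B by simp
  qed
  ultimately show ?thesis using P_mult[OF s P_inv[OF t]] by simp
qed

lemma prime_dvd_card_minus_one:
  assumes c: "c \<in> qaut Q" "c \<noteq> id\<^sub>Q" and x: "x \<in> carrier Q" "c x = x"
    and r: "prime r" "c [^]\<^bsub>A\<^esub> r = id\<^sub>Q"
  shows "r dvd p ^ m - 1"
proof -
  let ?J = "{h \<in> qaut Q. h x = x}"
  have J: "subgroup ?J A"
  proof (rule Sym.subgroupI)
    show "?J \<subseteq> carrier A" using qaut_Bij by auto
    have "id\<^sub>Q \<in> ?J" using subgroup.one_closed[OF subgroup_qaut] x by (simp add: Bij_one_apply)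
    then show "?J \<noteq> {}" by blast
    show "\<iota> h \<in> ?J" if "h \<in> ?J" for h
      using that qaut_inv[of h] qaut_inv_apply[of h x] x by simp
    show "g \<cdot> h \<in> ?J" if "g \<in> ?J" "h \<in> ?J" for g h
      using that qaut_mult qaut_mult_apply[of g h x] x by simp
  qed
  have cB: "c \<in> Bij (carrier Q)" by (rule qaut_Bij[OF c(1)])
  have "Sym.ord (carrier Q) c dvd r" using r cB by (simp add: Sym.pow_eq_id)
  moreover have "Sym.ord (carrier Q) c \<noteq> 1" using Sym.ord_eq_1[of c "carrier Q"] cB c by simp
  ultimately have o: "Sym.ord (carrier Q) c = r" using r(1) by (metis prime_nat_iff)
  have "c [^]\<^bsub>A\<lparr>carrier := ?J\<rparr>\<^esub> order (A\<lparr>carrier := ?J\<rparr>) = \<one>\<^bsub>A\<lparr>carrier := ?J\<rparr>\<^esub>"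
    using group.pow_order_eq_1[OF subgroup.subgroup_is_group[OF J group_BijGroup]] c x by simp
  then have "c [^]\<^bsub>A\<^esub> card ?J = id\<^sub>Q" by (simp add: order_def flip: Sym.nat_pow_consistent)
  then have "r dvd card ?J" using o cB Sym.pow_eq_id[of c "carrier Q"] by simp
  then have "card (carrier Q) mod r = 1"
    by (intro card_mod_prime_if_unique_fixed_point[OF finite_carrier J x(1) _ _ r(1)])
       (use qaut_rigid x in auto)
  then show ?thesis using card_carrier by (metis mod_eq_dvd_iff_nat dvd_minus_mod)
qed

end

section \<open>Displacement groups and factors\<close>

context finite_quandle
begin

abbreviation "D \<equiv> carrier (Dis Q)"

lemma displacement_closed:
  "a \<in> carrier Q \<Longrightarrow> b \<in> carrier Q \<Longrightarrow> L a \<cdot> \<iota> L b \<in> Bij (carrier Q)"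
  using left_mult_Bij by simp

lemma D_eq: "D = generate A {L a \<cdot> \<iota> L b | a b. a \<in> carrier Q \<and> b \<in> carrier Q}"
proof -
  have "carrier A \<inter> {L a \<cdot> \<iota> L b | a b. a \<in> carrier Q \<and> b \<in> carrier Q}
      = {L a \<cdot> \<iota> L b | a b. a \<in> carrier Q \<and> b \<in> carrier Q}"
    using displacement_closed by auto
  then show ?thesis by (simp only: Dis_def carrier_subgroup_generated)
qed

lemma Dis_eq: "Dis Q = A\<lparr>carrier := D\<rparr>"
  by (simp add: Dis_def subgroup_generated_def)

lemma subgroup_D: "subgroup D A"
  unfolding D_eq by (rule Sym.generate_is_subgroup) (use displacement_closed in auto)

lemma D_subset: "subgroup H A \<Longrightarrow> (\<And>a b. a \<in> carrier Q \<Longrightarrow> b \<in> carrier Q \<Longrightarrow> L a \<cdot> \<iota> L b \<in> H) \<Longrightarrow> D \<subseteq> H"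
  unfolding D_eq by (rule Sym.generate_subgroup_incl) auto

lemma displacement_in_D: "a \<in> carrier Q \<Longrightarrow> b \<in> carrier Q \<Longrightarrow> L a \<cdot> \<iota> L b \<in> D"
  unfolding D_eq by (rule generate.incl) blast

lemma D_subset_qaut: "D \<subseteq> qaut Q"
  by (rule D_subset[OF subgroup_qaut]) (intro qaut_mult qaut_inv left_mult_qaut)

lemma D_qaut: "g \<in> D \<Longrightarrow> g \<in> qaut Q"
  using D_subset_qaut by (rule subsetD)

lemma D_Bij: "g \<in> D \<Longrightarrow> g \<in> Bij (carrier Q)"
  by (rule qaut_Bij[OF D_qaut])

lemma D_mult: "g \<in> D \<Longrightarrow> h \<in> D \<Longrightarrow> g \<cdot> h \<in> D"
  by (rule subgroup.m_closed[OF subgroup_D])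

lemma D_inv: "g \<in> D \<Longrightarrow> \<iota> g \<in> D"
  by (rule subgroup.m_inv_closed[OF subgroup_D])

text \<open>The conjugate is the product of \<open>g\<close> and the displacement \<open>L (g\<^sup>-\<^sup>1 a) (L a)\<^sup>-\<^sup>1\<close>.\<close>

lemma D_conj_left_mult:
  assumes a: "a \<in> carrier Q" and g: "g \<in> D"
  shows "L a \<cdot> g \<cdot> \<iota> L a \<in> D"
proof -
  let ?g' = "\<iota> g"
  have B: "g \<in> Bij (carrier Q)" "L a \<in> Bij (carrier Q)" using D_Bij[OF g] left_mult_Bij[OF a] by auto
  have q: "?g' \<in> qaut Q" by (rule D_qaut[OF D_inv[OF g]])
  have "L (?g' a) = ?g' \<cdot> L a \<cdot> g"
    using qaut_conj_left_mult[OF q a] B by simp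
  then have "g \<cdot> (L (?g' a) \<cdot> \<iota> L a) = g \<cdot> (?g' \<cdot> (L a \<cdot> (g \<cdot> \<iota> L a)))"
    using B by (simp add: Sym.m_assoc)
  also have "\<dots> = L a \<cdot> (g \<cdot> \<iota> L a)" using B by (simp flip: Sym.m_assoc)
  also have "\<dots> = L a \<cdot> g \<cdot> \<iota> L a" using B by (simp add: Sym.m_assoc)
  finally have "L a \<cdot> g \<cdot> \<iota> L a = g \<cdot> (L (?g' a) \<cdot> \<iota> L a)" ..
  then show ?thesis using D_mult[OF g displacement_in_D[OF qaut_closed[OF q a] a]] by simp
qed

lemma abelian_quandle_iff:
  "abelian_quandle Q \<longleftrightarrow> (\<forall>g\<in>D. \<forall>h\<in>D. g \<cdot> h = h \<cdot> g) \<and>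
     (\<forall>a\<in>carrier Q. \<forall>g\<in>D. g a = a \<longrightarrow> g = id\<^sub>Q)"
proof -
  have G: "group (Dis Q)" by (simp add: Dis_def)
  have m: "g \<otimes>\<^bsub>Dis Q\<^esub> h = g \<cdot> h" for g h by (simp add: Dis_def)
  have "comm_group (Dis Q) \<longleftrightarrow> (\<forall>g\<in>D. \<forall>h\<in>D. g \<cdot> h = h \<cdot> g)"
  proof
    assume "comm_group (Dis Q)"
    then interpret C: comm_group "Dis Q" .
    show "\<forall>g\<in>D. \<forall>h\<in>D. g \<cdot> h = h \<cdot> g" using C.m_comm by (simp add: m)
  next
    assume "\<forall>g\<in>D. \<forall>h\<in>D. g \<cdot> h = h \<cdot> g"
    then show "comm_group (Dis Q)" by (intro group.group_comm_groupI[OF G]) (simp add: m)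
  qed
  moreover have "Dis_stabilizer Q a = {\<one>\<^bsub>Dis Q\<^esub>} \<longleftrightarrow> (\<forall>g\<in>D. g a = a \<longrightarrow> g = id\<^sub>Q)" if "a \<in> carrier Q" for a
  proof -
    have "id\<^sub>Q \<in> D" "id\<^sub>Q a = a" using subgroup.one_closed[OF subgroup_D] that by (auto simp: Bij_one_apply)
    moreover have "\<one>\<^bsub>Dis Q\<^esub> = id\<^sub>Q" by (simp add: Dis_def)
    ultimately show ?thesis unfolding stabilizer_def by auto
  qed
  ultimately show ?thesis using quandle by (simp add: abelian_quandle_def)
qed

end

lemma (in simple_homogeneous) D_subset_P: "D \<subseteq> P"
  by (rule D_subset[OF subgroup_P left_mult_quotient_P])

lemma (in simple_homogeneous) abelian: "abelian_quandle Q"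
  unfolding abelian_quandle_iff using D_subset_P P_comm P_fixed by (meson subsetD)

locale quandle_congruence = finite_quandle Q for Q :: "'a magma" (structure) +
  fixes r :: "('a \<times> 'a) set"
  assumes congruence: "qcongruence Q r"
begin

abbreviation "X \<equiv> qfactor Q r"

lemma equiv: "equiv (carrier Q) r"
  using congruence by (simp add: qcongruence_def)

lemma r_op: "(a, a') \<in> r \<Longrightarrow> (b, b') \<in> r \<Longrightarrow> (a \<rhd> b, a' \<rhd> b') \<in> r"
  and r_left_div: "(a, a') \<in> r \<Longrightarrow> (b, b') \<in> r \<Longrightarrow> (left_div Q a b, left_div Q a' b') \<in> r"
  using congruence unfolding qcongruence_def by fast+

lemma r_carrier: "(a, b) \<in> r \<Longrightarrow> a \<in> carrier Q \<and> b \<in> carrier Q"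
  using equiv by (auto simp: equiv_def refl_on_def)

lemma r_refl: "a \<in> carrier Q \<Longrightarrow> (a, a) \<in> r"
  using equiv by (simp add: equiv_def refl_on_def)

lemma r_sym: "(a, b) \<in> r \<Longrightarrow> (b, a) \<in> r"
  using equiv by (meson equiv_def symD)

lemma r_trans: "(a, b) \<in> r \<Longrightarrow> (b, c) \<in> r \<Longrightarrow> (a, c) \<in> r"
  using equiv by (meson equiv_def transD)

lemma class_eq_iff: "a \<in> carrier Q \<Longrightarrow> b \<in> carrier Q \<Longrightarrow> r `` {a} = r `` {b} \<longleftrightarrow> (a, b) \<in> r"
  using eq_equiv_class_iff[OF equiv] .

lemma class_eq: "(a, b) \<in> r \<Longrightarrow> r `` {a} = r `` {b}"
  using equiv_class_eq[OF equiv] .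

lemma subquandle_class: assumes "x \<in> carrier Q" shows "subquandle Q (r `` {x})"
proof (rule subquandleI)
  show "r `` {x} \<subseteq> carrier Q" using r_carrier by auto
  show "a \<rhd> b \<in> r `` {x}" if "a \<in> r `` {x}" "b \<in> r `` {x}" for a b
    using r_op[of x a x b] that assms by simp
qed

lemma carrier_X: "carrier X = carrier Q // r"
  by (simp add: qfactor_def)

lemma class_X: "x \<in> carrier Q \<Longrightarrow> r `` {x} \<in> carrier X"
  unfolding carrier_X by (rule quotientI)

lemma X_cases: "B \<in> carrier X \<Longrightarrow> (\<And>x. x \<in> carrier Q \<Longrightarrow> B = r `` {x} \<Longrightarrow> thesis) \<Longrightarrow> thesis"
  unfolding carrier_X by (erule quotientE)

lemma X_op: assumes "a \<in> carrier Q" "b \<in> carrier Q"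
  shows "(r `` {a}) \<rhd>\<^bsub>X\<^esub> (r `` {b}) = r `` {a \<rhd> b}"
proof -
  have "r `` {a' \<rhd> b'} = r `` {a \<rhd> b}" if "a' \<in> r `` {a}" "b' \<in> r `` {b}" for a' b'
    using class_eq[OF r_op[of a a' b b']] that by simp
  moreover have "a \<in> r `` {a}" "b \<in> r `` {b}" using assms r_refl by auto
  ultimately have "(\<Union>a' \<in> r `` {a}. \<Union>b' \<in> r `` {b}. r `` {a' \<rhd> b'}) = r `` {a \<rhd> b}" by fast
  then show ?thesis by (simp add: qfactor_def)
qed

lemma finite_quandle_X: "finite_quandle X"
proof
  show fin: "finite (carrier X)"
    unfolding carrier_X by (rule finite_quotient[OF finite_carrier equiv_type[OF equiv]])
  have bij: "bij_betw (\<lambda>B. C \<rhd>\<^bsub>X\<^esub> B) (carrier X) (carrier X)" if C: "C \<in> carrier X" for C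
  proof -
    obtain a where a: "a \<in> carrier Q" "C = r `` {a}" using X_cases[OF C] by blast
    have inj: "inj_on (\<lambda>B. C \<rhd>\<^bsub>X\<^esub> B) (carrier X)"
    proof (rule inj_onI)
      fix B B' assume B: "B \<in> carrier X" and B': "B' \<in> carrier X" and e: "C \<rhd>\<^bsub>X\<^esub> B = C \<rhd>\<^bsub>X\<^esub> B'"
      obtain b where b: "b \<in> carrier Q" "B = r `` {b}" using X_cases[OF B] by blast
      obtain b' where b': "b' \<in> carrier Q" "B' = r `` {b'}" using X_cases[OF B'] by blast
      have "(a \<rhd> b, a \<rhd> b') \<in> r" using e a b b' by (simp add: X_op class_eq_iff)
      from r_left_div[OF r_refl[OF a(1)] this] have "(b, b') \<in> r" using a b b' by (simp add: left_div_op)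
      then show "B = B'" using b b' class_eq by simp
    qed
    have "(\<lambda>B. C \<rhd>\<^bsub>X\<^esub> B) ` carrier X \<subseteq> carrier X"
    proof (rule image_subsetI)
      fix B assume B: "B \<in> carrier X"
      obtain b where b: "b \<in> carrier Q" "B = r `` {b}" using X_cases[OF B] by blast
      then show "C \<rhd>\<^bsub>X\<^esub> B \<in> carrier X" using a class_X by (simp add: X_op)
    qed
    from endo_inj_surj[OF fin this inj] inj show ?thesis by (simp add: bij_betw_def)
  qed
  have dist: "A1 \<rhd>\<^bsub>X\<^esub> (B \<rhd>\<^bsub>X\<^esub> C) = (A1 \<rhd>\<^bsub>X\<^esub> B) \<rhd>\<^bsub>X\<^esub> (A1 \<rhd>\<^bsub>X\<^esub> C)"
    if t: "A1 \<in> carrier X" "B \<in> carrier X" "C \<in> carrier X" for A1 B C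
  proof -
    obtain a where a: "a \<in> carrier Q" "A1 = r `` {a}" using X_cases[OF t(1)] by blast
    obtain b where b: "b \<in> carrier Q" "B = r `` {b}" using X_cases[OF t(2)] by blast
    obtain c where c: "c \<in> carrier Q" "C = r `` {c}" using X_cases[OF t(3)] by blast
    show ?thesis unfolding a(2) b(2) c(2) using a(1) b(1) c(1) distrib[of a b c] by (simp add: X_op)
  qed
  have id: "A1 \<rhd>\<^bsub>X\<^esub> A1 = A1" if t: "A1 \<in> carrier X" for A1
  proof -
    obtain a where a: "a \<in> carrier Q" "A1 = r `` {a}" using X_cases[OF t] by blast
    then show ?thesis by (simp add: X_op)
  qed
  show "quandle X" unfolding quandle_def using bij dist id by blast
qed

sublocale X: finite_quandle X by (rule finite_quandle_X)

definition cong_aut :: "('a \<Rightarrow> 'a) set" where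
  "cong_aut = {g \<in> qaut Q. \<forall>x y. (x, y) \<in> r \<longrightarrow> (g x, g y) \<in> r \<and> ((\<iota> g) x, (\<iota> g) y) \<in> r}"

lemma cong_aut_qaut: "g \<in> cong_aut \<Longrightarrow> g \<in> qaut Q"
  and cong_aut_r: "g \<in> cong_aut \<Longrightarrow> (x, y) \<in> r \<Longrightarrow> (g x, g y) \<in> r"
  and cong_aut_inv_r: "g \<in> cong_aut \<Longrightarrow> (x, y) \<in> r \<Longrightarrow> ((\<iota> g) x, (\<iota> g) y) \<in> r"
  unfolding cong_aut_def by simp_all

lemma subgroup_cong_aut: "subgroup cong_aut A"
proof (rule Sym.subgroupI)
  show "cong_aut \<subseteq> carrier A" using cong_aut_qaut qaut_Bij by auto
  have "id\<^sub>Q \<in> cong_aut"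
    using subgroup.one_closed[OF subgroup_qaut] r_carrier by (auto simp: cong_aut_def Bij_one_apply)
  then show "cong_aut \<noteq> {}" by blast
  show "\<iota> g \<in> cong_aut" if "g \<in> cong_aut" for g
    using cong_aut_r[OF that] cong_aut_inv_r[OF that] qaut_inv[OF cong_aut_qaut[OF that]]
      qaut_Bij[OF cong_aut_qaut[OF that]] by (simp add: cong_aut_def)
  show "g \<cdot> h \<in> cong_aut" if g: "g \<in> cong_aut" and h: "h \<in> cong_aut" for g h
  proof -
    have q: "g \<in> qaut Q" "h \<in> qaut Q" "\<iota> g \<in> qaut Q" "\<iota> h \<in> qaut Q"
      using g h cong_aut_qaut qaut_inv by auto
    have i: "\<iota> (g \<cdot> h) = \<iota> h \<cdot> \<iota> g" using q qaut_Bij by (simp add: Sym.inv_mult_group)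
    have "((g \<cdot> h) x, (g \<cdot> h) y) \<in> r \<and> ((\<iota> (g \<cdot> h)) x, (\<iota> (g \<cdot> h)) y) \<in> r"
      if xy: "(x, y) \<in> r" for x y
      using cong_aut_r[OF g cong_aut_r[OF h xy]] cong_aut_inv_r[OF h cong_aut_inv_r[OF g xy]] r_carrier[OF xy]
      unfolding i by (simp add: qaut_mult_apply[OF q(1,2)] qaut_mult_apply[OF q(4,3)])
    then show ?thesis unfolding cong_aut_def using qaut_mult[OF q(1,2)] by simp
  qed
qed

lemma left_mult_cong_aut: "a \<in> carrier Q \<Longrightarrow> L a \<in> cong_aut"
  unfolding cong_aut_def using left_mult_qaut r_op[OF r_refl] r_left_div[OF r_refl] r_carrier
  by (auto simp: left_mult_apply inv_left_mult_apply)

lemma D_subset_cong_aut: "D \<subseteq> cong_aut"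
  by (rule D_subset[OF subgroup_cong_aut])
     (intro subgroup.m_closed[OF subgroup_cong_aut] subgroup.m_inv_closed[OF subgroup_cong_aut] left_mult_cong_aut)

lemma image_class:
  assumes g: "g \<in> cong_aut" and x: "x \<in> carrier Q" shows "g ` (r `` {x}) = r `` {g x}"
proof
  show "g ` (r `` {x}) \<subseteq> r `` {g x}" using cong_aut_r[OF g] by auto
  show "r `` {g x} \<subseteq> g ` (r `` {x})"
  proof
    fix z assume "z \<in> r `` {g x}"
    then have z: "(g x, z) \<in> r" by simp
    then have "(x, (\<iota> g) z) \<in> r"
      using cong_aut_inv_r[OF g z] qaut_inv_apply[OF cong_aut_qaut[OF g] x] by simp
    moreover have "z = g ((\<iota> g) z)" using qaut_apply_inv[OF cong_aut_qaut[OF g]] r_carrier[OF z] by simp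
    ultimately show "z \<in> g ` (r `` {x})" by (intro image_eqI) auto
  qed
qed

definition induced :: "('a \<Rightarrow> 'a) \<Rightarrow> 'a set \<Rightarrow> 'a set" where
  "induced g = (\<lambda>B\<in>carrier X. g ` B)"

lemma induced_apply: "g \<in> cong_aut \<Longrightarrow> x \<in> carrier Q \<Longrightarrow> induced g (r `` {x}) = r `` {g x}"
  by (simp add: induced_def class_X image_class)

lemma induced_Bij: assumes g: "g \<in> cong_aut" shows "induced g \<in> Bij (carrier X)"
proof -
  have g': "\<iota> g \<in> cong_aut" by (rule subgroup.m_inv_closed[OF subgroup_cong_aut g])
  have cl: "induced h B \<in> carrier X" if h: "h \<in> cong_aut" and B: "B \<in> carrier X" for h B
  proof -
    obtain x where x: "x \<in> carrier Q" "B = r `` {x}" using X_cases[OF B] by blast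
    then show ?thesis using class_X[OF qaut_closed[OF cong_aut_qaut[OF h] x(1)]] by (simp add: induced_apply[OF h])
  qed
  have "bij_betw (induced g) (carrier X) (carrier X)"
  proof (rule bij_betw_byWitness[where f' = "induced (\<iota> g)"])
    show "\<forall>B\<in>carrier X. induced (\<iota> g) (induced g B) = B"
    proof
      fix B assume B: "B \<in> carrier X"
      obtain x where x: "x \<in> carrier Q" "B = r `` {x}" using X_cases[OF B] by blast
      then show "induced (\<iota> g) (induced g B) = B"
        using g g' qaut_closed[OF cong_aut_qaut[OF g] x(1)] qaut_inv_apply[OF cong_aut_qaut[OF g] x(1)]
        by (simp add: induced_apply)
    qed
    show "\<forall>B\<in>carrier X. induced g (induced (\<iota> g) B) = B"
    proof
      fix B assume B: "B \<in> carrier X"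
      obtain x where x: "x \<in> carrier Q" "B = r `` {x}" using X_cases[OF B] by blast
      then show "induced g (induced (\<iota> g) B) = B"
        using g g' qaut_closed[OF cong_aut_qaut[OF g'] x(1)] qaut_apply_inv[OF cong_aut_qaut[OF g] x(1)]
        by (simp add: induced_apply)
    qed
  qed (use cl g g' in auto)
  then show ?thesis by (simp add: Bij_def induced_def)
qed

lemma induced_mult:
  assumes g: "g \<in> cong_aut" and h: "h \<in> cong_aut"
  shows "induced (g \<cdot> h) = induced g \<otimes>\<^bsub>X.A\<^esub> induced h"
proof (rule Bij_eqI)
  have gh: "g \<cdot> h \<in> cong_aut" by (rule subgroup.m_closed[OF subgroup_cong_aut g h])
  show "induced (g \<cdot> h) \<in> Bij (carrier X)" by (rule induced_Bij[OF gh])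
  show "induced g \<otimes>\<^bsub>X.A\<^esub> induced h \<in> Bij (carrier X)" using induced_Bij g h by simp
  fix B assume B: "B \<in> carrier X"
  obtain x where x: "x \<in> carrier Q" "B = r `` {x}" using X_cases[OF B] by blast
  have q: "g \<in> qaut Q" "h \<in> qaut Q" using g h cong_aut_qaut by auto
  have "induced (g \<cdot> h) B = r `` {g (h x)}"
    using x induced_apply[OF gh x(1)] qaut_mult_apply[OF q x(1)] by simp
  moreover have "(induced g \<otimes>\<^bsub>X.A\<^esub> induced h) B = induced g (induced h B)"
    by (rule Bij_mult_apply[OF induced_Bij[OF g] induced_Bij[OF h] B])
  ultimately show "induced (g \<cdot> h) B = (induced g \<otimes>\<^bsub>X.A\<^esub> induced h) B"
    using x qaut_closed[OF q(2) x(1)] by (simp add: induced_apply[OF g] induced_apply[OF h])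
qed

lemma induced_group_hom: "group_hom (A\<lparr>carrier := cong_aut\<rparr>) X.A induced"
  using subgroup.subgroup_is_group[OF subgroup_cong_aut group_BijGroup] group_BijGroup
  by (auto simp: group_hom_def group_hom_axioms_def hom_def induced_Bij induced_mult)

lemma induced_one: "induced id\<^sub>Q = \<one>\<^bsub>X.A\<^esub>"
  using group_hom.hom_one[OF induced_group_hom] by simp

lemma induced_inv: assumes g: "g \<in> cong_aut" shows "induced (\<iota> g) = inv\<^bsub>X.A\<^esub> (induced g)"
  using group_hom.hom_inv[OF induced_group_hom, of g] g
    Sym.m_inv_consistent[OF subgroup_cong_aut g] by simp

lemma induced_pow: assumes g: "g \<in> cong_aut"
  shows "induced (g [^]\<^bsub>A\<^esub> (k::nat)) = induced g [^]\<^bsub>X.A\<^esub> k"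
  using group_hom.hom_nat_pow[OF induced_group_hom, of g k] g by (simp flip: Sym.nat_pow_consistent)

lemma induced_qaut: assumes g: "g \<in> cong_aut" shows "induced g \<in> qaut X"
proof -
  have "induced g (B \<rhd>\<^bsub>X\<^esub> C) = induced g B \<rhd>\<^bsub>X\<^esub> induced g C" if t: "B \<in> carrier X" "C \<in> carrier X" for B C
  proof -
    obtain b where b: "b \<in> carrier Q" "B = r `` {b}" using X_cases[OF t(1)] by blast
    obtain c where c: "c \<in> carrier Q" "C = r `` {c}" using X_cases[OF t(2)] by blast
    show ?thesis unfolding b(2) c(2)
      using b(1) c(1) cong_aut_qaut[OF g] by (simp add: X_op induced_apply[OF g] qaut_op qaut_closed)
  qed
  then show ?thesis using induced_Bij[OF g] by (simp add: qaut_def)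
qed

lemma induced_left_mult: assumes a: "a \<in> carrier Q" shows "induced (L a) = X.L (r `` {a})"
proof (rule Bij_eqI)
  show "induced (L a) \<in> Bij (carrier X)" by (rule induced_Bij[OF left_mult_cong_aut[OF a]])
  show "X.L (r `` {a}) \<in> Bij (carrier X)" by (rule X.left_mult_Bij[OF class_X[OF a]])
  fix B assume B: "B \<in> carrier X"
  obtain b where b: "b \<in> carrier Q" "B = r `` {b}" using X_cases[OF B] by blast
  show "induced (L a) B = X.L (r `` {a}) B"
    unfolding b(2) using a b(1) by (simp add: induced_apply[OF left_mult_cong_aut[OF a]] X.left_mult_apply class_X X_op left_mult_apply)
qed

lemma induced_D: assumes g: "g \<in> D" shows "induced g \<in> X.D"
proof -
  let ?H = "{g \<in> cong_aut. induced g \<in> X.D}"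
  have H: "subgroup ?H A"
  proof (rule Sym.subgroupI)
    show "?H \<subseteq> carrier A" using subgroup.subset[OF subgroup_cong_aut] by auto
    have "id\<^sub>Q \<in> ?H"
      using subgroup.one_closed[OF subgroup_cong_aut] subgroup.one_closed[OF X.subgroup_D] by (simp add: induced_one)
    then show "?H \<noteq> {}" by blast
    show "\<iota> g \<in> ?H" if "g \<in> ?H" for g
      using that subgroup.m_inv_closed[OF subgroup_cong_aut] X.D_inv by (simp add: induced_inv)
    show "g \<cdot> h \<in> ?H" if "g \<in> ?H" "h \<in> ?H" for g h
      using that subgroup.m_closed[OF subgroup_cong_aut] X.D_mult by (simp add: induced_mult)
  qed
  have "L a \<cdot> \<iota> L b \<in> ?H" if a: "a \<in> carrier Q" and b: "b \<in> carrier Q" for a b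
  proof -
    have ca: "L a \<in> cong_aut" "L b \<in> cong_aut" "\<iota> L b \<in> cong_aut"
      using a b left_mult_cong_aut subgroup.m_inv_closed[OF subgroup_cong_aut] by auto
    have "induced (L a \<cdot> \<iota> L b) = X.L (r `` {a}) \<otimes>\<^bsub>X.A\<^esub> inv\<^bsub>X.A\<^esub> X.L (r `` {b})"
      using ca a b by (simp add: induced_mult induced_inv induced_left_mult)
    then show ?thesis
      using X.displacement_in_D[OF class_X[OF a] class_X[OF b]] subgroup.m_closed[OF subgroup_cong_aut ca(1,3)] by simp
  qed
  then show ?thesis using D_subset[OF H] g by blast
qed

end

text \<open>The displacement group acts faithfully on singletons.\<close>

lemma (in finite_quandle) abelian_if_trivial_factor_abelian:
  assumes cong: "qcongruence Q (zero_cong Q)" and ab: "abelian_quandle (qfactor Q (zero_cong Q))"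
  shows "abelian_quandle Q"
proof -
  interpret Z: quandle_congruence Q "zero_cong Q" by unfold_locales (rule cong)
  have cl: "zero_cong Q `` {x} = {x}" if "x \<in> carrier Q" for x using that by auto
  have app: "Z.induced g {x} = {g x}" if "g \<in> D" "x \<in> carrier Q" for g x
    using Z.induced_apply[of g x] that Z.D_subset_cong_aut qaut_closed[OF D_qaut] by (auto simp: cl)
  have inj: "g = h" if g: "g \<in> D" and h: "h \<in> D" and e: "Z.induced g = Z.induced h" for g h
    by (rule Bij_eqI[OF D_Bij[OF g] D_Bij[OF h]]) (use app[OF g] app[OF h] e in simp)
  have ca: "g \<in> Z.cong_aut" if "g \<in> D" for g using that Z.D_subset_cong_aut by blast
  note abX = ab[unfolded Z.X.abelian_quandle_iff]
  have "g \<cdot> h = h \<cdot> g" if g: "g \<in> D" and h: "h \<in> D" for g h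
    by (rule inj[OF D_mult[OF g h] D_mult[OF h g]])
       (use abX Z.induced_D[OF g] Z.induced_D[OF h] in \<open>simp add: Z.induced_mult ca g h\<close>)
  moreover have "g = id\<^sub>Q" if a: "a \<in> carrier Q" and g: "g \<in> D" and e: "g a = a" for a g
  proof (rule inj[OF g subgroup.one_closed[OF subgroup_D]])
    have "{a} \<in> carrier Z.X" using Z.class_X[OF a] cl[OF a] by simp
    moreover have "Z.induced g {a} = {a}" using app[OF g a] e by simp
    ultimately show "Z.induced g = Z.induced id\<^sub>Q"
      using abX Z.induced_D[OF g] by (simp add: Z.induced_one)
  qed
  ultimately show ?thesis unfolding abelian_quandle_iff by blast
qed

section \<open>The unique congruence and its classes\<close>

text \<open>The sizes of the factor and of the classes are prime powers; this makes both of them instances of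
\<open>simple_homogeneous\<close>.\<close>

locale lss_quandle = quandle_congruence Q r for Q :: "'a magma" (structure) and r +
  fixes p q m n :: nat
  assumes p: "prime p" and q: "prime q" and m: "1 \<le> m"
    and transitive: "\<And>x y. x \<in> carrier Q \<Longrightarrow> y \<in> carrier Q \<Longrightarrow> \<exists>g\<in>D. g x = y"
    and lss: "\<And>T. proper_subquandle Q T \<Longrightarrow> strictly_simple (Q\<lparr>carrier := T\<rparr>)"
    and congruences: "\<And>s. qcongruence Q s \<Longrightarrow> s = zero_cong Q \<or> s = r \<or> s = one_cong Q"
    and r_neq_one: "r \<noteq> one_cong Q"
    and card_X: "card (carrier X) = q ^ n" and card_class: "\<And>x. x \<in> carrier Q \<Longrightarrow> card (r `` {x}) = p ^ m"
    and nonabelian: "\<not> abelian_quandle Q"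
    and sigma: "sigma_rel Q \<inter> gamma_cong Q = zero_cong Q"
begin

lemma proper_subquandle_minimal:
  assumes T: "subquandle Q T" "T \<noteq> carrier Q" and U: "subquandle Q U" "U \<subseteq> T"
    and ab: "a \<in> U" "b \<in> U" "a \<noteq> b"
  shows "U = T"
proof (rule ccontr)
  assume "U \<noteq> T"
  then have "proper_subquandle (Q\<lparr>carrier := T\<rparr>) U"
    using subquandle_of_subquandle[OF T(1)] U ab by (auto simp: proper_subquandle_def)
  moreover have "proper_subquandle Q T" using T U ab by (auto simp: proper_subquandle_def)
  ultimately show False using lss[of T] by (auto simp: strictly_simple_def)
qed

lemma class_nontrivial: assumes x: "x \<in> carrier Q" shows "\<exists>y. (x, y) \<in> r \<and> y \<noteq> x"
proof (rule ccontr)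
  assume "\<nexists>y. (x, y) \<in> r \<and> y \<noteq> x"
  then have "r `` {x} \<subseteq> {x}" by auto
  then have "card (r `` {x}) \<le> 1" using card_mono[of "{x}" "r `` {x}"] by simp
  moreover have "1 < p ^ m" using one_less_power[OF prime_gt_1_nat[OF p]] m by simp
  ultimately show False using card_class[OF x] by simp
qed

lemma other_class: assumes x: "x \<in> carrier Q" shows "\<exists>y\<in>carrier Q. (x, y) \<notin> r"
proof (rule ccontr)
  assume "\<not> (\<exists>y\<in>carrier Q. (x, y) \<notin> r)"
  then have all: "(x, y) \<in> r" if "y \<in> carrier Q" for y using that by blast
  have "(a, b) \<in> r" if "a \<in> carrier Q" "b \<in> carrier Q" for a b
    by (rule r_trans[OF r_sym[OF all[OF that(1)]] all[OF that(2)]])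
  moreover have "r \<subseteq> one_cong Q" by (rule equiv_type[OF equiv])
  ultimately have "r = one_cong Q" by blast
  then show False using r_neq_one by simp
qed

text \<open>A class is a subquandle with at least two points, so it is not strictly contained in a proper subquandle.\<close>

lemma class_and_point_generate:
  assumes T: "subquandle Q T" and x: "x \<in> carrier Q" "r `` {x} \<subseteq> T" and y: "y \<in> T" "(x, y) \<notin> r"
  shows "T = carrier Q"
proof (rule ccontr)
  assume ne: "T \<noteq> carrier Q"
  obtain z where z: "(x, z) \<in> r" "z \<noteq> x" using class_nontrivial[OF x(1)] by blast
  have "r `` {x} = T"
    by (rule proper_subquandle_minimal[OF T ne subquandle_class[OF x(1)] x(2), of x z])
       (use z r_refl[OF x(1)] in auto)
  then show False using y by blast
qed

text \<open>The union of the classes in a subquandle of the factor is a subquandle of \<open>Q\<close>. If it contains two classes,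
it is all of \<open>Q\<close>.\<close>

lemma factor_simple: "simple_homogeneous X q n"
proof (intro simple_homogeneous.intro finite_quandle_X simple_homogeneous_axioms.intro)
  show "prime q" by (rule q)
  show "card (carrier X) = q ^ n" by (rule card_X)
  have ne: "carrier Q \<noteq> {}" using r_neq_one r_carrier by auto
  then obtain x where x: "x \<in> carrier Q" by blast
  obtain y where y: "y \<in> carrier Q" "(x, y) \<notin> r" using other_class[OF x] by blast
  have "r `` {x} \<noteq> r `` {y}" using class_eq_iff[OF x y(1)] y by simp
  then show "\<exists>B\<in>carrier X. \<exists>C\<in>carrier X. B \<noteq> C" using class_X[OF x] class_X[OF y(1)] by blast
  show "\<exists>h\<in>qaut X. h B = C" if BC: "B \<in> carrier X" "C \<in> carrier X" for B C
  proof -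
    obtain b where b: "b \<in> carrier Q" "B = r `` {b}" using X_cases[OF BC(1)] by blast
    obtain c where c: "c \<in> carrier Q" "C = r `` {c}" using X_cases[OF BC(2)] by blast
    obtain g where g: "g \<in> D" "g b = c" using transitive[OF b(1) c(1)] by blast
    have gc: "g \<in> cong_aut" using g D_subset_cong_aut by blast
    have "induced g B = C" using induced_apply[OF gc b(1)] g b c by simp
    then show ?thesis using induced_qaut[OF gc] by blast
  qed
  show "T = carrier X" if T: "subquandle X T" and BC: "B \<in> T" "C \<in> T" "B \<noteq> C" for T B C
  proof -
    have TX: "T \<subseteq> carrier X" using T by (simp add: subquandle_def)
    have U: "subquandle Q (\<Union>T)"
    proof (rule subquandleI)
      show "\<Union>T \<subseteq> carrier Q"
      proof
        fix z assume "z \<in> \<Union>T"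
        then obtain E where E: "E \<in> T" "z \<in> E" by blast
        then have "E \<in> carrier X" using TX by blast
        then show "z \<in> carrier Q" using E(2) r_carrier by (elim X_cases) auto
      qed
      fix a b assume "a \<in> \<Union>T" "b \<in> \<Union>T"
      then obtain E F where EF: "E \<in> T" "a \<in> E" "F \<in> T" "b \<in> F" by blast
      obtain e where e: "e \<in> carrier Q" "E = r `` {e}" using X_cases[of E] EF TX by blast
      obtain f where f: "f \<in> carrier Q" "F = r `` {f}" using X_cases[of F] EF TX by blast
      have "(e \<rhd> f, a \<rhd> b) \<in> r" using r_op EF e f by simp
      moreover have "E \<rhd>\<^bsub>X\<^esub> F \<in> T" using T EF unfolding subquandle_def by blast
      then have "r `` {e \<rhd> f} \<in> T" using X_op[OF e(1) f(1)] e(2) f(2) by simp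
      ultimately show "a \<rhd> b \<in> \<Union>T" by blast
    qed
    obtain b where b: "b \<in> carrier Q" "B = r `` {b}" using X_cases[of B] BC TX by blast
    obtain c where c: "c \<in> carrier Q" "C = r `` {c}" using X_cases[of C] BC TX by blast
    have bc: "(b, c) \<notin> r" using class_eq BC b c by blast
    have "r `` {b} \<subseteq> \<Union>T" using BC(1) b(2) by blast
    moreover have "c \<in> \<Union>T" using BC(2) c(2) r_refl[OF c(1)] by blast
    ultimately have "\<Union>T = carrier Q" using class_and_point_generate[OF U b(1) _ _ bc] by simp
    have "E \<in> T" if E: "E \<in> carrier X" for E
    proof -
      obtain e where e: "e \<in> carrier Q" "E = r `` {e}" using X_cases[OF E] by blast
      then obtain F where F: "F \<in> T" "e \<in> F" using \<open>\<Union>T = carrier Q\<close> by blast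
      obtain f where f: "f \<in> carrier Q" "F = r `` {f}" using X_cases[of F] F TX by blast
      have "F = E" using F f e class_eq by simp
      then show ?thesis using F by simp
    qed
    then show ?thesis using TX by blast
  qed
qed

sublocale XS: simple_homogeneous X q n by (rule factor_simple)

text \<open>The kernel of the action of the displacement group on the classes.\<close>

definition Ker where "Ker = {g \<in> D. \<forall>x\<in>carrier Q. (x, g x) \<in> r}"

lemma Ker_D: "g \<in> Ker \<Longrightarrow> g \<in> D" and Ker_r: "g \<in> Ker \<Longrightarrow> x \<in> carrier Q \<Longrightarrow> (x, g x) \<in> r"
  by (simp_all add: Ker_def)

lemma D_cong_aut: "g \<in> D \<Longrightarrow> g \<in> cong_aut"
  using D_subset_cong_aut by (rule subsetD)

lemma Ker_Bij: "g \<in> Ker \<Longrightarrow> g \<in> Bij (carrier Q)"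
  by (rule D_Bij[OF Ker_D])

lemma Ker_qaut: "g \<in> Ker \<Longrightarrow> g \<in> qaut Q"
  by (rule D_qaut[OF Ker_D])

lemma induced_one_Ker: assumes g: "g \<in> D" and e: "induced g = \<one>\<^bsub>X.A\<^esub>" shows "g \<in> Ker"
proof -
  have "(x, g x) \<in> r" if x: "x \<in> carrier Q" for x
  proof -
    have "r `` {g x} = r `` {x}"
      using induced_apply[OF D_cong_aut[OF g] x] e class_X[OF x] by (simp add: Bij_one_apply)
    then show ?thesis using class_eq_iff[OF x qaut_closed[OF D_qaut[OF g] x]] by simp
  qed
  then show ?thesis using g by (simp add: Ker_def)
qed

text \<open>The factor is abelian, so an induced displacement that fixes one class fixes all classes.\<close>

lemma KerI: assumes g: "g \<in> D" and x: "x \<in> carrier Q" "(x, g x) \<in> r" shows "g \<in> Ker"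
proof (rule induced_one_Ker[OF g])
  have "induced g \<in> XS.P" using induced_D[OF g] XS.D_subset_P by blast
  moreover have "induced g (r `` {x}) = r `` {x}"
    using induced_apply[OF D_cong_aut[OF g] x(1)] class_eq[OF x(2)] by simp
  ultimately show "induced g = \<one>\<^bsub>X.A\<^esub>" using XS.P_fixed class_X[OF x(1)] by blast
qed

lemma subgroup_Ker: "subgroup Ker A"
proof (rule Sym.subgroupI)
  show "Ker \<subseteq> carrier A" using Ker_Bij by auto
  have "id\<^sub>Q \<in> Ker" using subgroup.one_closed[OF subgroup_D] r_refl by (simp add: Ker_def Bij_one_apply)
  then show "Ker \<noteq> {}" by blast
  show "\<iota> g \<in> Ker" if g: "g \<in> Ker" for g
  proof -
    have "(x, (\<iota> g) x) \<in> r" if x: "x \<in> carrier Q" for x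
    proof -
      have y: "(\<iota> g) x \<in> carrier Q" by (rule qaut_closed[OF qaut_inv[OF Ker_qaut[OF g]] x])
      show ?thesis using r_sym[OF Ker_r[OF g y]] qaut_apply_inv[OF Ker_qaut[OF g] x] by simp
    qed
    then show ?thesis using D_inv[OF Ker_D[OF g]] by (simp add: Ker_def)
  qed
  show "g \<cdot> h \<in> Ker" if g: "g \<in> Ker" and h: "h \<in> Ker" for g h
  proof -
    have "(x, (g \<cdot> h) x) \<in> r" if x: "x \<in> carrier Q" for x
      using r_trans[OF Ker_r[OF h x] Ker_r[OF g qaut_closed[OF Ker_qaut[OF h] x]]]
        qaut_mult_apply[OF Ker_qaut[OF g] Ker_qaut[OF h] x] by simp
    then show ?thesis using D_mult[OF Ker_D[OF g] Ker_D[OF h]] by (simp add: Ker_def)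
  qed
qed

lemma Ker_mult: "g \<in> Ker \<Longrightarrow> h \<in> Ker \<Longrightarrow> g \<cdot> h \<in> Ker"
  by (rule subgroup.m_closed[OF subgroup_Ker])

lemma Ker_inv: "g \<in> Ker \<Longrightarrow> \<iota> g \<in> Ker"
  by (rule subgroup.m_inv_closed[OF subgroup_Ker])

lemma Ker_fixed: "g \<in> D \<Longrightarrow> x \<in> carrier Q \<Longrightarrow> g x = x \<Longrightarrow> g \<in> Ker"
  by (rule KerI[of g x]) (simp_all add: r_refl)

lemma Ker_transitive: assumes xy: "(x, y) \<in> r" shows "\<exists>g\<in>Ker. g x = y"
proof -
  obtain g where g: "g \<in> D" "g x = y" using transitive r_carrier[OF xy] by blast
  then have "g \<in> Ker" using KerI[OF g(1), of x] xy r_carrier by simp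
  then show ?thesis using g by blast
qed

lemma conj_apply:
  assumes k: "k \<in> qaut Q" and g: "g \<in> qaut Q" and x: "x \<in> carrier Q"
  shows "(k \<cdot> g \<cdot> \<iota> k) (k x) = k (g x)"
  using k g x by (simp add: qaut_mult_apply qaut_mult qaut_inv qaut_closed qaut_inv_apply)

lemma Ker_conj:
  assumes k: "k \<in> cong_aut" and g: "g \<in> Ker" and D: "k \<cdot> g \<cdot> \<iota> k \<in> D"
  shows "k \<cdot> g \<cdot> \<iota> k \<in> Ker"
proof -
  obtain x where x: "x \<in> carrier Q" using r_neq_one r_carrier by auto
  have kq: "k \<in> qaut Q" by (rule cong_aut_qaut[OF k])
  show ?thesis
    using KerI[OF D, of "k x"] qaut_closed[OF kq x] cong_aut_r[OF k Ker_r[OF g x]] conj_apply[OF kq Ker_qaut[OF g] x] by simp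
qed

lemma Ker_conj_D: "k \<in> D \<Longrightarrow> g \<in> Ker \<Longrightarrow> k \<cdot> g \<cdot> \<iota> k \<in> Ker"
  by (rule Ker_conj[OF D_cong_aut]) (simp_all add: D_mult D_inv Ker_D)

lemma Ker_conj_left_mult: "a \<in> carrier Q \<Longrightarrow> g \<in> Ker \<Longrightarrow> L a \<cdot> g \<cdot> \<iota> L a \<in> Ker"
  by (rule Ker_conj[OF left_mult_cong_aut]) (simp_all add: D_conj_left_mult Ker_D)

lemma D_commutator_Ker:
  assumes g: "g \<in> D" and h: "h \<in> D" shows "g \<cdot> h \<cdot> \<iota> (h \<cdot> g) \<in> Ker"
proof (rule induced_one_Ker)
  show "g \<cdot> h \<cdot> \<iota> (h \<cdot> g) \<in> D" using g h D_mult D_inv by simp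
  note c = D_cong_aut[OF g] D_cong_aut[OF h] D_cong_aut[OF D_mult[OF g h]] D_cong_aut[OF D_mult[OF h g]]
  have gP: "induced g \<in> XS.P" "induced h \<in> XS.P" using induced_D g h XS.D_subset_P by auto
  have "induced (g \<cdot> h \<cdot> \<iota> (h \<cdot> g)) = induced (g \<cdot> h) \<otimes>\<^bsub>X.A\<^esub> inv\<^bsub>X.A\<^esub> induced (h \<cdot> g)"
    using c D_cong_aut[OF D_inv[OF D_mult[OF h g]]] by (simp only: induced_mult[OF c(3)] induced_inv[OF c(4)])
  also have "induced (h \<cdot> g) = induced (g \<cdot> h)"
    unfolding induced_mult[OF c(1,2)] induced_mult[OF c(2,1)] by (rule XS.P_comm[OF gP(2,1)])
  finally show "induced (g \<cdot> h \<cdot> \<iota> (h \<cdot> g)) = \<one>\<^bsub>X.A\<^esub>"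
    using induced_Bij[OF c(3)] by simp
qed

lemma D_pow: "g \<in> D \<Longrightarrow> g [^]\<^bsub>A\<^esub> (k::nat) \<in> D"
  using Sym.subgroup_int_pow_closed[OF subgroup_D, of g "int k"] by (simp add: int_pow_int)

lemma D_pow_Ker: assumes g: "g \<in> D" shows "g [^]\<^bsub>A\<^esub> q \<in> Ker"
proof (rule induced_one_Ker[OF D_pow[OF g]])
  have "induced g \<in> XS.P" using induced_D g XS.D_subset_P by auto
  then show "induced (g [^]\<^bsub>A\<^esub> q) = \<one>\<^bsub>X.A\<^esub>"
    using XS.P_pow_p by (simp add: induced_pow[OF D_cong_aut[OF g]])
qed

text \<open>Equality does not have an abelian factor because \<open>Q\<close> is not abelian.\<close>

lemma gamma_eq: "gamma_cong Q = r"
  unfolding gamma_cong_def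
proof (rule Least_equality)
  show "qcongruence Q r \<and> abelian_quandle (qfactor Q r)" using congruence XS.abelian by simp
  fix s assume s: "qcongruence Q s \<and> abelian_quandle (qfactor Q s)"
  have "s \<noteq> zero_cong Q" using s abelian_if_trivial_factor_abelian nonabelian by blast
  then consider "s = r" | "s = one_cong Q" using congruences[of s] s by blast
  then show "r \<le> s" by cases (use equiv_type[OF equiv] in simp_all)
qed

text \<open>Two distinct points of one class have different stabilizers, so one of these moves the other point.\<close>

lemma stabilizer_moves_class:
  "\<exists>x\<in>carrier Q. \<exists>g\<in>Ker. g x = x \<and> (\<exists>y. (x, y) \<in> r \<and> g y \<noteq> y)"
proof -
  obtain x where x: "x \<in> carrier Q" using r_neq_one r_carrier by auto
  obtain y where y: "(x, y) \<in> r" "y \<noteq> x" using class_nontrivial[OF x] by blast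
  have yc: "y \<in> carrier Q" using r_carrier y by blast
  have "(x, y) \<notin> sigma_rel Q" using sigma gamma_eq y by blast
  then have ne: "Dis_stabilizer Q x \<noteq> Dis_stabilizer Q y" using x yc by (simp add: sigma_rel_def)
  have "\<exists>g\<in>D. g x = x \<and> g y \<noteq> y \<or> g y = y \<and> g x \<noteq> x"
  proof (rule ccontr)
    assume "\<not> ?thesis"
    then have "Dis_stabilizer Q x = Dis_stabilizer Q y" unfolding stabilizer_def by blast
    then show False using ne by simp
  qed
  then obtain g where g: "g \<in> D" "g x = x \<and> g y \<noteq> y \<or> g y = y \<and> g x \<noteq> x" by blast
  from g(2) show ?thesis
  proof
    assume "g x = x \<and> g y \<noteq> y"
    then show ?thesis using Ker_fixed[OF g(1) x] x y(1) by (intro bexI[of _ x] bexI[of _ g]) auto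
  next
    assume "g y = y \<and> g x \<noteq> x"
    then show ?thesis using Ker_fixed[OF g(1) yc] yc r_sym[OF y(1)] by (intro bexI[of _ y] bexI[of _ g]) auto
  qed
qed

definition block :: "'a \<Rightarrow> 'a magma" where "block x = Q\<lparr>carrier := r `` {x}\<rparr>"

definition res :: "'a \<Rightarrow> ('a \<Rightarrow> 'a) \<Rightarrow> 'a \<Rightarrow> 'a" where "res x g = restrict g (r `` {x})"

lemma carrier_block [simp]: "carrier (block x) = r `` {x}"
  by (simp add: block_def)

lemma res_apply: "(x, y) \<in> r \<Longrightarrow> res x g y = g y"
  by (simp add: res_def)

lemma res_qaut_gen:
  assumes g: "g \<in> cong_aut" and x: "x \<in> carrier Q" and gx: "(x, g x) \<in> r" shows "res x g \<in> qaut (block x)"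
  unfolding res_def block_def
  by (rule qaut_restrict[OF cong_aut_qaut[OF g] subquandle_class[OF x]])
     (use image_class[OF g x] class_eq[OF gx] in simp)

lemma res_qaut: "g \<in> Ker \<Longrightarrow> x \<in> carrier Q \<Longrightarrow> res x g \<in> qaut (block x)"
  by (rule res_qaut_gen) (simp_all add: D_cong_aut Ker_D Ker_r)

lemma block_simple: assumes x: "x \<in> carrier Q" shows "simple_homogeneous (block x) p m"
proof (intro simple_homogeneous.intro simple_homogeneous_axioms.intro)
  show "finite_quandle (block x)"
    unfolding block_def by (rule subquandle_imp_finite_quandle[OF subquandle_class[OF x]])
  show "prime p" by (rule p)
  show "card (carrier (block x)) = p ^ m" using card_class[OF x] by simp
  show "\<exists>a\<in>carrier (block x). \<exists>b\<in>carrier (block x). a \<noteq> b"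
    using class_nontrivial[OF x] r_refl[OF x] by auto
  show "T = carrier (block x)" if T: "subquandle (block x) T" "a \<in> T" "b \<in> T" "a \<noteq> b" for T a b
  proof -
    have TQ: "subquandle Q T" "T \<subseteq> r `` {x}"
      using T(1) subquandle_of_subquandle[OF subquandle_class[OF x]] by (simp_all add: block_def)
    have "r `` {x} \<noteq> carrier Q" using other_class[OF x] by blast
    then show ?thesis using proper_subquandle_minimal[OF subquandle_class[OF x] _ TQ T(2-4)] by simp
  qed
  show "\<exists>h\<in>qaut (block x). h y = z" if yz: "y \<in> carrier (block x)" "z \<in> carrier (block x)" for y z
  proof -
    have "(x, y) \<in> r" "(x, z) \<in> r" using yz by auto
    then have "(y, z) \<in> r" using r_trans r_sym by metis
    then obtain g where g: "g \<in> Ker" "g y = z" using Ker_transitive by blast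
    then show ?thesis using res_qaut[OF g(1) x] yz by (intro bexI[of _ "res x g"]) (auto simp: res_apply)
  qed
qed

lemma res_mult:
  assumes g: "g \<in> Ker" and h: "h \<in> Ker" and x: "x \<in> carrier Q"
  shows "res x (g \<cdot> h) = res x g \<otimes>\<^bsub>BijGroup (r `` {x})\<^esub> res x h"
proof (rule Bij_eqI)
  interpret B: simple_homogeneous "block x" p m by (rule block_simple[OF x])
  show "res x (g \<cdot> h) \<in> Bij (r `` {x})" using B.qaut_Bij[OF res_qaut[OF Ker_mult[OF g h] x]] by simp
  have b: "res x g \<in> Bij (r `` {x})" "res x h \<in> Bij (r `` {x})"
    using B.qaut_Bij[OF res_qaut[OF g x]] B.qaut_Bij[OF res_qaut[OF h x]] by simp_all
  show "res x g \<otimes>\<^bsub>BijGroup (r `` {x})\<^esub> res x h \<in> Bij (r `` {x})" using b by simp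
  fix y assume y: "y \<in> r `` {x}"
  then have yQ: "y \<in> carrier Q" "(x, y) \<in> r" using r_carrier by auto
  have "(x, h y) \<in> r" using r_trans[OF yQ(2) Ker_r[OF h yQ(1)]] .
  then show "res x (g \<cdot> h) y = (res x g \<otimes>\<^bsub>BijGroup (r `` {x})\<^esub> res x h) y"
    using Bij_mult_apply[OF b y] yQ qaut_mult_apply[OF Ker_qaut[OF g] Ker_qaut[OF h] yQ(1)] by (simp add: res_apply)
qed

lemma res_group_hom: assumes x: "x \<in> carrier Q"
  shows "group_hom (A\<lparr>carrier := Ker\<rparr>) (BijGroup (r `` {x})) (res x)"
proof -
  interpret B: simple_homogeneous "block x" p m by (rule block_simple[OF x])
  have "res x g \<in> Bij (r `` {x})" if "g \<in> Ker" for g using B.qaut_Bij[OF res_qaut[OF that x]] by simp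
  then show ?thesis
    using subgroup.subgroup_is_group[OF subgroup_Ker group_BijGroup] group_BijGroup
    by (auto simp: group_hom_def group_hom_axioms_def hom_def res_mult x)
qed

lemma res_one: "x \<in> carrier Q \<Longrightarrow> res x id\<^sub>Q = \<one>\<^bsub>BijGroup (r `` {x})\<^esub>"
  using group_hom.hom_one[OF res_group_hom] by simp

lemma res_inv: "g \<in> Ker \<Longrightarrow> x \<in> carrier Q \<Longrightarrow> res x (\<iota> g) = inv\<^bsub>BijGroup (r `` {x})\<^esub> res x g"
  using group_hom.hom_inv[OF res_group_hom, of x g] Sym.m_inv_consistent[OF subgroup_Ker, of g] by simp

lemma res_pow: "g \<in> Ker \<Longrightarrow> x \<in> carrier Q \<Longrightarrow> res x (g [^]\<^bsub>A\<^esub> (k::nat)) = res x g [^]\<^bsub>BijGroup (r `` {x})\<^esub> k"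
  using group_hom.hom_nat_pow[OF res_group_hom, of x g k] by (simp flip: Sym.nat_pow_consistent)

text \<open>Being embedded in the product of the translation groups of the classes, this is an elementary abelian
\<open>p\<close>-group.\<close>

definition N where "N = {g \<in> Ker. \<forall>x\<in>carrier Q. res x g \<in> translation_group (block x)}"

lemma N_Ker: "g \<in> N \<Longrightarrow> g \<in> Ker" and N_res: "g \<in> N \<Longrightarrow> x \<in> carrier Q \<Longrightarrow> res x g \<in> translation_group (block x)"
  by (simp_all add: N_def)

lemma Ker_eqI:
  assumes g: "g \<in> Ker" and h: "h \<in> Ker" and e: "\<And>x. x \<in> carrier Q \<Longrightarrow> res x g = res x h" shows "g = h"
proof (rule Bij_eqI[OF Ker_Bij[OF g] Ker_Bij[OF h]])
  fix x assume x: "x \<in> carrier Q"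
  show "g x = h x" using fun_cong[OF e[OF x], of x] r_refl[OF x] by (simp add: res_apply)
qed

lemma subgroup_N: "subgroup N A"
proof (rule Sym.subgroupI)
  note sP = simple_homogeneous.subgroup_P[OF block_simple, simplified]
  show "N \<subseteq> carrier A" using N_Ker Ker_Bij by auto
  have "id\<^sub>Q \<in> N" using subgroup.one_closed[OF subgroup_Ker] subgroup.one_closed[OF sP]
    by (simp add: N_def res_one)
  then show "N \<noteq> {}" by blast
  show "\<iota> g \<in> N" if "g \<in> N" for g
    using that Ker_inv subgroup.m_inv_closed[OF sP] by (simp add: N_def res_inv)
  show "g \<cdot> h \<in> N" if "g \<in> N" "h \<in> N" for g h
    using that Ker_mult subgroup.m_closed[OF sP] by (simp add: N_def res_mult)
qed

lemma N_mult: "g \<in> N \<Longrightarrow> h \<in> N \<Longrightarrow> g \<cdot> h \<in> N"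
  by (rule subgroup.m_closed[OF subgroup_N])

lemma N_inv: "g \<in> N \<Longrightarrow> \<iota> g \<in> N"
  by (rule subgroup.m_inv_closed[OF subgroup_N])

lemma N_comm: assumes g: "g \<in> N" and h: "h \<in> N" shows "g \<cdot> h = h \<cdot> g"
proof (rule Ker_eqI)
  show "g \<cdot> h \<in> Ker" "h \<cdot> g \<in> Ker" using g h N_Ker Ker_mult by auto
  fix x assume x: "x \<in> carrier Q"
  show "res x (g \<cdot> h) = res x (h \<cdot> g)"
    using simple_homogeneous.P_comm[OF block_simple[OF x] N_res[OF g x] N_res[OF h x]]
    by (simp add: res_mult N_Ker g h x)
qed

lemma N_pow_p: assumes g: "g \<in> N" shows "g [^]\<^bsub>A\<^esub> p = id\<^sub>Q"
proof (rule Ker_eqI)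
  have gK: "g \<in> Ker" by (rule N_Ker[OF g])
  show "g [^]\<^bsub>A\<^esub> p \<in> Ker"
    using Sym.subgroup_int_pow_closed[OF subgroup_Ker gK, of "int p"] by (simp add: int_pow_int)
  show "id\<^sub>Q \<in> Ker" by (rule subgroup.one_closed[OF subgroup_Ker])
  fix x assume x: "x \<in> carrier Q"
  show "res x (g [^]\<^bsub>A\<^esub> p) = res x id\<^sub>Q"
    using simple_homogeneous.P_pow_p[OF block_simple[OF x] N_res[OF g x]] by (simp add: res_pow gK x res_one)
qed

lemma res_eq_one: assumes x: "x \<in> carrier Q" and e: "res x g = \<one>\<^bsub>BijGroup (r `` {x})\<^esub>" and y: "(x, y) \<in> r"
  shows "g y = y"
  using fun_cong[OF e, of y] y by (simp add: res_apply Bij_one_apply)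

lemma N_fixed: assumes g: "g \<in> N" and x: "x \<in> carrier Q" "g x = x" and y: "(x, y) \<in> r" shows "g y = y"
proof (rule res_eq_one[OF x(1) _ y])
  show "res x g = \<one>\<^bsub>BijGroup (r `` {x})\<^esub>"
    using simple_homogeneous.P_fixed[OF block_simple[OF x(1)] N_res[OF g x(1)], of x] r_refl[OF x(1)] x
    by (simp add: res_apply)
qed

lemma res_translation_if_fixed_point_free:
  assumes g: "g \<in> Ker" and x: "x \<in> carrier Q" and fpf: "\<And>y. (x, y) \<in> r \<Longrightarrow> g y \<noteq> y"
  shows "res x g \<in> translation_group (block x)"
  unfolding translation_group_def using res_qaut[OF g x] fpf by (simp add: res_apply)

lemma Ker_not_N:
  assumes g: "g \<in> Ker" "g \<notin> N" shows "\<exists>x\<in>carrier Q. g x = x \<and> (\<exists>y. (x, y) \<in> r \<and> g y \<noteq> y)"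
proof -
  obtain x where x: "x \<in> carrier Q" "res x g \<notin> translation_group (block x)" using g by (auto simp: N_def)
  interpret B: simple_homogeneous "block x" p m by (rule block_simple[OF x(1)])
  obtain z where z: "(x, z) \<in> r" "g z = z" using res_translation_if_fixed_point_free[OF g(1) x(1)] x(2) by blast
  have "res x g \<noteq> \<one>\<^bsub>B.A\<^esub>" using x(2) subgroup.one_closed[OF B.subgroup_P] by auto
  moreover have "res x g = \<one>\<^bsub>B.A\<^esub>" if "\<And>y. (x, y) \<in> r \<Longrightarrow> g y = y"
    by (rule Bij_eqI[OF B.qaut_Bij[OF res_qaut[OF g(1) x(1)]]]) (use that in \<open>auto simp: res_apply Bij_one_apply\<close>)
  ultimately obtain y where y: "(x, y) \<in> r" "g y \<noteq> y" by blast
  have "(z, y) \<in> r" using r_trans[OF r_sym[OF z(1)] y(1)] .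
  then show ?thesis using z y r_carrier by blast
qed

text \<open>An element of \<open>Ker\<close> lies in \<open>N\<close> iff on each class it is trivial or without fixed points, and this is
invariant under automorphisms that permute the classes.\<close>

lemma N_conj:
  assumes k: "k \<in> cong_aut" and g: "g \<in> N" and Ker: "k \<cdot> g \<cdot> \<iota> k \<in> Ker"
  shows "k \<cdot> g \<cdot> \<iota> k \<in> N"
proof (rule ccontr)
  let ?c = "k \<cdot> g \<cdot> \<iota> k" and ?k' = "\<iota> k"
  assume "?c \<notin> N"
  then obtain x y where x: "x \<in> carrier Q" "?c x = x" and y: "(x, y) \<in> r" "?c y \<noteq> y"
    using Ker_not_N[OF Ker] by blast
  have kq: "k \<in> qaut Q" and gq: "g \<in> qaut Q" using cong_aut_qaut[OF k] Ker_qaut[OF N_Ker[OF g]] .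
  have yc: "y \<in> carrier Q" using r_carrier y by blast
  have xy': "?k' x \<in> carrier Q" "?k' y \<in> carrier Q" using qaut_closed[OF qaut_inv[OF kq]] x yc by auto
  have cc: "?c z = k (g (?k' z))" if "z \<in> carrier Q" "?k' z \<in> carrier Q" for z
    using conj_apply[OF kq gq that(2)] qaut_apply_inv[OF kq that(1)] by simp
  have "g (?k' x) = ?k' x"
    using qaut_inv_apply[OF kq qaut_closed[OF gq xy'(1)]] cc[OF x(1) xy'(1)] x(2) by simp
  then have "g (?k' y) = ?k' y" using N_fixed[OF g xy'(1)] cong_aut_inv_r[OF k y(1)] by simp
  then have "?c y = y" using cc[OF yc xy'(2)] qaut_apply_inv[OF kq yc] by simp
  then show False using y by simp
qed

lemma N_conj_D: "k \<in> D \<Longrightarrow> g \<in> N \<Longrightarrow> k \<cdot> g \<cdot> \<iota> k \<in> N"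
  by (rule N_conj[OF D_cong_aut]) (simp_all add: Ker_conj_D N_Ker)

lemma N_conj_left_mult: "a \<in> carrier Q \<Longrightarrow> g \<in> N \<Longrightarrow> L a \<cdot> g \<cdot> \<iota> L a \<in> N"
  by (rule N_conj[OF left_mult_cong_aut]) (simp_all add: Ker_conj_left_mult N_Ker)

lemma Ker_commutator_N:
  assumes g: "g \<in> Ker" and h: "h \<in> Ker" shows "g \<cdot> h \<cdot> \<iota> (h \<cdot> g) \<in> N"
proof -
  have "res x (g \<cdot> h \<cdot> \<iota> (h \<cdot> g)) \<in> translation_group (block x)" if x: "x \<in> carrier Q" for x
    using simple_homogeneous.qaut_commutator_P[OF block_simple[OF x] res_qaut[OF g x] res_qaut[OF h x]]
    by (simp add: res_mult res_inv Ker_mult Ker_inv g h x)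
  then show ?thesis using g h Ker_mult Ker_inv by (simp add: N_def)
qed

text \<open>On the class of \<open>x\<close>, the stabilizer of \<open>x\<close> in the automorphism group has no \<open>p\<close>-torsion.\<close>

lemma Ker_pow_p_moves:
  assumes g: "g \<in> Ker" and x: "x \<in> carrier Q" "g x = x" and y: "(x, y) \<in> r" "g y \<noteq> y"
  shows "(g [^]\<^bsub>A\<^esub> p) y \<noteq> y"
proof
  assume e: "(g [^]\<^bsub>A\<^esub> p) y = y"
  interpret B: simple_homogeneous "block x" p m by (rule block_simple[OF x(1)])
  have xx: "(x, x) \<in> r" by (rule r_refl[OF x(1)])
  have gq: "res x g \<in> qaut (block x)" by (rule res_qaut[OF g x(1)])
  have gpK: "g [^]\<^bsub>A\<^esub> p \<in> Ker"
    using Sym.subgroup_int_pow_closed[OF subgroup_Ker g, of "int p"] by (simp add: int_pow_int)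
  have "res x (g [^]\<^bsub>A\<^esub> p) = \<one>\<^bsub>B.A\<^esub>"
  proof (rule B.qaut_rigid[OF res_qaut[OF gpK x(1)], of x y])
    show "res x (g [^]\<^bsub>A\<^esub> p) x = x" using Bij_pow_fixed[OF Ker_Bij[OF g] x] xx by (simp add: res_apply)
  qed (use xx y x e in \<open>auto simp: res_apply\<close>)
  then have "res x g [^]\<^bsub>B.A\<^esub> p = \<one>\<^bsub>B.A\<^esub>" by (simp add: res_pow g x)
  then have "res x g = \<one>\<^bsub>B.A\<^esub>" using B.stabilizer_p_torsion_free[OF gq, of x] xx x by (simp add: res_apply)
  then have "g y = y" using res_eq_one[OF x(1) _ y(1)] by simp
  then show False using y by simp
qed

end

section \<open>Fixed points of elements outside the translations\<close>

context lss_quandle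
begin

lemma Ker_pow: "g \<in> Ker \<Longrightarrow> g [^]\<^bsub>A\<^esub> (k::nat) \<in> Ker"
  using Sym.subgroup_int_pow_closed[OF subgroup_Ker, of g "int k"] by (simp add: int_pow_int)

text \<open>Let \<open>F\<close> be the set of fixed points of \<open>g\<^sup>p\<close>. On a class where \<open>g\<close> has no fixed point it is a translation and
\<open>g\<^sup>p\<close> is trivial; so \<open>F\<close> meets every class. As \<open>g\<^sup>p\<close> is not trivial, \<open>F\<close> is a proper subquandle, and by
strict simplicity it has at most one point in each class, since it is not contained in a single class.
In particular \<open>g\<^sup>p\<close> is trivial on no class, so \<open>g\<close> does have a fixed point in every class.\<close>

lemma fixed_points_section:
  assumes g: "g \<in> Ker" "g \<notin> N"
  shows fixed_points_meet_classes: "\<And>x. x \<in> carrier Q \<Longrightarrow> \<exists>y. (x, y) \<in> r \<and> g y = y"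
    and fixed_points_unique: "\<And>y z. (y, z) \<in> r \<Longrightarrow> g y = y \<Longrightarrow> g z = z \<Longrightarrow> y = z"
proof -
  obtain x0 y0 where x0: "x0 \<in> carrier Q" "g x0 = x0" and y0: "(x0, y0) \<in> r" "g y0 \<noteq> y0"
    using Ker_not_N[OF g] by blast
  let ?h = "g [^]\<^bsub>A\<^esub> p"
  let ?F = "{x \<in> carrier Q. ?h x = x}"
  have hK: "?h \<in> Ker" by (rule Ker_pow[OF g(1)])
  have y0F: "?h y0 \<noteq> y0" by (rule Ker_pow_p_moves[OF g(1) x0 y0])
  have fixh: "?h y = y" if "y \<in> carrier Q" "g y = y" for y by (rule Bij_pow_fixed[OF Ker_Bij[OF g(1)] that])
  have triv: "?h y = y" if x: "x \<in> carrier Q" and fpf: "\<And>y. (x, y) \<in> r \<Longrightarrow> g y \<noteq> y" and y: "(x, y) \<in> r" for x y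
  proof (rule res_eq_one[OF x _ y])
    show "res x ?h = \<one>\<^bsub>BijGroup (r `` {x})\<^esub>"
      using simple_homogeneous.P_pow_p[OF block_simple[OF x] res_translation_if_fixed_point_free[OF g(1) x fpf]]
      by (simp add: res_pow[OF g(1) x])
  qed
  have meet: "\<exists>y. (x, y) \<in> r \<and> ?h y = y" if x: "x \<in> carrier Q" for x
  proof (cases "\<exists>y. (x, y) \<in> r \<and> g y = y")
    case True then show ?thesis using fixh r_carrier by blast
  next
    case False then show ?thesis using triv[OF x] r_refl[OF x] by blast
  qed
  have F: "subquandle Q ?F" by (rule subquandle_fixed_points[OF Ker_qaut[OF hK]])
  have Fne: "?F \<noteq> carrier Q" using y0F r_carrier[OF y0(1)] by blast
  have uniq: "y = z" if yz: "(y, z) \<in> r" "?h y = y" "?h z = z" for y z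
  proof (rule ccontr)
    assume ne: "y \<noteq> z"
    have c: "y \<in> carrier Q" "z \<in> carrier Q" using r_carrier[OF yz(1)] by auto
    have "?F \<inter> r `` {y} = ?F"
      by (rule proper_subquandle_minimal[OF F Fne subquandle_Int[OF F subquandle_class[OF c(1)]] _ _ _ ne])
         (use c yz r_refl in auto)
    then have sub: "?F \<subseteq> r `` {y}" by blast
    obtain w where w: "w \<in> carrier Q" "(y, w) \<notin> r" using other_class[OF c(1)] by blast
    obtain v where v: "(w, v) \<in> r" "?h v = v" using meet[OF w(1)] by blast
    have "v \<in> ?F" using v r_carrier[OF v(1)] by simp
    then have "(y, v) \<in> r" using sub by blast
    then have "(y, w) \<in> r" by (rule r_trans[OF _ r_sym[OF v(1)]])
    then show False using w by simp
  qed
  show "\<exists>y. (x, y) \<in> r \<and> g y = y" if x: "x \<in> carrier Q" for x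
  proof (rule ccontr)
    assume none: "\<nexists>y. (x, y) \<in> r \<and> g y = y"
    obtain y where y: "(x, y) \<in> r" "y \<noteq> x" using class_nontrivial[OF x] by blast
    have "?h y = y" "?h x = x" using triv[OF x] none y r_refl[OF x] by blast+
    then show False using uniq[OF y(1)] y by simp
  qed
  show "y = z" if "(y, z) \<in> r" "g y = y" "g z = z" for y z
    using uniq[OF that(1)] fixh that r_carrier[OF that(1)] by simp
qed

text \<open>By \<open>fixed_points_section\<close> the points \<open>t\<close> and \<open>x\<close> lie in one orbit of \<open>N\<close>: if \<open>g\<close> in \<open>Ker\<close> maps \<open>t\<close> to \<open>x\<close> and
is not in \<open>N\<close>, take a fixed point \<open>s\<close> of \<open>g\<close> in the class and \<open>k\<close> in \<open>Ker\<close> with \<open>k s = t\<close>; then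
\<open>x = g (k s) = w (k (g s)) = w t\<close> with the commutator \<open>w\<close> of \<open>g\<close> and \<open>k\<close>, which is in \<open>N\<close>. And if \<open>v\<close> is in \<open>N\<close>,
then \<open>L (v s) (L s)\<^sup>-\<^sup>1\<close> is the product of \<open>v\<close> and a conjugate of its inverse.\<close>

lemma left_mult_quotient_N:
  assumes xt: "(t, x) \<in> r" shows "L x \<cdot> \<iota> L t \<in> N"
proof -
  have t: "t \<in> carrier Q" and x: "x \<in> carrier Q" using r_carrier[OF xt] by auto
  obtain g where g: "g \<in> Ker" "g t = x" using Ker_transitive[OF xt] by blast
  have LB: "L a \<in> Bij (carrier Q)" if "a \<in> carrier Q" for a by (rule left_mult_Bij[OF that])
  have gB: "g \<in> Bij (carrier Q)" by (rule Ker_Bij[OF g(1)])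
  \<comment> \<open>the case in which an element of \<open>N\<close> moves one point to the other\<close>
  have comm: "L (v s) \<cdot> \<iota> L s \<in> N" if v: "v \<in> N" and s: "s \<in> carrier Q" for v s
  proof -
    have vB: "v \<in> Bij (carrier Q)" by (rule Ker_Bij[OF N_Ker[OF v]])
    have "L (v s) \<cdot> \<iota> L s = v \<cdot> (L s \<cdot> \<iota> v \<cdot> \<iota> L s)"
      using qaut_conj_left_mult[OF Ker_qaut[OF N_Ker[OF v]] s, symmetric] vB LB[OF s] by (simp add: Sym.m_assoc)
    then show ?thesis using N_mult[OF v N_conj_left_mult[OF s N_inv[OF v]]] by simp
  qed
  show ?thesis
  proof (cases "g \<in> N")
    case True then show ?thesis using comm[OF True t] g by simp
  next
    case False
    obtain s where s: "(t, s) \<in> r" "g s = s" using fixed_points_meet_classes[OF g(1) False t] by blast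
    have sc: "s \<in> carrier Q" using r_carrier[OF s(1)] by simp
    obtain k where k: "k \<in> Ker" "k s = t" using Ker_transitive[OF r_sym[OF s(1)]] by blast
    have kB: "k \<in> Bij (carrier Q)" and kq: "k \<in> qaut Q" by (rule Ker_Bij[OF k(1)], rule Ker_qaut[OF k(1)])
    define w where "w = g \<cdot> k \<cdot> \<iota> (k \<cdot> g)"
    have w: "w \<in> N" unfolding w_def by (rule Ker_commutator_N[OF g(1) k(1)])
    have gq: "g \<in> qaut Q" by (rule Ker_qaut[OF g(1)])
    \<comment> \<open>\<open>x = g k s = w k g s = w t\<close>\<close>
    have kgq: "k \<cdot> g \<in> qaut Q" "g \<cdot> k \<in> qaut Q" using qaut_mult kq gq by auto
    have "(k \<cdot> g) s = t" using k s sc qaut_mult_apply[OF kq gq sc] by simp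
    then have "w t = (w \<cdot> (k \<cdot> g)) s"
      using qaut_mult_apply[OF Ker_qaut[OF N_Ker[OF w]] kgq(1) sc] by simp
    also have "w \<cdot> (k \<cdot> g) = g \<cdot> k" unfolding w_def using gB kB by (simp add: Sym.m_assoc)
    also have "(g \<cdot> k) s = x" using k g sc qaut_mult_apply[OF gq kq sc] by simp
    finally show ?thesis using comm[OF w t] by simp
  qed
qed

lemma conj_funpow:
  assumes c: "c \<in> Bij (carrier Q)" and v: "v \<in> Bij (carrier Q)"
  shows "((\<lambda>v. c \<cdot> v \<cdot> \<iota> c) ^^ i) v = c [^]\<^bsub>A\<^esub> i \<cdot> v \<cdot> \<iota> (c [^]\<^bsub>A\<^esub> i)"
proof (induction i)
  case 0 show ?case using v by simp
next
  case (Suc i)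
  have "c [^]\<^bsub>A\<^esub> Suc i = c \<cdot> c [^]\<^bsub>A\<^esub> i" using c Sym.nat_pow_Suc2[of c "carrier Q" i] by simp
  then show ?case using c v Suc by (simp add: Sym.m_assoc Sym.inv_mult_group)
qed

end

section \<open>The complement\<close>

locale lss_section = lss_quandle Q r p q m n for Q :: "'a magma" (structure) and r p q m n +
  fixes h :: "'a \<Rightarrow> 'a" and s :: 'a
  assumes h: "h \<in> Ker" "h \<notin> N" and s: "s \<in> carrier Q" "h s = s"
begin

definition S where "S = {x \<in> carrier Q. h x = x}"

text \<open>The displacement group of the subquandle \<open>S\<close>, but acting on all of \<open>Q\<close>.\<close>

definition K where "K = generate A {L a \<cdot> \<iota> L b | a b. a \<in> S \<and> b \<in> S}"

lemma S_carrier: "x \<in> S \<Longrightarrow> x \<in> carrier Q" and S_fixed: "x \<in> S \<Longrightarrow> h x = x" and s_S: "s \<in> S"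
  using s by (simp_all add: S_def)

lemma S_unique: "x \<in> S \<Longrightarrow> y \<in> S \<Longrightarrow> (x, y) \<in> r \<Longrightarrow> x = y"
  using fixed_points_unique[OF h] by (simp add: S_def)

lemma S_meets: assumes "x \<in> carrier Q" obtains y where "y \<in> S" "(x, y) \<in> r"
  using fixed_points_meet_classes[OF h assms] r_carrier by (auto simp: S_def)

lemma subquandle_S: "subquandle Q S"
  unfolding S_def by (rule subquandle_fixed_points[OF Ker_qaut[OF h(1)]])

lemma S_neq: "S \<noteq> carrier Q"
proof
  assume e: "S = carrier Q"
  obtain y where "(s, y) \<in> r" "y \<noteq> s" using class_nontrivial[OF s(1)] by blast
  then show False using S_unique[OF s_S, of y] r_carrier e by blast
qed

lemma K_gen_Bij: "{L a \<cdot> \<iota> L b | a b. a \<in> S \<and> b \<in> S} \<subseteq> carrier A"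
  using displacement_closed S_carrier by auto

lemma subgroup_K: "subgroup K A"
  unfolding K_def by (rule Sym.generate_is_subgroup[OF K_gen_Bij])

lemma K_subset: "subgroup H A \<Longrightarrow> (\<And>a b. a \<in> S \<Longrightarrow> b \<in> S \<Longrightarrow> L a \<cdot> \<iota> L b \<in> H) \<Longrightarrow> K \<subseteq> H"
  unfolding K_def by (rule Sym.generate_subgroup_incl) auto

lemma displacement_in_K: "a \<in> S \<Longrightarrow> b \<in> S \<Longrightarrow> L a \<cdot> \<iota> L b \<in> K"
  unfolding K_def by (rule generate.incl) blast

lemma K_subset_D: "K \<subseteq> D"
  by (rule K_subset[OF subgroup_D]) (intro displacement_in_D S_carrier)

lemma K_D: "k \<in> K \<Longrightarrow> k \<in> D"
  using K_subset_D by (rule subsetD)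

lemma K_Bij: "k \<in> K \<Longrightarrow> k \<in> Bij (carrier Q)"
  by (rule D_Bij[OF K_D])

lemma K_qaut: "k \<in> K \<Longrightarrow> k \<in> qaut Q"
  by (rule D_qaut[OF K_D])

lemma K_mult: "g \<in> K \<Longrightarrow> k \<in> K \<Longrightarrow> g \<cdot> k \<in> K"
  by (rule subgroup.m_closed[OF subgroup_K])

lemma K_inv: "g \<in> K \<Longrightarrow> \<iota> g \<in> K"
  by (rule subgroup.m_inv_closed[OF subgroup_K])

text \<open>An automorphism commutes with \<open>L a\<close> if it fixes \<open>a\<close>.\<close>

lemma K_commutes:
  assumes z: "z \<in> qaut Q" and zS: "\<And>x. x \<in> S \<Longrightarrow> z x = x" and k: "k \<in> K"
  shows "k \<cdot> z = z \<cdot> k"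
proof -
  have zB: "z \<in> Bij (carrier Q)" by (rule qaut_Bij[OF z])
  have "K \<subseteq> {k \<in> Bij (carrier Q). k \<cdot> z = z \<cdot> k}"
  proof (rule K_subset)
    show "subgroup {k \<in> Bij (carrier Q). k \<cdot> z = z \<cdot> k} A"
      using Sym.subgroup_centralizer_in[OF Sym.subgroup_self, of z "carrier Q"] zB by simp
    fix a b assume a: "a \<in> S" and b: "b \<in> S"
    have B: "L a \<in> Bij (carrier Q)" "L b \<in> Bij (carrier Q)" using left_mult_Bij S_carrier a b by auto
    have za: "z \<cdot> L a = L a \<cdot> z" using qaut_left_mult_comm[OF z S_carrier[OF a]] zS[OF a] by simp
    have zb: "z \<cdot> L b = L b \<cdot> z" using qaut_left_mult_comm[OF z S_carrier[OF b]] zS[OF b] by simp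
    have "\<iota> L b \<cdot> z = \<iota> L b \<cdot> (z \<cdot> L b) \<cdot> \<iota> L b" using B zB by (simp add: Sym.m_assoc)
    also have "\<dots> = (\<iota> L b \<cdot> L b) \<cdot> z \<cdot> \<iota> L b"
      unfolding zb using B zB by (simp only: Sym.m_assoc carrier_BijGroup Bij_inv_closed Bij_mult_closed)
    also have "\<dots> = z \<cdot> \<iota> L b" using B zB by simp
    finally have zb': "\<iota> L b \<cdot> z = z \<cdot> \<iota> L b" .
    have "L a \<cdot> \<iota> L b \<cdot> z = L a \<cdot> (z \<cdot> \<iota> L b)" using B zB zb' by (simp add: Sym.m_assoc)
    also have "\<dots> = (z \<cdot> L a) \<cdot> \<iota> L b" unfolding za using B zB by (simp add: Sym.m_assoc)
    finally have "L a \<cdot> \<iota> L b \<cdot> z = z \<cdot> (L a \<cdot> \<iota> L b)" using B zB by (simp add: Sym.m_assoc)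
    then show "L a \<cdot> \<iota> L b \<in> {k \<in> Bij (carrier Q). k \<cdot> z = z \<cdot> k}" using B by simp
  qed
  then show ?thesis using k by blast
qed

text \<open>The elements of \<open>K\<close> commute with \<open>h\<close>.\<close>

lemma K_S: assumes k: "k \<in> K" and x: "x \<in> S" shows "k x \<in> S"
proof -
  have "h (k x) = k (h x)"
    using fun_cong[OF K_commutes[OF Ker_qaut[OF h(1)] S_fixed k], of x]
      qaut_mult_apply[OF K_qaut[OF k] Ker_qaut[OF h(1)] S_carrier[OF x]]
      qaut_mult_apply[OF Ker_qaut[OF h(1)] K_qaut[OF k] S_carrier[OF x]] by simp
  then show ?thesis using qaut_closed[OF K_qaut[OF k] S_carrier[OF x]] S_fixed[OF x] by (simp add: S_def)
qed

lemma K_Ker_fixes_S: assumes k: "k \<in> K" "k \<in> Ker" and x: "x \<in> S" shows "k x = x"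
  using S_unique[OF x K_S[OF k(1) x] Ker_r[OF k(2) S_carrier[OF x]]] by simp

lemma N_fixing_S: assumes v: "v \<in> N" and fixS: "\<And>x. x \<in> S \<Longrightarrow> v x = x" shows "v = id\<^sub>Q"
proof (rule Bij_eqI[OF Ker_Bij[OF N_Ker[OF v]]])
  fix y assume y: "y \<in> carrier Q"
  obtain x where x: "x \<in> S" "(y, x) \<in> r" using S_meets[OF y] .
  show "v y = id\<^sub>Q y" using N_fixed[OF v S_carrier[OF x(1)] fixS[OF x(1)] r_sym[OF x(2)]] y by (simp add: Bij_one_apply)
qed simp

lemma N_Int_K: "N \<inter> K = {id\<^sub>Q}"
proof
  show "N \<inter> K \<subseteq> {id\<^sub>Q}" using N_fixing_S K_Ker_fixes_S N_Ker by blast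
  show "{id\<^sub>Q} \<subseteq> N \<inter> K" using subgroup.one_closed[OF subgroup_N] subgroup.one_closed[OF subgroup_K] by simp
qed

text \<open>Modulo \<open>N\<close> each \<open>L x\<close> agrees with \<open>L a\<close> for the point \<open>a\<close> of \<open>S\<close> in the class of \<open>x\<close>.\<close>

lemma D_factorization: assumes g: "g \<in> D" shows "\<exists>v\<in>N. \<exists>k\<in>K. g = v \<cdot> k"
proof -
  let ?H = "{g. \<exists>v\<in>N. \<exists>k\<in>K. g = v \<cdot> k}"
  have NB: "v \<in> Bij (carrier Q)" if "v \<in> N" for v by (rule Ker_Bij[OF N_Ker[OF that]])
  have HI: "v \<cdot> k \<in> ?H" if "v \<in> N" "k \<in> K" for v k using that by blast
  have H: "subgroup ?H A"
  proof (rule Sym.subgroupI)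
    show "?H \<subseteq> carrier A" using NB K_Bij by auto
    show "?H \<noteq> {}" using HI[OF subgroup.one_closed[OF subgroup_N] subgroup.one_closed[OF subgroup_K]] by blast
    fix g assume "g \<in> ?H"
    then obtain v k where g: "v \<in> N" "k \<in> K" "g = v \<cdot> k" by blast
    have B: "v \<in> Bij (carrier Q)" "k \<in> Bij (carrier Q)" using NB K_Bij g by auto
    have "\<iota> k \<cdot> \<iota> v \<cdot> \<iota> (\<iota> k) \<cdot> \<iota> k \<in> ?H"
      by (rule HI[OF N_conj_D[OF K_D[OF K_inv[OF g(2)]] N_inv[OF g(1)]] K_inv[OF g(2)]])
    then show "\<iota> g \<in> ?H" using B g(3) by (simp add: Sym.inv_mult_group Sym.m_assoc)
  next
    fix g1 g2 assume "g1 \<in> ?H" "g2 \<in> ?H"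
    then obtain v k w l where g: "v \<in> N" "k \<in> K" "g1 = v \<cdot> k" "w \<in> N" "l \<in> K" "g2 = w \<cdot> l" by blast
    have B: "v \<in> Bij (carrier Q)" "k \<in> Bij (carrier Q)" "w \<in> Bij (carrier Q)" "l \<in> Bij (carrier Q)" using NB K_Bij g by auto
    have c: "\<iota> k \<cdot> (k \<cdot> l) = l" using B by (simp flip: Sym.m_assoc)
    have "v \<cdot> (k \<cdot> w \<cdot> \<iota> k) \<cdot> (k \<cdot> l) \<in> ?H"
      by (rule HI[OF N_mult[OF g(1) N_conj_D[OF K_D[OF g(2)] g(4)]] K_mult[OF g(2,5)]])
    then show "g1 \<cdot> g2 \<in> ?H" using B g(3,6) c by (simp add: Sym.m_assoc)
  qed
  have "L x \<cdot> \<iota> L y \<in> ?H" if x: "x \<in> carrier Q" and y: "y \<in> carrier Q" for x y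
  proof -
    obtain a where a: "a \<in> S" "(x, a) \<in> r" using S_meets[OF x] .
    obtain b where b: "b \<in> S" "(y, b) \<in> r" using S_meets[OF y] .
    let ?v = "L x \<cdot> \<iota> L a" and ?w = "L y \<cdot> \<iota> L b" and ?k = "L a \<cdot> \<iota> L b"
    have v: "?v \<in> N" by (rule left_mult_quotient_N[OF r_sym[OF a(2)]])
    have w: "?w \<in> N" by (rule left_mult_quotient_N[OF r_sym[OF b(2)]])
    have k: "?k \<in> K" by (rule displacement_in_K[OF a(1) b(1)])
    have B: "L x \<in> Bij (carrier Q)" "L y \<in> Bij (carrier Q)" "L a \<in> Bij (carrier Q)" "L b \<in> Bij (carrier Q)"
      using left_mult_Bij x y S_carrier a b by auto
    have c: "\<iota> l \<cdot> (l \<cdot> z) = z" if "l \<in> Bij (carrier Q)" "z \<in> Bij (carrier Q)" for l z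
      using that by (simp flip: Sym.m_assoc)
    have "?v \<cdot> (?k \<cdot> \<iota> ?w \<cdot> \<iota> ?k) \<cdot> ?k \<in> ?H"
      by (rule HI[OF N_mult[OF v N_conj_D[OF K_D[OF k] N_inv[OF w]]] k])
    moreover have "?v \<cdot> (?k \<cdot> \<iota> ?w \<cdot> \<iota> ?k) \<cdot> ?k = L x \<cdot> \<iota> L y"
      using B by (simp add: Sym.m_assoc Sym.inv_mult_group c)
    ultimately show ?thesis by simp
  qed
  then show ?thesis using D_subset[OF H] g by blast
qed

text \<open>This is the modular law for \<open>D = N K\<close>.\<close>

lemma Ker_factorization: assumes g: "g \<in> Ker" shows "\<exists>v\<in>N. \<exists>k\<in>K \<inter> Ker. g = v \<cdot> k"
proof -
  obtain v k where vk: "v \<in> N" "k \<in> K" "g = v \<cdot> k" using D_factorization[OF Ker_D[OF g]] by blast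
  have "\<iota> v \<cdot> g = k" using vk K_Bij[OF vk(2)] Ker_Bij[OF N_Ker[OF vk(1)]] by (simp flip: Sym.m_assoc)
  then have "k \<in> Ker" using Ker_mult[OF Ker_inv[OF N_Ker[OF vk(1)]] g] by simp
  then show ?thesis using vk by blast
qed

lemma N_transitive: assumes sx: "(s, x) \<in> r" shows "\<exists>v\<in>N. v s = x"
proof -
  obtain g where g: "g \<in> Ker" "g s = x" using Ker_transitive[OF sx] by blast
  obtain v k where vk: "v \<in> N" "k \<in> K \<inter> Ker" "g = v \<cdot> k" using Ker_factorization[OF g(1)] by blast
  have "g s = v (k s)" using qaut_mult_apply[OF Ker_qaut[OF N_Ker[OF vk(1)]] K_qaut s(1), of k] vk by simp
  then have "v s = x" using K_Ker_fixes_S[of k s] vk s_S g by simp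
  then show ?thesis using vk(1) by blast
qed

lemma K_transitive: assumes x: "x \<in> S" shows "\<exists>k\<in>K. k s = x"
proof -
  obtain g where g: "g \<in> D" "g s = x" using transitive[OF s(1) S_carrier[OF x]] by blast
  obtain v k where vk: "v \<in> N" "k \<in> K" "g = v \<cdot> k" using D_factorization[OF g(1)] by blast
  have ks: "k s \<in> S" by (rule K_S[OF vk(2) s_S])
  have "x = v (k s)" using g vk qaut_mult_apply[OF Ker_qaut[OF N_Ker[OF vk(1)]] K_qaut[OF vk(2)] s(1)] by simp
  then have "(k s, x) \<in> r" using Ker_r[OF N_Ker[OF vk(1)] S_carrier[OF ks]] by simp
  then have "k s = x" by (rule S_unique[OF ks x])
  then show ?thesis using vk(2) by blast
qed

lemma h_K: "h \<in> K"
proof -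
  obtain v k where vk: "v \<in> N" "k \<in> K \<inter> Ker" "h = v \<cdot> k" using Ker_factorization[OF h(1)] by blast
  have B: "v \<in> Bij (carrier Q)" "k \<in> Bij (carrier Q)" using Ker_Bij N_Ker vk by auto
  have "v = id\<^sub>Q"
  proof (rule N_fixing_S[OF vk(1)])
    fix x assume x: "x \<in> S"
    have "h x = v (k x)" unfolding vk(3) by (rule Bij_mult_apply[OF B S_carrier[OF x]])
    then show "v x = x" using S_fixed[OF x] K_Ker_fixes_S[of k x] vk x by simp
  qed
  then show ?thesis using vk B by simp
qed

lemma K_Int_Ker_fixed_points:
  assumes c: "c \<in> K" "c \<in> Ker" "c \<noteq> id\<^sub>Q" and x: "x \<in> carrier Q" "c x = x" shows "x \<in> S"
proof -
  have cN: "c \<notin> N" using N_Int_K c by blast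
  obtain y where y: "y \<in> S" "(x, y) \<in> r" using S_meets[OF x(1)] .
  have "x = y" by (rule fixed_points_unique[OF c(2) cN y(2) x(2) K_Ker_fixes_S[OF c(1,2) y(1)]])
  then show ?thesis using y by simp
qed

text \<open>An element of \<open>N\<close> that commutes with \<open>c\<close> preserves the set of fixed points of \<open>c\<close>, which is \<open>S\<close>; as it also
preserves the classes, it fixes \<open>S\<close> pointwise.\<close>

lemma commuting_N_trivial:
  assumes c: "c \<in> K" "c \<in> Ker" "c \<noteq> id\<^sub>Q" and v: "v \<in> N" and cv: "c \<cdot> v \<cdot> \<iota> c = v"
  shows "v = id\<^sub>Q"
proof (rule N_fixing_S[OF v])
  fix x assume x: "x \<in> S"
  have vx: "v x \<in> carrier Q" by (rule qaut_closed[OF Ker_qaut[OF N_Ker[OF v]] S_carrier[OF x]])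
  have "c (v x) = v x"
    using conj_apply[OF K_qaut[OF c(1)] Ker_qaut[OF N_Ker[OF v]] S_carrier[OF x]] cv K_Ker_fixes_S[OF c(1,2) x] by simp
  then have "v x \<in> S" by (rule K_Int_Ker_fixed_points[OF c vx])
  then show "v x = x" using S_unique[OF x _ Ker_r[OF N_Ker[OF v] S_carrier[OF x]]] by simp
qed

lemma K_Int_Ker_p_torsion_free:
  assumes c: "c \<in> K" "c \<in> Ker" "c \<noteq> id\<^sub>Q" shows "c [^]\<^bsub>A\<^esub> p \<noteq> id\<^sub>Q"
proof
  assume e: "c [^]\<^bsub>A\<^esub> p = id\<^sub>Q"
  obtain y where y: "(s, y) \<in> r" "y \<noteq> s" using class_nontrivial[OF s(1)] by blast
  have yc: "y \<in> carrier Q" using r_carrier[OF y(1)] by simp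
  have "c y \<noteq> y" using K_Int_Ker_fixed_points[OF c yc] S_unique[OF s_S _ y(1)] y by blast
  then have "(c [^]\<^bsub>A\<^esub> p) y \<noteq> y"
    by (rule Ker_pow_p_moves[OF c(2) s(1) K_Ker_fixes_S[OF c(1,2) s_S] y(1)])
  then show False using e yc by (simp add: Bij_one_apply)
qed

lemma N_nontrivial: "\<exists>v\<in>N. v \<noteq> id\<^sub>Q"
proof -
  obtain y where y: "(s, y) \<in> r" "y \<noteq> s" using class_nontrivial[OF s(1)] by blast
  obtain v where v: "v \<in> N" "v s = y" using N_transitive[OF y(1)] by blast
  then have "v \<noteq> id\<^sub>Q" using y s by (auto simp: Bij_one_apply)
  then show ?thesis using v by blast
qed

end

section \<open>The complement is extraspecial\<close>

context lss_section
begin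

abbreviation "KG \<equiv> A\<lparr>carrier := K\<rparr>"

lemma group_KG: "group KG"
  by (rule subgroup.subgroup_is_group[OF subgroup_K group_BijGroup])

lemma inv_KG: "x \<in> K \<Longrightarrow> inv\<^bsub>KG\<^esub> x = \<iota> x"
  by (rule Sym.m_inv_consistent[OF subgroup_K])

lemma pow_KG: "x [^]\<^bsub>KG\<^esub> (k::nat) = x [^]\<^bsub>A\<^esub> k"
  by (simp flip: Sym.nat_pow_consistent)

lemma K_pow: "x \<in> K \<Longrightarrow> x [^]\<^bsub>A\<^esub> (k::nat) \<in> K"
  using Sym.subgroup_int_pow_closed[OF subgroup_K, of x "int k"] by (simp add: int_pow_int)

text \<open>Conjugation by \<open>c\<close> and \<open>d\<close> gives commuting automorphisms of \<open>N\<close> of order dividing \<open>q\<close>. If \<open>c\<close> is not a power of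
\<open>d\<close>, then none of the products involved is trivial, so they have no fixed points and all elements of \<open>N\<close>
have order dividing \<open>q\<close>. But \<open>N\<close> is a nontrivial group of exponent \<open>p\<close>, and \<open>p\<close> differs from \<open>q\<close>.\<close>

lemma K_Int_Ker_cyclic:
  assumes c: "c \<in> K" "c \<in> Ker" "c [^]\<^bsub>A\<^esub> q = id\<^sub>Q"
    and d: "d \<in> K" "d \<in> Ker" "d \<noteq> id\<^sub>Q" "d [^]\<^bsub>A\<^esub> q = id\<^sub>Q"
  shows "\<exists>j::nat. c = d [^]\<^bsub>A\<^esub> j"
proof (rule ccontr)
  assume none: "\<nexists>j::nat. c = d [^]\<^bsub>A\<^esub> j"
  let ?NG = "A\<lparr>carrier := N\<rparr>"
  have NGg: "group ?NG" by (rule subgroup.subgroup_is_group[OF subgroup_N group_BijGroup])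
  interpret NG: comm_group ?NG by (rule group.group_comm_groupI[OF NGg]) (simp add: N_comm)
  have NB: "v \<in> Bij (carrier Q)" if "v \<in> N" for v by (rule Ker_Bij[OF N_Ker[OF that]])
  have B: "c \<in> Bij (carrier Q)" "d \<in> Bij (carrier Q)" using K_Bij c d by auto
  define cj where "cj e v = e \<cdot> v \<cdot> \<iota> e" for e v
  have cjN: "cj e v \<in> N" if "e \<in> K" "v \<in> N" for e v
    unfolding cj_def by (rule N_conj_D[OF K_D[OF that(1)] that(2)])
  have cjcj: "cj e (cj f v) = cj (e \<cdot> f) v" if "e \<in> Bij (carrier Q)" "f \<in> Bij (carrier Q)" "v \<in> Bij (carrier Q)" for e f v
    using that by (simp add: cj_def Sym.inv_mult_group Sym.m_assoc)
  have cjhom: "cj e \<in> hom ?NG ?NG" if e: "e \<in> K" for e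
  proof (rule homI)
    show "cj e v \<in> carrier ?NG" if "v \<in> carrier ?NG" for v using cjN[OF e] that by simp
    show "cj e (v \<otimes>\<^bsub>?NG\<^esub> w) = cj e v \<otimes>\<^bsub>?NG\<^esub> cj e w" if vw: "v \<in> carrier ?NG" "w \<in> carrier ?NG" for v w
    proof -
      have b: "e \<in> Bij (carrier Q)" "v \<in> Bij (carrier Q)" "w \<in> Bij (carrier Q)" using K_Bij e NB vw by auto
      have "\<iota> e \<cdot> (e \<cdot> (w \<cdot> \<iota> e)) = w \<cdot> \<iota> e" using b by (simp flip: Sym.m_assoc)
      then show ?thesis using b by (simp add: cj_def Sym.m_assoc)
    qed
  qed
  have pw: "(cj e ^^ i) v = cj (e [^]\<^bsub>A\<^esub> i) v" if "e \<in> Bij (carrier Q)" "v \<in> Bij (carrier Q)" for e i v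
    using conj_funpow[OF that, of i] by (simp add: cj_def[abs_def])
  have triv: "v = id\<^sub>Q" if "e \<in> K" "e \<in> Ker" "e \<noteq> id\<^sub>Q" "v \<in> N" "cj e v = v" for e v
    using commuting_N_trivial[OF that(1-4)] that(5) by (simp add: cj_def)
  have cd: "d \<cdot> c = c \<cdot> d" by (rule K_commutes[OF K_qaut[OF c(1)] K_Ker_fixes_S[OF c(1,2)] d(1)])
  have ordd: "Sym.ord (carrier Q) d = q" by (rule Sym.ord_eq_prime) (use B d q in auto)
  have vq: "v [^]\<^bsub>?NG\<^esub> q = \<one>\<^bsub>?NG\<^esub>" if v: "v \<in> carrier ?NG" for v
  proof (rule NG.pow_eq_one_if_fixed_point_free_rank_two[OF cjhom[OF c(1)] cjhom[OF d(1)] _ _ _ _ _ v])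
    show "cj c (cj d x) = cj d (cj c x)" if "x \<in> carrier ?NG" for x
      using that NB B by (simp add: cjcj cd)
    show "(cj c ^^ q) x = x" if "x \<in> carrier ?NG" for x
      using that NB B c by (simp add: pw cj_def)
    show "(cj d ^^ q) x = x" if "x \<in> carrier ?NG" for x
      using that NB B d by (simp add: pw cj_def)
    show "x = \<one>\<^bsub>?NG\<^esub>" if i: "0 < i" "i < q" and x: "x \<in> carrier ?NG" "(cj d ^^ i) x = x" for i x
    proof -
      have "d [^]\<^bsub>A\<^esub> i \<noteq> id\<^sub>Q"
        using Sym.pow_eq_id[of d "carrier Q" i] B ordd i by (auto dest: dvd_imp_le)
      then show ?thesis using triv[of "d [^]\<^bsub>A\<^esub> i" x] K_pow Ker_pow d x NB B by (simp add: pw)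
    qed
    show "x = \<one>\<^bsub>?NG\<^esub>" if j: "j < q" and x: "x \<in> carrier ?NG" "cj c ((cj d ^^ j) x) = x" for j x
    proof -
      have dj: "d [^]\<^bsub>A\<^esub> j \<in> K" "d [^]\<^bsub>A\<^esub> j \<in> Ker" using K_pow Ker_pow d by auto
      have "c \<cdot> d [^]\<^bsub>A\<^esub> j \<noteq> id\<^sub>Q"
      proof
        assume "c \<cdot> d [^]\<^bsub>A\<^esub> j = id\<^sub>Q"
        moreover have "d [^]\<^bsub>A\<^esub> (q - j) \<cdot> d [^]\<^bsub>A\<^esub> j = id\<^sub>Q"
          using Sym.nat_pow_mult[of d "carrier Q" "q - j" j] B j d by simp
        ultimately have "c \<cdot> d [^]\<^bsub>A\<^esub> j = d [^]\<^bsub>A\<^esub> (q - j) \<cdot> d [^]\<^bsub>A\<^esub> j" by simp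
        then have "c = d [^]\<^bsub>A\<^esub> (q - j)" using B by (simp del: Sym.r_one)
        then show False using none by blast
      qed
      then show ?thesis
        using triv[of "c \<cdot> d [^]\<^bsub>A\<^esub> j" x] K_mult[OF c(1) dj(1)] Ker_mult[OF c(2) dj(2)] x NB B by (simp add: pw cjcj)
    qed
  qed
  obtain v where v: "v \<in> N" "v \<noteq> id\<^sub>Q" using N_nontrivial by blast
  have "v [^]\<^bsub>A\<^esub> q = id\<^sub>Q" using vq[of v] v by (simp flip: Sym.nat_pow_consistent)
  then have "Sym.ord (carrier Q) v = q" by (intro Sym.ord_eq_prime) (use v q NB in auto)
  moreover have "Sym.ord (carrier Q) v = p" by (rule Sym.ord_eq_prime) (use v p NB N_pow_p in auto)
  ultimately show False using K_Int_Ker_p_torsion_free[OF d(1-3)] d(4) by simp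
qed

lemma K_conj_s: assumes k: "k \<in> K" shows "L s \<cdot> k \<cdot> \<iota> L s \<in> K"
  and K_twist: "k \<cdot> \<iota> (L s \<cdot> k \<cdot> \<iota> L s) = L (k s) \<cdot> \<iota> L s"
proof -
  have B: "k \<in> Bij (carrier Q)" "L s \<in> Bij (carrier Q)" using K_Bij[OF k] left_mult_Bij[OF s(1)] by auto
  let ?a = "L s \<cdot> k \<cdot> \<iota> L s"
  have "L (k s) = k \<cdot> L s \<cdot> \<iota> k" using qaut_conj_left_mult[OF K_qaut[OF k] s(1)] by simp
  then show tw: "k \<cdot> \<iota> ?a = L (k s) \<cdot> \<iota> L s"
    using B by (simp add: Sym.m_assoc Sym.inv_mult_group)
  have "\<iota> (\<iota> k \<cdot> (k \<cdot> \<iota> ?a)) = ?a"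
    using B by (simp flip: Sym.m_assoc)
  moreover have "k \<cdot> \<iota> ?a \<in> K" unfolding tw by (rule displacement_in_K[OF K_S[OF k s_S] s_S])
  ultimately show "?a \<in> K" using K_inv[OF K_mult[OF K_inv[OF k]]] by metis
qed

text \<open>The automorphism is conjugation by \<open>L s\<close>. Irreducibility holds because the orbit of \<open>s\<close> under an invariant
subgroup is a subquandle of the strictly simple quandle \<open>S\<close>, and the stabilizer of \<open>s\<close> in \<open>K\<close> is \<open>K \<inter> Ker\<close>.\<close>

lemma K_structure:
  shows card_K_Int_Ker: "card (K \<inter> Ker) = q"
    and center_KG: "group_center KG = K \<inter> Ker"
    and K_Int_Ker_pow: "\<And>z. z \<in> K \<inter> Ker \<Longrightarrow> z [^]\<^bsub>A\<^esub> q = id\<^sub>Q"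
    and K_exponent: "\<And>x. odd q \<Longrightarrow> x \<in> K \<Longrightarrow> x [^]\<^bsub>A\<^esub> q = id\<^sub>Q"
    and K_commutator: "\<And>x y. x \<in> K \<Longrightarrow> y \<in> K \<Longrightarrow> x \<cdot> y \<cdot> \<iota> (y \<cdot> x) \<in> K \<inter> Ker"
    and K_pow_center: "\<And>x. x \<in> K \<Longrightarrow> x [^]\<^bsub>A\<^esub> q \<in> K \<inter> Ker"
    and subgroup_K_Int_Ker: "subgroup (K \<inter> Ker) KG"
proof -
  let ?M = "K \<inter> Ker"
  let ?\<alpha> = "\<lambda>k. L s \<cdot> k \<cdot> \<iota> L s"
  interpret KG: group KG by (rule group_KG)
  have LB: "L s \<in> Bij (carrier Q)" by (rule left_mult_Bij[OF s(1)])
  have fin: "finite (carrier KG)" using Bij_subgroup_finite[OF finite_carrier subgroup_K] by simp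
  have MA: "subgroup ?M A" by (rule Sym.subgroups_Inter_pair[OF subgroup_K subgroup_Ker])
  show M: "subgroup ?M KG" by (rule Sym.subgroup_incl[OF MA subgroup_K]) simp
  show com: "x \<cdot> y \<cdot> \<iota> (y \<cdot> x) \<in> ?M" if "x \<in> K" "y \<in> K" for x y
    using that K_mult K_inv D_commutator_Ker K_D by simp
  show pwM: "x [^]\<^bsub>A\<^esub> q \<in> ?M" if "x \<in> K" for x using that K_pow D_pow_Ker K_D by simp
  have central: "z \<otimes>\<^bsub>KG\<^esub> x = x \<otimes>\<^bsub>KG\<^esub> z" if "z \<in> ?M" "x \<in> carrier KG" for z x
    using K_commutes[of z x] that K_Ker_fixes_S K_qaut by auto
  have \<alpha>K: "?\<alpha> k \<in> K" if "k \<in> K" for k by (rule K_conj_s[OF that])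
  have comm': "x \<otimes>\<^bsub>KG\<^esub> y \<otimes>\<^bsub>KG\<^esub> inv\<^bsub>KG\<^esub> (y \<otimes>\<^bsub>KG\<^esub> x) \<in> ?M" if "x \<in> carrier KG" "y \<in> carrier KG" for x y
    using com[of x y] that K_mult by (simp add: inv_KG)
  have pow': "x [^]\<^bsub>KG\<^esub> q \<in> ?M" if "x \<in> carrier KG" for x using pwM that by (simp add: pow_KG)
  have hom: "?\<alpha> \<in> hom KG KG"
  proof (rule homI)
    show "?\<alpha> x \<in> carrier KG" if "x \<in> carrier KG" for x using that \<alpha>K by simp
    show "?\<alpha> (x \<otimes>\<^bsub>KG\<^esub> y) = ?\<alpha> x \<otimes>\<^bsub>KG\<^esub> ?\<alpha> y" if xy: "x \<in> carrier KG" "y \<in> carrier KG" for x y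
    proof -
      have b: "x \<in> Bij (carrier Q)" "y \<in> Bij (carrier Q)" using K_Bij xy by auto
      have "\<iota> L s \<cdot> (L s \<cdot> (y \<cdot> \<iota> L s)) = y \<cdot> \<iota> L s"
        using b LB by (simp flip: Sym.m_assoc)
      then show ?thesis using b LB by (simp add: Sym.m_assoc)
    qed
  qed
  have surj: "?\<alpha> ` carrier KG = carrier KG"
  proof (rule endo_inj_surj[OF fin])
    show "?\<alpha> ` carrier KG \<subseteq> carrier KG" using \<alpha>K by auto
    show "inj_on ?\<alpha> (carrier KG)"
    proof (rule inj_onI)
      fix x y assume xy: "x \<in> carrier KG" "y \<in> carrier KG" "?\<alpha> x = ?\<alpha> y"
      have b: "x \<in> Bij (carrier Q)" "y \<in> Bij (carrier Q)" using K_Bij xy by auto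
      then show "x = y" using xy(3) LB by simp
    qed
  qed
  have \<alpha>M: "?\<alpha> z = z" if z: "z \<in> ?M" for z
  proof -
    have zB: "z \<in> Bij (carrier Q)" using z K_Bij by simp
    have "z \<cdot> L s = L s \<cdot> z"
      using qaut_left_mult_comm[OF K_qaut s(1), of z] K_Ker_fixes_S[of z s] z s_S by simp
    then have "?\<alpha> z = z \<cdot> L s \<cdot> \<iota> L s" by simp
    then show ?thesis using zB LB by (simp add: Sym.m_assoc)
  qed
  let ?T = "{x \<otimes>\<^bsub>KG\<^esub> inv\<^bsub>KG\<^esub> (?\<alpha> x) | x. x \<in> carrier KG}"
  have T: "L t \<cdot> \<iota> L s \<in> ?T" if t: "t \<in> S" for t
  proof -
    obtain k where k: "k \<in> K" "k s = t" using K_transitive[OF t] by blast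
    have "L t \<cdot> \<iota> L s = k \<otimes>\<^bsub>KG\<^esub> inv\<^bsub>KG\<^esub> (?\<alpha> k)"
      using K_twist[OF k(1)] k by (simp add: inv_KG \<alpha>K)
    then show ?thesis using k by auto
  qed
  have TK: "?T \<subseteq> K" using \<alpha>K K_mult K_inv by (auto simp: inv_KG)
  have gen: "generate KG ?T = carrier KG"
  proof
    show "generate KG ?T \<subseteq> carrier KG" using KG.generate_incl[of ?T] TK by simp
    have sg: "subgroup (generate KG ?T) KG" using KG.generate_is_subgroup[of ?T] TK by simp
    then have sgA: "subgroup (generate KG ?T) A" by (rule Sym.incl_subgroup[OF subgroup_K])
    have "K \<subseteq> generate KG ?T"
    proof (rule K_subset[OF sgA])
      fix a b assume a: "a \<in> S" and b: "b \<in> S"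
      have B: "L a \<in> Bij (carrier Q)" "L b \<in> Bij (carrier Q)" using left_mult_Bij S_carrier a b by auto
      have "(L a \<cdot> \<iota> L s) \<cdot> \<iota> (L b \<cdot> \<iota> L s) \<in> generate KG ?T"
        by (intro subgroup.m_closed[OF sgA] subgroup.m_inv_closed[OF sgA] generate.incl T a b)
      moreover have "\<iota> L s \<cdot> (L s \<cdot> \<iota> L b) = \<iota> L b" using B LB by (simp flip: Sym.m_assoc)
      ultimately show "L a \<cdot> \<iota> L b \<in> generate KG ?T"
        using B LB by (simp add: Sym.inv_mult_group Sym.m_assoc)
    qed
    then show "carrier KG \<subseteq> generate KG ?T" by simp
  qed
  have irr: "W = ?M \<or> W = carrier KG" if W: "subgroup W KG" and MW: "?M \<subseteq> W" and \<alpha>W: "?\<alpha> ` W \<subseteq> W" for W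
  proof -
    have WA: "subgroup W A" by (rule Sym.incl_subgroup[OF subgroup_K W])
    have WK: "W \<subseteq> K" using subgroup.subset[OF W] by simp
    show ?thesis
    proof (cases "\<exists>w\<in>W. w s \<noteq> s")
      case False
      have "w \<in> ?M" if w: "w \<in> W" for w
      proof -
        have "w \<in> K" using w WK by blast
        then show ?thesis using Ker_fixed[OF K_D s(1), of w] w False by blast
      qed
      then show ?thesis using MW by blast
    next
      case True
      then obtain w where w: "w \<in> W" "w s \<noteq> s" by blast
      define T where "T = (\<lambda>w. w s) ` W"
      have TS: "T \<subseteq> S" unfolding T_def using K_S[OF _ s_S] WK by blast
      have "subquandle Q T"
      proof (rule subquandleI)
        show "T \<subseteq> carrier Q" using TS S_carrier by blast
        fix x y assume "x \<in> T" "y \<in> T"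
        then obtain g k where gk: "g \<in> W" "x = g s" "k \<in> W" "y = k s" unfolding T_def by (elim imageE)
        have q: "g \<in> qaut Q" "k \<in> qaut Q" "\<iota> g \<in> qaut Q" "L s \<in> qaut Q" "\<iota> L s \<in> qaut Q"
          using gk WK K_qaut qaut_inv left_mult_qaut[OF s(1)] by auto
        let ?u = "\<iota> g \<cdot> k"
        have u: "?u \<in> W" by (rule subgroup.m_closed[OF WA subgroup.m_inv_closed[OF WA gk(1)] gk(3)])
        have uq: "?u \<in> qaut Q" by (rule qaut_mult[OF q(3,2)])
        have gu: "g \<cdot> ?\<alpha> ?u \<in> W" using subgroup.m_closed[OF WA gk(1), of "?\<alpha> ?u"] \<alpha>W u by blast
        have \<alpha>q: "?\<alpha> ?u \<in> qaut Q" using qaut_mult q uq by simp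
        have ls: "left_div Q s s = s" using s(1) by (intro left_div_eqI) auto
        have us: "?u s = (\<iota> g) (k s)" by (rule qaut_mult_apply[OF q(3,2) s(1)])
        have ks: "k s \<in> carrier Q" "(\<iota> g) (k s) \<in> carrier Q" using qaut_closed q s(1) by auto
        have "?\<alpha> ?u s = s \<rhd> (\<iota> g) (k s)"
          using qaut_mult_apply[OF qaut_mult[OF q(4) uq] q(5) s(1)] qaut_mult_apply[OF q(4) uq s(1)] us ks
          by (simp add: inv_left_mult_apply s(1) ls left_mult_apply)
        then have "(g \<cdot> ?\<alpha> ?u) s = g s \<rhd> k s"
          using qaut_mult_apply[OF q(1) \<alpha>q s(1)] qaut_op[OF q(1) s(1) ks(2)] qaut_apply_inv[OF q(1) ks(1)] by simp
        then have e: "x \<rhd> y = (g \<cdot> ?\<alpha> ?u) s" using gk by simp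
        show "x \<rhd> y \<in> T" unfolding T_def e by (rule imageI[OF gu])
      qed
      moreover have "s \<in> T"
      proof -
        have "s = id\<^sub>Q s" using s(1) by (simp add: Bij_one_apply)
        then show ?thesis unfolding T_def using subgroup.one_closed[OF WA] by (rule image_eqI)
      qed
      moreover have "w s \<in> T" unfolding T_def using w(1) by (rule imageI)
      ultimately have "T = S"
        using proper_subquandle_minimal[OF subquandle_S S_neq _ TS, of s "w s"] w(2) by metis
      have "k \<in> W" if k: "k \<in> K" for k
      proof -
        have "k s \<in> T" using K_S[OF k s_S] \<open>T = S\<close> by simp
        then obtain g where g: "k s = g s" "g \<in> W" unfolding T_def by (rule imageE)
        have gK: "g \<in> K" using g WK by blast
        let ?u = "\<iota> g \<cdot> k"
        have uK: "?u \<in> K" by (rule K_mult[OF K_inv[OF gK] k])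
        have "?u s = s"
          using qaut_mult_apply[OF qaut_inv[OF K_qaut[OF gK]] K_qaut[OF k] s(1)] qaut_inv_apply[OF K_qaut[OF gK] s(1)] g by simp
        then have "?u \<in> ?M" using Ker_fixed[OF K_D[OF uK] s(1)] uK by simp
        then have "?u \<in> W" using MW by blast
        then have "g \<cdot> ?u \<in> W" by (rule subgroup.m_closed[OF WA g(2)])
        moreover have "g \<cdot> ?u = k" using K_Bij[OF gK] K_Bij[OF k] by (simp flip: Sym.m_assoc)
        ultimately show ?thesis by simp
      qed
      then show ?thesis using WK by auto
    qed
  qed
  have hM: "h \<in> ?M" "h \<noteq> id\<^sub>Q" using h_K h subgroup.one_closed[OF subgroup_N] by auto
  have M1: "?M \<noteq> {\<one>\<^bsub>KG\<^esub>}" using hM by auto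
  have cyc: "\<exists>j::nat. c = d [^]\<^bsub>KG\<^esub> j"
    if "c \<in> ?M" "d \<in> ?M" "d \<noteq> \<one>\<^bsub>KG\<^esub>" "c [^]\<^bsub>KG\<^esub> q = \<one>\<^bsub>KG\<^esub>" "d [^]\<^bsub>KG\<^esub> q = \<one>\<^bsub>KG\<^esub>" for c d
    using K_Int_Ker_cyclic[of c d] that by (simp add: pow_KG)
  note struct = KG.extraspecial_structure[OF fin q M central comm' pow' hom surj \<alpha>M gen irr M1 cyc]
  show "card ?M = q" by (rule struct(1))
  show "group_center KG = ?M" by (rule struct(2))
  show "z [^]\<^bsub>A\<^esub> q = id\<^sub>Q" if "z \<in> ?M" for z using struct(3)[of z] that by (simp add: pow_KG)
  show "x [^]\<^bsub>A\<^esub> q = id\<^sub>Q" if "odd q" "x \<in> K" for x using struct(4)[of x] that by (simp add: pow_KG)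
qed

lemma h_pow_q: "h [^]\<^bsub>A\<^esub> q = id\<^sub>Q" and h_neq_one: "h \<noteq> id\<^sub>Q"
  using K_Int_Ker_pow h_K h subgroup.one_closed[OF subgroup_N] by auto

lemma card_S: "card S = q ^ n"
proof -
  have "bij_betw (\<lambda>x. r `` {x}) S (carrier X)"
  proof (rule bij_betw_imageI)
    show "inj_on (\<lambda>x. r `` {x}) S"
      by (rule inj_onI) (use class_eq_iff S_carrier S_unique in metis)
    show "(\<lambda>x. r `` {x}) ` S = carrier X"
    proof
      show "(\<lambda>x. r `` {x}) ` S \<subseteq> carrier X" using class_X S_carrier by auto
      show "carrier X \<subseteq> (\<lambda>x. r `` {x}) ` S"
      proof
        fix B assume B: "B \<in> carrier X"
        obtain x where x: "x \<in> carrier Q" "B = r `` {x}" using X_cases[OF B] by blast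
        obtain y where y: "y \<in> S" "(x, y) \<in> r" using S_meets[OF x(1)] .
        show "B \<in> (\<lambda>x. r `` {x}) ` S" unfolding x(2) class_eq[OF y(2)] by (rule imageI[OF y(1)])
      qed
    qed
  qed
  then show ?thesis using bij_betw_same_card card_X by metis
qed

lemma card_K: "card K = q ^ Suc n"
proof -
  interpret act: group_action KG "carrier Q" "\<lambda>h. h" by (rule Bij_subgroup_action[OF subgroup_K])
  have "orbit KG (\<lambda>h. h) s = S"
  proof
    show "orbit KG (\<lambda>h. h) s \<subseteq> S" using K_S[OF _ s_S] by (auto simp: orbit_def)
    show "S \<subseteq> orbit KG (\<lambda>h. h) s" using K_transitive by (fastforce simp: orbit_def)
  qed
  moreover have "stabilizer KG (\<lambda>h. h) s = K \<inter> Ker"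
    unfolding stabilizer_def using Ker_fixed[OF K_D s(1)] K_Ker_fixes_S s_S by auto
  ultimately show ?thesis
    using act.orbit_stabilizer_theorem[OF s(1)] card_S card_K_Int_Ker by (simp add: order_def mult.commute)
qed

lemma extraspecial_KG: "extraspecial q KG"
proof -
  interpret KG: group KG by (rule group_KG)
  show ?thesis
  proof (rule KG.extraspecialI[OF _ q center_KG card_K_Int_Ker])
    show "finite (carrier KG)" using Bij_subgroup_finite[OF finite_carrier subgroup_K] by simp
    show "x \<otimes>\<^bsub>KG\<^esub> y \<otimes>\<^bsub>KG\<^esub> inv\<^bsub>KG\<^esub> (y \<otimes>\<^bsub>KG\<^esub> x) \<in> K \<inter> Ker" if "x \<in> carrier KG" "y \<in> carrier KG" for x y
      using K_commutator[of x y] that K_mult by (simp add: inv_KG)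
    show "x [^]\<^bsub>KG\<^esub> q \<in> K \<inter> Ker" if "x \<in> carrier KG" for x using K_pow_center[of x] that by (simp add: pow_KG)
    show "order KG = q ^ Suc n" using card_K by (simp add: order_def)
    show "1 \<le> n" by (rule XS.m_pos)
  qed
qed

lemma even_n: "even n"
proof -
  interpret KG: group KG by (rule group_KG)
  have "\<exists>k. card K = q ^ (2 * k + 1)"
  proof (rule KG.card_odd_prime_power_if_prime_center[OF q subgroup_K_Int_Ker card_K_Int_Ker])
    show "subgroup K KG" using KG.subgroup_self by simp
    show "finite K" using Bij_subgroup_finite[OF finite_carrier subgroup_K] .
    show "{z \<in> K. \<forall>g\<in>K. z \<otimes>\<^bsub>KG\<^esub> g = g \<otimes>\<^bsub>KG\<^esub> z} = K \<inter> Ker" using center_KG by (simp add: group_center_def)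
    show "x \<otimes>\<^bsub>KG\<^esub> y \<otimes>\<^bsub>KG\<^esub> inv\<^bsub>KG\<^esub> x \<otimes>\<^bsub>KG\<^esub> inv\<^bsub>KG\<^esub> y \<in> K \<inter> Ker" if "x \<in> K" "y \<in> K" for x y
      using K_commutator[OF that] K_Bij[OF that(1)] K_Bij[OF that(2)] that
      by (simp add: inv_KG Sym.inv_mult_group Sym.m_assoc)
  qed
  then obtain k where "q ^ Suc n = q ^ (2 * k + 1)" using card_K by auto
  then have "Suc n = 2 * k + 1" using power_inject_exp[OF prime_gt_1_nat[OF q]] by blast
  then show ?thesis by simp
qed

lemma exponent_KG: assumes "odd q" shows "group_exponent KG = q"
  unfolding group_exponent_def
proof (rule Least_equality)
  show "0 < q \<and> (\<forall>x\<in>carrier KG. x [^]\<^bsub>KG\<^esub> q = \<one>\<^bsub>KG\<^esub>)"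
    using K_exponent[OF assms] prime_gt_0_nat[OF q] by (simp add: pow_KG)
  fix e :: nat assume e: "0 < e \<and> (\<forall>x\<in>carrier KG. x [^]\<^bsub>KG\<^esub> e = \<one>\<^bsub>KG\<^esub>)"
  have hB: "h \<in> Bij (carrier Q)" by (rule K_Bij[OF h_K])
  have "Sym.ord (carrier Q) h = q" by (rule Sym.ord_eq_prime) (use hB h_pow_q h_neq_one q in auto)
  moreover have "h [^]\<^bsub>A\<^esub> e = id\<^sub>Q" using e h_K by (simp add: pow_KG)
  ultimately have "q dvd e" using Sym.pow_eq_id[of h "carrier Q" e] hB by simp
  then show "q \<le> e" using e by (auto dest: dvd_imp_le)
qed

lemma q_dvd: "q dvd p ^ m - 1"
proof -
  interpret B: simple_homogeneous "block s" p m by (rule block_simple[OF s(1)])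
  have ss: "(s, s) \<in> r" by (rule r_refl[OF s(1)])
  obtain y where y: "(s, y) \<in> r" "y \<noteq> s" using class_nontrivial[OF s(1)] by blast
  show ?thesis
  proof (rule B.prime_dvd_card_minus_one[OF res_qaut[OF h(1) s(1)] _ _ _ q])
    show "res s h \<noteq> \<one>\<^bsub>B.A\<^esub>"
    proof
      assume "res s h = \<one>\<^bsub>B.A\<^esub>"
      then have "h y = y" using res_eq_one[OF s(1) _ y(1)] by simp
      then show False using fixed_points_unique[OF h y(1) s(2)] y(2) by simp
    qed
    show "s \<in> carrier (block s)" using ss by simp
    show "res s h s = s" using ss s by (simp add: res_apply)
    show "res s h [^]\<^bsub>B.A\<^esub> q = \<one>\<^bsub>B.A\<^esub>"
      using res_pow[OF h(1) s(1), of q] h_pow_q res_one[OF s(1)] by simp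
  qed
qed

text \<open>The upper bound holds because an element of \<open>N\<close> is determined by its values at \<open>s\<close> and at a point \<open>w\<close> of
another class: fixing \<open>s\<close> it fixes the class of \<open>s\<close>, and this class generates \<open>Q\<close> together with \<open>w\<close>.\<close>

lemma card_N_bounds:
  assumes t: "card N = p ^ t" shows "m \<le> t" and "t \<le> m + m"
proof -
  have finN: "finite N" by (rule Bij_subgroup_finite[OF finite_carrier subgroup_N])
  have p1: "1 < p" by (rule prime_gt_1_nat[OF p])
  have "r `` {s} \<subseteq> (\<lambda>v. v s) ` N" using N_transitive by fastforce
  then have "card (r `` {s}) \<le> card ((\<lambda>v. v s) ` N)" by (intro card_mono finite_imageI finN)
  also have "\<dots> \<le> card N" by (rule card_image_le[OF finN])
  finally show "m \<le> t" using card_class[OF s(1)] t p1 by simp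
  obtain w where w: "w \<in> carrier Q" "(s, w) \<notin> r" using other_class[OF s(1)] by blast
  have fc: "finite (r `` {x})" for x using finite_subset[OF _ finite_carrier] r_carrier by blast
  have "inj_on (\<lambda>v. (v s, v w)) N"
  proof (rule inj_onI)
    fix u v assume u: "u \<in> N" and v: "v \<in> N" and e: "(u s, u w) = (v s, v w)"
    let ?g = "\<iota> v \<cdot> u"
    have g: "?g \<in> N" by (rule N_mult[OF N_inv[OF v] u])
    have gq: "?g \<in> qaut Q" by (rule Ker_qaut[OF N_Ker[OF g]])
    have uvq: "u \<in> qaut Q" "v \<in> qaut Q" using u v N_Ker Ker_qaut by auto
    have gx: "?g x = x" if "x \<in> carrier Q" "u x = v x" for x
      using qaut_mult_apply[OF qaut_inv[OF uvq(2)] uvq(1) that(1)] qaut_inv_apply[OF uvq(2) that(1)] that(2) by simp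
    have "{x \<in> carrier Q. ?g x = x} = carrier Q"
    proof (rule class_and_point_generate[OF subquandle_fixed_points[OF gq] s(1) _ _ w(2)])
      have gs: "?g s = s" using gx[OF s(1)] e by simp
      show "r `` {s} \<subseteq> {x \<in> carrier Q. ?g x = x}" using N_fixed[OF g s(1) gs] r_carrier by blast
      show "w \<in> {x \<in> carrier Q. ?g x = x}" using gx[OF w(1)] e w(1) by simp
    qed
    then have "?g = id\<^sub>Q" by (intro N_fixing_S[OF g]) (use S_carrier in blast)
    moreover have "v \<cdot> ?g = u" using qaut_Bij[OF uvq(1)] qaut_Bij[OF uvq(2)] by (simp flip: Sym.m_assoc)
    ultimately show "u = v" using qaut_Bij[OF uvq(2)] by simp
  qed
  moreover have "(\<lambda>v. (v s, v w)) ` N \<subseteq> r `` {s} \<times> r `` {w}"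
    using Ker_r[OF N_Ker] s(1) w(1) by blast
  ultimately have "card N \<le> card (r `` {s} \<times> r `` {w})" using card_inj_on_le fc by blast
  also have "\<dots> = p ^ (m + m)" using card_class s(1) w(1) by (simp add: card_cartesian_product power_add)
  finally show "t \<le> m + m" using t p1 by simp
qed

lemma conclusion:
  "\<exists>(k :: nat) (K :: ('a \<Rightarrow> 'a) monoid) \<rho>.
     k \<le> m \<and> extraspecial q K \<and> \<rho> \<in> hom K (AutoGroup (elem_abelian_power p (m + k))) \<and>
     Dis Q \<cong> semidirect_product (elem_abelian_power p (m + k)) K \<rho> \<and>
     q dvd p ^ m - 1 \<and> even n \<and> (odd q \<longrightarrow> group_exponent K = q)"
proof -
  let ?NG = "A\<lparr>carrier := N\<rparr>"
  have NGg: "group ?NG" by (rule subgroup.subgroup_is_group[OF subgroup_N group_BijGroup])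
  have NGc: "comm_group ?NG" by (rule group.group_comm_groupI[OF NGg]) (simp add: N_comm)
  have "\<exists>t. card (carrier ?NG) = p ^ t \<and> ?NG \<cong> elem_abelian_power p t"
    by (rule comm_group_elementary_abelian_iso[OF NGc _ p])
       (use Bij_subgroup_finite[OF finite_carrier subgroup_N] N_pow_p in \<open>simp_all flip: Sym.nat_pow_consistent\<close>)
  then obtain t f where t: "card N = p ^ t" and f: "f \<in> iso ?NG (elem_abelian_power p t)"
    by (auto simp: is_iso_def)
  interpret DG: group "Dis Q" by (simp add: Dis_def)
  have "N \<subseteq> D" using N_Ker Ker_D by blast
  from Sym.subgroup_incl[OF subgroup_N subgroup_D this] have ND: "subgroup N (Dis Q)" by (simp flip: Dis_eq)
  from Sym.subgroup_incl[OF subgroup_K subgroup_D K_subset_D] have KD: "subgroup K (Dis Q)" by (simp flip: Dis_eq)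
  have multD: "g \<otimes>\<^bsub>Dis Q\<^esub> k = g \<cdot> k" and oneD: "\<one>\<^bsub>Dis Q\<^esub> = id\<^sub>Q" for g k by (simp_all add: Dis_def)
  have invD: "inv\<^bsub>Dis Q\<^esub> g = \<iota> g" if "g \<in> D" for g
    using Sym.m_inv_consistent[OF subgroup_D that] by (simp flip: Dis_eq)
  have car: "Dis Q\<lparr>carrier := H\<rparr> = A\<lparr>carrier := H\<rparr>" for H by (subst Dis_eq) simp
  have normal: "N \<lhd> Dis Q"
    by (rule DG.normal_invI[OF ND]) (use N_conj_D in \<open>simp add: multD invD\<close>)
  have E: "group (elem_abelian_power p t)" by (simp add: elem_abelian_power_def)
  have "\<exists>\<rho>. \<rho> \<in> hom (Dis Q\<lparr>carrier := K\<rparr>) (AutoGroup (elem_abelian_power p t)) \<and>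
      Dis Q \<cong> semidirect_product (elem_abelian_power p t) (Dis Q\<lparr>carrier := K\<rparr>) \<rho>"
  proof (rule DG.internal_semidirect_product[OF normal KD _ _ E])
    show "N \<inter> K = {\<one>\<^bsub>Dis Q\<^esub>}" unfolding oneD by (rule N_Int_K)
    show "\<exists>v\<in>N. \<exists>k\<in>K. g = v \<otimes>\<^bsub>Dis Q\<^esub> k" if "g \<in> D" for g unfolding multD by (rule D_factorization[OF that])
    show "f \<in> iso (Dis Q\<lparr>carrier := N\<rparr>) (elem_abelian_power p t)" unfolding car by (rule f)
  qed
  then obtain \<rho> where \<rho>: "\<rho> \<in> hom KG (AutoGroup (elem_abelian_power p t))"
      "Dis Q \<cong> semidirect_product (elem_abelian_power p t) KG \<rho>"
    unfolding car by blast
  have tm: "m + (t - m) = t" "t - m \<le> m" using card_N_bounds[OF t] by auto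
  show ?thesis
    by (rule exI[of _ "t - m"], rule exI[of _ KG], rule exI[of _ \<rho>])
       (use tm \<rho> extraspecial_KG q_dvd even_n exponent_KG in simp)
qed

end

section \<open>The displacement group\<close>

theorem theorem3p13:
  fixes p q m n :: nat and Q :: "'a magma"
  assumes "prime p" and "prime q" and "1 \<le> m" and "1 \<le> n" and "p ^ m > 2"
    and "Q \<in> LSS_class (p ^ m) (q ^ n) (sigma_rel Q)"
    and "sigma_rel Q \<inter> gamma_cong Q = zero_cong Q"
  shows "\<exists>(k :: nat) (K :: ('a \<Rightarrow> 'a) monoid) \<rho>.
           k \<le> m \<and>
           extraspecial q K \<and>
           \<rho> \<in> hom K (AutoGroup (elem_abelian_power p (m + k))) \<and>
           Dis Q \<cong> semidirect_product (elem_abelian_power p (m + k)) K \<rho> \<and>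
           q dvd p ^ m - 1 \<and>
           even n \<and>
           (odd q \<longrightarrow> group_exponent K = q)"
proof -
  have fin: "finite (carrier Q)" and conn: "connected_quandle Q" and na: "\<not> abelian_quandle Q"
    and lss: "locally_strictly_simple Q"
    using assms(6) by (auto simp: LSS_class_def)
  obtain r where r: "{s. qcongruence Q s \<and> s \<noteq> zero_cong Q \<and> s \<noteq> one_cong Q} = {r}"
      "card (carrier (qfactor Q r)) = q ^ n" "\<forall>B\<in>carrier Q // r. card B = p ^ m"
    using assms(6) unfolding LSS_class_def by blast
  have rc: "qcongruence Q r" "r \<noteq> one_cong Q" using r(1) by blast+
  have qd: "quandle Q" and tr: "transitive_action (Dis Q) (carrier Q) (\<lambda>h. h)"
    using conn by (auto simp: connected_quandle_def)
  interpret quandle_congruence Q r by unfold_locales (rule qd, rule fin, rule rc(1))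
  interpret lss_quandle Q r p q m n
  proof unfold_locales
    show "\<exists>g\<in>D. g x = y" if "x \<in> carrier Q" "y \<in> carrier Q" for x y
      using transitive_action.unique_orbit[OF tr that] .
    show "strictly_simple (Q\<lparr>carrier := T\<rparr>)" if "proper_subquandle Q T" for T
      using lss that by (simp add: locally_strictly_simple_def)
    show "s = zero_cong Q \<or> s = r \<or> s = one_cong Q" if "qcongruence Q s" for s
      using r(1) that by blast
    show "card (r `` {x}) = p ^ m" if "x \<in> carrier Q" for x
      using r(3) that by (simp add: quotientI)
  qed (use assms na rc r in auto)
  obtain x g y where x: "x \<in> carrier Q" "g \<in> Ker" "g x = x" "(x, y) \<in> r" "g y \<noteq> y"
    using stabilizer_moves_class by blast
  have "g \<notin> N" using N_fixed[of g x y] x by blast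
  then interpret lss_section Q r p q m n g x by unfold_locales (use x in auto)
  show ?thesis by (rule conclusion)
qed

end
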